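(* Let $1\le s<\infty$, $1\le p\le\infty$, let $r_1\ge r_2\ge1$ be integers, let $\mu>2r_1+1/2-1/s$, let $f\in L^\mu_{s,2}$ with $\|f\|_{s,\mu}\le1$, and let the perturbed coefficients $\{\langle f_\delta,\varphi_{k,j}\rangle\}_{k,j\ge0}$ satisfy $\|\overline\xi\|_{\ell_p}\le\delta$, where $\overline\xi=\{\langle f-f_\delta,\varphi_{k,j}\rangle\}_{k,j\ge0}$. Then, for all sufficiently small $\delta\in(0,1)$: I) If $r_1=r_2$, then for $n\asymp\left(\delta/\ln^{1/p-1/s}\frac1\delta\right)^{-\frac1{\mu-1/p+1/s}}$ and $\gamma=1$ $$\|f^{(r_1,r_1)}-\mathcal D^{(r_1,r_1)}_{n,1}f_\delta\|_{L_2}\le c\left(\delta\ln^{1/s-1/p}\tfrac1\delta\right)^{\frac{\mu-2r_1+1/s-1/2}{\mu-1/p+1/s}}\ln^{3/2-1/s}\tfrac1\delta .$$ II) If $r_1>r_2$, then: a) for $n\asymp\delta^{-\frac1{\mu-1/p+1/s}}$ and any $$\gamma\in\left[1,\tfrac{\mu-2r_2+1/s-1/2}{\mu-2r_1+1/s+1/2}\right)\cup\left(\tfrac{\mu-2r_2+1/s-1/2}{\mu-2r_1+1/s+1/2},\tfrac{\mu-2r_2+1/s+1/2}{\mu-2r_1+1/s+1/2}\right)\cup\left(\tfrac{\mu-2r_2+1/s+1/2}{\mu-2r_1+1/s+1/2},\tfrac{\mu-2r_2+1/s-1/2}{\mu-2r_1+1/s-1/2}\right)$$ $$\|f^{(r_1,r_2)}-\mathcal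 D^{(r_1,r_2)}_{n,\gamma}f_\delta\|_{L_2}\le c\,\delta^{\frac{\mu-2r_1+1/s-1/2}{\mu-1/p+1/s}};$$ b) for $n\asymp\delta^{-\frac1{\mu-1/p+1/s}}\ln^{\frac1{2(\mu-1/p+1/s)}}\frac1\delta$ and $\gamma=\frac{\mu-2r_2+1/s-1/2}{\mu-2r_1+1/s+1/2}$ or $\gamma=\frac{\mu-2r_2+1/s-1/2}{\mu-2r_1+1/s-1/2}$ $$\|f^{(r_1,r_2)}-\mathcal D^{(r_1,r_2)}_{n,\gamma}f_\delta\|_{L_2}\le c\left(\delta/\ln^{1/2}\tfrac1\delta\right)^{\frac{\mu-2r_1+1/s-1/2}{\mu-1/p+1/s}}\ln^{1/2}\tfrac1\delta;$$ c) for $n\asymp\left(\delta/\ln^{1-1/s}\frac1\delta\right)^{-\frac1{\mu-1/p+1/s}}$ and $\gamma=\frac{\mu-2r_2+1/s+1/2}{\mu-2r_1+1/s+1/2}$ $$\|f^{(r_1,r_2)}-\mathcal D^{(r_1,r_2)}_{n,\gamma}f_\delta\|_{L_2}\le c\left(\delta/\ln^{1-1/s}\tfrac1\delta\right)^{\frac{\mu-2r_1+1/s-1/2}{\mu-1/p+1/s}}\ln^{1-1/s}\tfrac1\delta .$$ Here $c>0$ depends only on $\mu,s,p,r_1,r_2,\gamma$ and the constants implied in the choice of $n$, not on $f$, $f_\delta$, $\delta$, $n$.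
   Context: Convention: $1/\infty=0$; $a\asymp b$ means two-sided bounds with positive constants independent of $\delta$ and $n$. Let $\varphi_k(t)=\sqrt{k+1/2}\,(2^kk!)^{-1}\frac{d^k}{dt^k}[(t^2-1)^k]$, $k=0,1,2,\dots$, be the Legendre polynomials orthonormal on $[-1,1]$, let $Q=[-1,1]^2$, $L_2=L_2(Q)$, and for $f\in L_2(Q)$ let $\langle f,\varphi_{k,j}\rangle=\int_{-1}^1\int_{-1}^1 f(t,\tau)\varphi_k(t)\varphi_j(\tau)\,d\tau\,dt$. With $\underline{k}=\max\{1,k\}$, for $\mu>0$, $1\le s<\infty$, $$L^\mu_{s,2}=\Big\{f\in L_2(Q):\ \|f\|_{s,\mu}^s:=\sum_{k,j=0}^\infty(\underline{k}\cdot\underline{j})^{s\mu}|\langle f,\varphi_{k,j}\rangle|^s<\infty\Big\};$$ the same symbol denotes its unit ball. The mixed derivative of $f=\sum_{k,j\ge0}\langle f,\varphi_{k,j}\rangle\varphi_k(t)\varphi_j(\tau)$ is the series $f^{(r_1,r_2)}(t,\tau)=\sum_{k=r_1}^\infty\sum_{j=r_2}^\infty\langle f,\varphi_{k,j}\rangle\varphi_k^{(r_1)}(t)\varphi_j^{(r_2)}(\tau)$. The perturbed data $\{\langle f_\delta,\varphi_{k,j}\rangle\}_{k,j\ge0}$ form a numerical sequence, and $\langle f-f_\delta,\varphi_{k,j}\rangle:=\langle f,\varphi_{k,j}\rangle-\langle f_\delta,\varphi_{k,j}\rangle$; $\ell_p$ carries the usual norm on double sequences. Truncation method: for $\gamma\ge1$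 and $n>0$ let $\Gamma_{n,\gamma}=\{(k,j)\in\mathbb N^2:\ k\ge r_1,\ j\ge r_2,\ k\,j^\gamma\le n\}$ and $$\mathcal D^{(r_1,r_2)}_{n,\gamma}f_\delta(t,\tau)=\sum_{(k,j)\in\Gamma_{n,\gamma}}\langle f_\delta,\varphi_{k,j}\rangle\varphi_k^{(r_1)}(t)\varphi_j^{(r_2)}(\tau).$$ *)

theory Defs
  imports "HOL-Analysis.Analysis" "HOL-Computational_Algebra.Polynomial"
begin

text \<open>Rodrigues' formula for the Legendre polynomials, normalised to be orthonormal on [-1,1].\<close>

definition legendre :: "nat \<Rightarrow> real poly" where
  "legendre k =
     smult (sqrt (real k + 1/2) * inverse (2 ^ k * fact k)) ((pderiv ^^ k) ([:-1, 0, 1:] ^ k))"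

text \<open>The r-th derivative of the k-th orthonormal Legendre polynomial.\<close>

definition legendre_deriv :: "nat \<Rightarrow> nat \<Rightarrow> real \<Rightarrow> real" where
  "legendre_deriv r k t = poly ((pderiv ^^ r) (legendre k)) t"

definition Qsq :: "(real \<times> real) set" where
  "Qsq = {-1..1} \<times> {-1..1}"

definition in_L2 :: "(real \<times> real \<Rightarrow> real) \<Rightarrow> bool" where
  "in_L2 f \<longleftrightarrow> f \<in> borel_measurable (lebesgue_on Qsq) \<and> integrable (lebesgue_on Qsq) (\<lambda>x. (f x)\<^sup>2)"

text \<open>Meaningful only for functions satisfying \<^const>\<open>in_L2\<close>: the Bochner integral of a
  non-integrable function is 0.\<close>

definition L2_norm :: "(real \<times> real \<Rightarrow> real) \<Rightarrow> real" where
  "L2_norm f = sqrt (LINT x|lebesgue_on Qsq. (f x)\<^sup>2)"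

definition coef :: "(real \<times> real \<Rightarrow> real) \<Rightarrow> nat \<Rightarrow> nat \<Rightarrow> real" where
  "coef f k j =
     (LINT t|lebesgue_on {-1..1}. LINT \<tau>|lebesgue_on {-1..1}.
        f (t, \<tau>) * poly (legendre k) t * poly (legendre j) \<tau>)"

definition smooth_term :: "real \<Rightarrow> real \<Rightarrow> (real \<times> real \<Rightarrow> real) \<Rightarrow> nat \<times> nat \<Rightarrow> real" where
  "smooth_term s \<mu> f = (\<lambda>(k, j).
     (real (max 1 k) * real (max 1 j)) powr (s * \<mu>) * \<bar>coef f k j\<bar> powr s)"

definition smooth_class :: "real \<Rightarrow> real \<Rightarrow> (real \<times> real \<Rightarrow> real) set" where
  "smooth_class s \<mu> = {f. in_L2 f \<and> smooth_term s \<mu> f summable_on UNIV}"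

definition smooth_norm :: "real \<Rightarrow> real \<Rightarrow> (real \<times> real \<Rightarrow> real) \<Rightarrow> real" where
  "smooth_norm s \<mu> f = (\<Sum>\<^sub>\<infinity>i\<in>UNIV. smooth_term s \<mu> f i) powr (1 / s)"

definition in_lp :: "ereal \<Rightarrow> (nat \<times> nat \<Rightarrow> real) \<Rightarrow> bool" where
  "in_lp p \<xi> \<longleftrightarrow>
     (if p = \<infinity> then bounded (range \<xi>)
      else (\<lambda>i. \<bar>\<xi> i\<bar> powr real_of_ereal p) summable_on UNIV)"

definition lp_norm :: "ereal \<Rightarrow> (nat \<times> nat \<Rightarrow> real) \<Rightarrow> real" where
  "lp_norm p \<xi> =
     (if p = \<infinity> then (SUP i. \<bar>\<xi> i\<bar>)
      else (\<Sum>\<^sub>\<infinity>i\<in>UNIV. \<bar>\<xi> i\<bar> powr real_of_ereal p) powr (1 / real_of_ereal p))"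

text \<open>\<open>has_mixed_deriv r1 r2 f g\<close>: the term-by-term differentiated Legendre series of f converges
  in L2 to g, as a net of finite partial sums.  Such a g is unique up to a null set.\<close>

definition has_mixed_deriv ::
    "nat \<Rightarrow> nat \<Rightarrow> (real \<times> real \<Rightarrow> real) \<Rightarrow> (real \<times> real \<Rightarrow> real) \<Rightarrow> bool" where
  "has_mixed_deriv r1 r2 f g \<longleftrightarrow> in_L2 g \<and>
     ((\<lambda>F. L2_norm (\<lambda>(t, \<tau>). g (t, \<tau>) -
          (\<Sum>(k, j)\<in>F. coef f k j * legendre_deriv r1 k t * legendre_deriv r2 j \<tau>)))
      \<longlongrightarrow> 0) (finite_subsets_at_top ({r1..} \<times> {r2..}))"

definition hyp_cross :: "nat \<Rightarrow> nat \<Rightarrow> real \<Rightarrow> real \<Rightarrow> (nat \<times> nat) set" where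
  "hyp_cross r1 r2 n \<gamma> = {(k, j). r1 \<le> k \<and> r2 \<le> j \<and> real k * real j powr \<gamma> \<le> n}"

definition trunc_deriv ::
    "nat \<Rightarrow> nat \<Rightarrow> real \<Rightarrow> real \<Rightarrow> (nat \<Rightarrow> nat \<Rightarrow> real) \<Rightarrow> real \<times> real \<Rightarrow> real" where
  "trunc_deriv r1 r2 n \<gamma> y = (\<lambda>(t, \<tau>).
     \<Sum>(k, j)\<in>hyp_cross r1 r2 n \<gamma>. y k j * legendre_deriv r1 k t * legendre_deriv r2 j \<tau>)"

text \<open>The truncation method with parameter \<open>\<gamma>\<close> and any \<open>n\<close> between \<open>c1 * N \<delta>\<close> and \<open>c2 * N \<delta>\<close>
  has L2 error at most \<open>c * B \<delta>\<close>, uniformly over the unit ball and over all admissible data \<open>y\<close>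
  (the perturbed coefficients).  The constant \<open>c\<close> and the threshold \<open>\<delta>0\<close> are chosen before
  \<open>\<delta>\<close>, \<open>n\<close>, \<open>f\<close> and \<open>y\<close>.\<close>

definition error_rate ::
    "real \<Rightarrow> real \<Rightarrow> ereal \<Rightarrow> nat \<Rightarrow> nat \<Rightarrow> real \<Rightarrow> real \<Rightarrow> real \<Rightarrow> (real \<Rightarrow> real) \<Rightarrow> (real \<Rightarrow> real) \<Rightarrow> bool" where
  "error_rate s \<mu> p r1 r2 \<gamma> c1 c2 N B \<longleftrightarrow>
     (\<exists>c>0. \<exists>\<delta>0\<in>{0<..<1}. \<forall>\<delta>\<in>{0<..<\<delta>0}. \<forall>n f y.
        c1 * N \<delta> \<le> n \<and> n \<le> c2 * N \<delta> \<and>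
        f \<in> smooth_class s \<mu> \<and> smooth_norm s \<mu> f \<le> 1 \<and>
        in_lp p (\<lambda>(k, j). coef f k j - y k j) \<and>
        lp_norm p (\<lambda>(k, j). coef f k j - y k j) \<le> \<delta> \<longrightarrow>
        (\<exists>g. has_mixed_deriv r1 r2 f g \<and>
             L2_norm (\<lambda>x. g x - trunc_deriv r1 r2 n \<gamma> y x) \<le> c * B \<delta>))"

end

theory Submission
  imports Defs "HOL-Real_Asymp.Real_Asymp"
begin

text \<open>The Legendre coefficients of \<open>\<phi>\<^sub>k\<^sup>(\<^sup>r\<^sup>)\<close> are \<open>O(k powr (2 r - 3/2) * l powr (1/2))\<close>, so its \<open>L\<^sub>2\<close> norm is
  \<open>O(k powr (2 r - 1/2))\<close>.  The triangle inequality and Hoelder's inequality then bound the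
  truncation error and the propagated data error by \<open>\<ell>\<^sub>p\<close> norms of explicit power weights outside
  and inside the hyperbolic cross, and the choice of \<open>n\<close> balances the two.  This loses a power of
  the logarithm only at the largest admissible \<open>\<gamma>\<close> when \<open>s > 2\<close>; there orthogonality is exploited
  through a Hardy inequality, which bounds the squared error by the squares of the coefficients
  with weights \<open>k powr (4 r\<^sub>1) * j powr (4 r\<^sub>2)\<close>.\<close>

section \<open>Orthonormal Legendre polynomials and their derivatives\<close>

text \<open>Write \<open>a = \<mu> - 2 r1 + 1/s - 1/2\<close>,
  \<open>b = \<mu> - 2 r2 + 1/s - 1/2\<close> and \<open>q = 1/p\<close>. Summing over
  \<open>k\<close> first leaves a single sum over powers of \<open>j\<close>, and a logarithm can
  appear only where that sum is harmonic. Outside the cross this happens at \<gamma> = b/a, the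
  largest admissible value; inside the cross only for r1 = r2 and \<gamma> = 1. If r1 = r2 then b/a
  = 1, so both sums are critical at once, which is why case I carries logarithms from both error
  terms. For r2 < r1 the breakpoints b/(a+1) and (b+1)/(a+1) lie strictly below b/a; neither sum is
  critical there, and the logarithms in those rates enter only through the choice of
  \<open>n\<close>. The truncation error is of order \<open>n powr (-a)\<close> and the data error
  of order \<open>\<delta> * n powr (2 r1 + 1/2 - q)\<close>, up to logarithms. The two exponents
  add up to \<open>M = \<mu> - q + 1/s\<close>, the number that governs the choice of
  \<open>n\<close>.\<close>

definition poly_ip :: "real poly \<Rightarrow> real poly \<Rightarrow> real" where
  "poly_ip p q = integral {-1..1} (\<lambda>t. poly p t * poly q t)"

lemma poly_mult_integrable: "(\<lambda>t. poly p t * poly q t) integrable_on {-1..1::real}"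
  by (intro integrable_continuous_real continuous_intros)

lemma poly_ip_commute: "poly_ip p q = poly_ip q p"
  unfolding poly_ip_def by (simp add: mult.commute)

lemma poly_ip_add: "poly_ip (p + p') q = poly_ip p q + poly_ip p' q"
  unfolding poly_ip_def
  by (simp add: distrib_right integral_add[OF poly_mult_integrable poly_mult_integrable])

lemma poly_ip_smult: "poly_ip (smult a p) q = a * poly_ip p q"
  unfolding poly_ip_def by (simp add: mult.assoc)

lemma poly_ip_0: "poly_ip 0 q = 0"
  unfolding poly_ip_def by simp

lemma poly_ip_sum: "poly_ip (\<Sum>i\<in>I. p i) q = (\<Sum>i\<in>I. poly_ip (p i) q)"
  by (induction I rule: infinite_finite_induct) (auto simp: poly_ip_add poly_ip_0)

text \<open>Integration by parts, from the fundamental theorem of calculus for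
  \<open>p * q\<close>.\<close>

lemma poly_ip_pderiv:
  "poly_ip (pderiv p) q = poly p 1 * poly q 1 - poly p (-1) * poly q (-1) - poly_ip p (pderiv q)"
proof -
  have "((\<lambda>t. poly (pderiv (p * q)) t) has_integral poly (p * q) 1 - poly (p * q) (-1)) {-1..1::real}"
    by (rule fundamental_theorem_of_calculus)
      (auto intro!: has_field_derivative_at_within poly_DERIV
        simp del: poly_mult simp flip: has_real_derivative_iff_has_vector_derivative)
  then have "integral {-1..1} (\<lambda>t. poly (pderiv (p * q)) t) = poly (p * q) 1 - poly (p * q) (-1)"
    by (rule integral_unique)
  moreover have "integral {-1..1} (\<lambda>t. poly (pderiv (p * q)) t)
      = poly_ip (pderiv p) q + poly_ip p (pderiv q)"
    unfolding poly_ip_def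
    by (subst integral_add[OF poly_mult_integrable poly_mult_integrable, symmetric])
      (intro integral_cong, simp add: pderiv_mult mult.commute add.commute)
  ultimately show ?thesis by simp
qed

text \<open>One differentiation destroys at most one factor \<open>w\<close>. Iterated, this keeps
  factors \<open>t^2 - 1\<close> in every derivative of \<open>(t^2 - 1)^k\<close> of order below
  \<open>k\<close>.\<close>

lemma power_dvd_pderiv: "w ^ Suc m dvd p \<Longrightarrow> w ^ m dvd pderiv (p :: real poly)"
proof -
  assume "w ^ Suc m dvd p"
  then obtain r where r: "p = w ^ Suc m * r" by (elim dvdE)
  have "pderiv p = w ^ m * (w * pderiv r + smult (of_nat (Suc m)) (pderiv w) * r)"
    unfolding r by (simp add: pderiv_mult pderiv_power_Suc algebra_simps del: power_Suc)
      (simp add: algebra_simps)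
  then show ?thesis by simp
qed

lemma power_dvd_higher_pderiv: "i \<le> k \<Longrightarrow> (w :: real poly) ^ (k - i) dvd (pderiv ^^ i) (w ^ k)"
proof (induction i)
  case (Suc i)
  then have "w ^ Suc (k - Suc i) dvd (pderiv ^^ i) (w ^ k)"
    by (simp add: Suc_diff_Suc del: power_Suc)
  then show ?case by (simp add: power_dvd_pderiv)
qed simp

text \<open>A surviving factor \<open>t^2 - 1\<close> vanishes at both endpoints. These are the
  boundary terms met when the derivatives of Rodrigues' formula are moved to the other
  factor.\<close>

lemma poly_rodrigues_lower_endpoints:
  assumes "i < k"
  shows "poly ((pderiv ^^ i) ([:-1, 0, 1:] ^ k)) (1::real) = 0"
    and "poly ((pderiv ^^ i) ([:-1, 0, 1:] ^ k)) (-1::real) = 0"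
proof -
  have "[:-1, 0, 1:] ^ (k - i) dvd (pderiv ^^ i) ([:-1, 0, 1::real:] ^ k)"
    using assms by (intro power_dvd_higher_pderiv) simp
  then obtain r where r: "(pderiv ^^ i) ([:-1, 0, 1::real:] ^ k) = [:-1, 0, 1:] ^ (k - i) * r"
    by (elim dvdE)
  show "poly ((pderiv ^^ i) ([:-1, 0, 1:] ^ k)) (1::real) = 0"
    "poly ((pderiv ^^ i) ([:-1, 0, 1:] ^ k)) (-1::real) = 0"
    using assms unfolding r by (simp_all add: poly_power)
qed

text \<open>Repeated integration by parts; each boundary term involves a derivative of order below
  \<open>k\<close> and is zero. For \<open>i = k\<close> a polynomial of degree below
  \<open>k\<close> is annihilated, which is the orthogonality relation.\<close>

lemma poly_ip_rodrigues:
  "i \<le> k \<Longrightarrow> poly_ip ((pderiv ^^ i) ([:-1, 0, 1:] ^ k)) q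
      = (-1) ^ i * poly_ip ([:-1, 0, 1:] ^ k) ((pderiv ^^ i) q)"
proof (induction i arbitrary: q)
  case (Suc i)
  then have "poly_ip ((pderiv ^^ Suc i) ([:-1, 0, 1:] ^ k)) q
      = - poly_ip ((pderiv ^^ i) ([:-1, 0, 1:] ^ k)) (pderiv q)"
    by (simp add: poly_ip_pderiv poly_rodrigues_lower_endpoints)
  also have "\<dots> = (-1) ^ Suc i * poly_ip ([:-1, 0, 1:] ^ k) ((pderiv ^^ Suc i) q)"
    using Suc by (simp add: funpow_swap1)
  finally show ?case .
qed simp

section \<open>Endpoint values, orthonormality and finite Legendre expansions\<close>

lemma degree_higher_pderiv: "degree ((pderiv ^^ i) p) = degree (p :: real poly) - i"
  by (induction i) (auto simp: degree_pderiv)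

lemma higher_pderiv_eq_0: "degree p < i \<Longrightarrow> (pderiv ^^ i) (p :: real poly) = 0"
proof -
  assume "degree p < i"
  then obtain m where "i = Suc m" "degree p \<le> m" by (cases i) auto
  then show ?thesis by (simp add: pderiv_eq_0_iff degree_higher_pderiv)
qed

text \<open>At \<open>a\<close> only the Leibniz term in which all derivatives hit the power
  survives. The induction absorbs one derivative into the cofactor: \<open>q\<close> becomes
  \<open>(k + 1) q + (t - a) q'\<close>, whose value at \<open>a\<close> is
  \<open>(k + 1) q(a)\<close>.\<close>

lemma poly_higher_pderiv_root:
  "poly ((pderiv ^^ k) ([:-a, 1:] ^ k * q)) a = fact k * poly q (a::real)"
proof (induction k arbitrary: q)
  case (Suc k)
  have "pderiv ([:-a, 1:] ^ Suc k * q)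
      = [:-a, 1:] ^ k * (smult (real (Suc k)) q + [:-a, 1:] * pderiv q)"
    by (simp add: pderiv_mult pderiv_power_Suc pderiv_pCons algebra_simps del: power_Suc)
      (simp add: algebra_simps)
  then have "(pderiv ^^ Suc k) ([:-a, 1:] ^ Suc k * q)
      = (pderiv ^^ k) ([:-a, 1:] ^ k * (smult (real (Suc k)) q + [:-a, 1:] * pderiv q))"
    by (simp add: funpow_swap1 del: power_Suc)
  moreover have "poly (smult (real (Suc k)) q + [:-a, 1:] * pderiv q) a = real (Suc k) * poly q a"
    by simp
  ultimately show ?case by (simp only: Suc fact_Suc ac_simps of_nat_mult)
qed simp

text \<open>In \<open>(t - 1)^k (t + 1)^k\<close> the second factor is \<open>2^k\<close> at 1, so
  Rodrigues' derivative takes the value \<open>fact k * 2^k\<close>, exactly the inverse of the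
  factor in \<open>legendre\<close>.\<close>

lemma poly_legendre_1: "poly (legendre k) 1 = sqrt (real k + 1/2)"
proof -
  have "[:-1, 0, 1::real:] ^ k = [:-1, 1:] ^ k * [:1, 1:] ^ k"
    by (simp flip: power_mult_distrib)
  then have "poly ((pderiv ^^ k) ([:-1, 0, 1:] ^ k)) (1::real) = fact k * 2 ^ k"
    using poly_higher_pderiv_root[of k 1 "[:1, 1:] ^ k"] by (simp add: poly_power)
  then show ?thesis by (simp add: legendre_def field_simps)
qed

lemma poly_legendre_minus_1: "poly (legendre k) (-1) = (-1) ^ k * sqrt (real k + 1/2)"
proof -
  have "[:-1, 0, 1::real:] ^ k = [:1, 1:] ^ k * [:-1, 1:] ^ k"
    by (simp flip: power_mult_distrib)
  then have "poly ((pderiv ^^ k) ([:-1, 0, 1:] ^ k)) (-1::real) = fact k * (-2) ^ k"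
    using poly_higher_pderiv_root[of k "-1" "[:-1, 1:] ^ k"] by (simp add: poly_power)
  also have "\<dots> = (-1) ^ k * (fact k * 2 ^ k)"
    using power_mult_distrib[of "-1::real" 2 k] by simp
  finally have *: "poly ((pderiv ^^ k) ([:-1, 0, 1:] ^ k)) (-1::real) = (-1) ^ k * (fact k * 2 ^ k)" .
  have "inverse (2 ^ k * fact k) * (fact k * 2 ^ k) = (1::real)"
    by (subst mult.commute[of "fact k"]) (rule left_inverse, simp)
  moreover have "poly (legendre k) (-1)
      = ((-1) ^ k * sqrt (real k + 1/2)) * (inverse (2 ^ k * fact k) * (fact k * 2 ^ k))"
    by (simp only: legendre_def poly_smult *) (simp only: ac_simps)
  ultimately show ?thesis by simp
qed

lemma degree_legendre: "degree (legendre k) = k"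
proof -
  have "degree ([:-1, 0, 1::real:] ^ k) = 2 * k" by (simp add: degree_power_eq)
  then show ?thesis by (simp add: legendre_def degree_higher_pderiv)
qed

lemma poly_ip_legendre_lower_degree: "degree q < k \<Longrightarrow> poly_ip (legendre k) q = 0"
  by (simp add: legendre_def poly_ip_smult poly_ip_rodrigues higher_pderiv_eq_0 poly_ip_commute[of _ 0] poly_ip_0)

text \<open>The normalisation comes from integrating \<open>(t \<phi>\<^sub>k\<^sup>2)'\<close>: since \<open>t \<phi>\<^sub>k' - k \<phi>\<^sub>k\<close> has degree less
  than \<open>k\<close>, orthogonality gives \<open>(2 k + 1) \<integral> \<phi>\<^sub>k\<^sup>2 = \<phi>\<^sub>k(1)\<^sup>2 + \<phi>\<^sub>k(-1)\<^sup>2 = 2 k + 1\<close>.\<close>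

lemma poly_ip_legendre_self: "poly_ip (legendre k) (legendre k) = 1"
proof -
  let ?L = "legendre k" and ?d = "[:0, 1:] * pderiv (legendre k) + smult (- real k) (legendre k)"
  have lower: "poly_ip ?d ?L = 0"
  proof (cases "k = 0")
    case True
    then have "pderiv ?L = 0" by (simp add: pderiv_eq_0_iff degree_legendre)
    then show ?thesis using True by (simp add: poly_ip_0)
  next
    case False
    have "degree ?d < k"
    proof (rule degree_lessI)
      show "\<forall>n\<ge>k. coeff ?d n = 0"
      proof (intro allI impI)
        fix n assume "k \<le> n"
        then show "coeff ?d n = 0"
          using False
          by (cases n; cases "n = k") (auto simp: coeff_pderiv coeff_eq_0 degree_legendre algebra_simps)
      qed
    qed (use False in auto)
    then show ?thesis by (subst poly_ip_commute) (rule poly_ip_legendre_lower_degree)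
  qed
  have "poly_ip ([:0, 1:] * pderiv ?L) ?L = poly_ip (?d + smult (real k) ?L) ?L" by simp
  also have "\<dots> = real k * poly_ip ?L ?L"
    using poly_ip_add[of ?d "smult (real k) ?L" ?L] lower by (simp only: poly_ip_smult)
  finally have 1: "poly_ip ([:0, 1:] * pderiv ?L) ?L = real k * poly_ip ?L ?L" .
  have "pderiv ([:0, 1:] * ?L) = ?L + [:0, 1:] * pderiv ?L"
    by (simp add: pderiv_mult pderiv_pCons)
  then have "poly_ip ?L ?L + poly_ip ([:0, 1:] * pderiv ?L) ?L = poly_ip (pderiv ([:0, 1:] * ?L)) ?L"
    by (simp add: poly_ip_add)
  also have "\<dots> = 2 * real k + 1 - poly_ip ([:0, 1:] * ?L) (pderiv ?L)"
    using power_mult_distrib[of "(-1) ^ k" "sqrt (real k + 1/2)" 2]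
    by (simp add: poly_ip_pderiv poly_legendre_1 poly_legendre_minus_1 power2_eq_square[symmetric]
        power_even_eq[symmetric])
  also have "poly_ip ([:0, 1:] * ?L) (pderiv ?L) = poly_ip ([:0, 1:] * pderiv ?L) ?L"
    unfolding poly_ip_def by (simp add: ac_simps)
  finally have "(2 * real k + 1) * poly_ip ?L ?L = (2 * real k + 1) * 1"
    unfolding 1 by (simp add: algebra_simps)
  then show ?thesis by (subst (asm) mult_cancel_left) auto
qed

lemma poly_ip_legendre: "poly_ip (legendre k) (legendre l) = (if k = l then 1 else 0)"
proof (cases k l rule: linorder_cases)
  case less
  then show ?thesis
    by (simp add: poly_ip_commute[of "legendre k"] poly_ip_legendre_lower_degree degree_legendre)
qed (auto simp: poly_ip_legendre_self poly_ip_legendre_lower_degree degree_legendre)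

text \<open>Since \<open>legendre K\<close> has degree exactly \<open>K\<close>, leading terms can
  be peeled off one at a time; orthonormality then identifies the coefficients. The alternative
  \<open>p = 0\<close> makes the induction start at \<open>K = 0\<close>, where no degree is
  smaller.\<close>

lemma legendre_expansion:
  assumes "degree p < K \<or> p = 0"
  shows "p = (\<Sum>l<K. smult (poly_ip p (legendre l)) (legendre l))"
proof -
  have "\<exists>c. p = (\<Sum>l<K. smult (c l) (legendre l))"
    using assms
  proof (induction K arbitrary: p)
    case (Suc K)
    define a where "a = coeff p K / coeff (legendre K) K"
    \<comment> \<open>A vanishing leading coefficient would make the polynomial zero, but its value
      at 1 is positive.\<close>
    have nz: "coeff (legendre K) K \<noteq> 0"
      by (metis degree_legendre leading_coeff_0_iff poly_legendre_1 poly_0 real_sqrt_eq_zero_cancel_iff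
          add_nonneg_eq_0_iff divide_eq_0_iff of_nat_0_le_iff zero_le_divide_1_iff zero_le_numeral
          one_neq_zero zero_neq_numeral)
    have "degree (p - smult a (legendre K)) < K \<or> p - smult a (legendre K) = 0"
    proof (cases "K = 0")
      case True
      have "p - smult a (legendre K) = 0"
      proof (rule poly_eqI)
        fix n
        show "coeff (p - smult a (legendre K)) n = coeff 0 n"
          using Suc.prems True nz
          by (cases n) (auto simp: a_def coeff_eq_0 degree_legendre)
      qed
      then show ?thesis ..
    next
      case False
      have "degree (p - smult a (legendre K)) < K"
      proof (rule degree_lessI)
        show "\<forall>n\<ge>K. coeff (p - smult a (legendre K)) n = 0"
        proof (intro allI impI)
          fix n assume "K \<le> n"
          then show "coeff (p - smult a (legendre K)) n = 0"
            using Suc.prems nz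
            by (cases "n = K") (auto simp: a_def coeff_eq_0 degree_legendre)
        qed
      qed (use False in auto)
      then show ?thesis ..
    qed
    from Suc.IH[OF this] obtain c where c: "p - smult a (legendre K) = (\<Sum>l<K. smult (c l) (legendre l))"
      by blast
    have "p = (\<Sum>l<Suc K. smult ((c(K := a)) l) (legendre l))"
      using c by (simp add: algebra_simps)
    then show ?case by blast
  qed simp
  then obtain c where c: "p = (\<Sum>l<K. smult (c l) (legendre l))" by blast
  have "poly_ip p (legendre m) = c m" if "m < K" for m
  proof -
    have "poly_ip p (legendre m) = (\<Sum>l<K. c l * (if l = m then 1 else 0))"
      unfolding c poly_ip_sum by (simp add: poly_ip_smult poly_ip_legendre)
    also have "\<dots> = c m" using that by (simp add: if_distrib cong: if_cong)
    finally show ?thesis .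
  qed
  then show ?thesis using c by simp
qed

section \<open>The matrix of differentiation in the Legendre basis\<close>

definition deriv_coef :: "nat \<Rightarrow> nat \<Rightarrow> nat \<Rightarrow> real" where
  "deriv_coef r k l = poly_ip ((pderiv ^^ r) (legendre k)) (legendre l)"

lemma deriv_coef_eq_0: "1 \<le> r \<Longrightarrow> k \<le> l \<Longrightarrow> deriv_coef r k l = 0"
proof -
  assume r: "1 \<le> r" and kl: "k \<le> l"
  have "(pderiv ^^ r) (legendre k) = 0 \<or> degree ((pderiv ^^ r) (legendre k)) < l"
    using r kl higher_pderiv_eq_0[of "legendre k" r]
    by (cases "k < r") (auto simp: degree_higher_pderiv degree_legendre)
  then show ?thesis
    unfolding deriv_coef_def poly_ip_commute[of _ "legendre l"]
    by (auto simp: poly_ip_legendre_lower_degree poly_ip_0 poly_ip_commute[of "legendre l" 0])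
qed

text \<open>The cut-off \<open>K\<close> may be any bound of \<open>k\<close>, so that one
  \<open>K\<close> serves all members of a finite index set at once.\<close>

lemma legendre_deriv_expansion:
  assumes "1 \<le> r" "k \<le> K"
  shows "(pderiv ^^ r) (legendre k) = (\<Sum>l<K. smult (deriv_coef r k l) (legendre l))"
  unfolding deriv_coef_def
proof (rule legendre_expansion)
  show "degree ((pderiv ^^ r) (legendre k)) < K \<or> (pderiv ^^ r) (legendre k) = 0"
    using assms higher_pderiv_eq_0[of "legendre k" r]
    by (cases "k < r") (auto simp: degree_higher_pderiv degree_legendre)
qed

text \<open>For \<open>l < k\<close>, moving the derivative to the polynomial of lower degree
  \<open>l\<close> leaves an inner product that vanishes by orthogonality. Only the two boundary
  terms remain; they cancel or add up according to the parity of \<open>k + l\<close>.\<close>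

lemma deriv_coef_1_bound: "\<bar>deriv_coef 1 k l\<bar> \<le> 2 * sqrt (real k + 1) * sqrt (real l + 1)"
proof (cases "k \<le> l")
  case True
  then show ?thesis by (simp add: deriv_coef_eq_0)
next
  case False
  then have "poly_ip (legendre k) (pderiv (legendre l)) = 0"
    by (intro poly_ip_legendre_lower_degree) (simp add: degree_pderiv degree_legendre)
  then have "deriv_coef 1 k l = sqrt (real k + 1/2) * sqrt (real l + 1/2)
      - (-1) ^ (k + l) * (sqrt (real k + 1/2) * sqrt (real l + 1/2))"
    by (simp add: deriv_coef_def poly_ip_pderiv poly_legendre_1 poly_legendre_minus_1 power_add)
  also have "\<bar>\<dots>\<bar> \<le> 2 * (sqrt (real k + 1/2) * sqrt (real l + 1/2))"
    by (cases "even (k + l)") (auto simp: abs_mult)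
  also have "\<dots> \<le> 2 * (sqrt (real k + 1) * sqrt (real l + 1))"
    by (intro mult_mono) auto
  finally show ?thesis by simp
qed

text \<open>Matrix multiplication; the sum stops below \<open>k\<close> because the matrices are
  strictly triangular.\<close>

lemma deriv_coef_Suc:
  assumes "1 \<le> r"
  shows "deriv_coef (Suc r) k l = (\<Sum>i<k. deriv_coef r k i * deriv_coef 1 i l)"
proof -
  have "deriv_coef (Suc r) k l
      = poly_ip (pderiv (\<Sum>i<k. smult (deriv_coef r k i) (legendre i))) (legendre l)"
    unfolding deriv_coef_def[of "Suc r"] legendre_deriv_expansion[OF assms order_refl, symmetric]
    by simp
  also have "\<dots> = (\<Sum>i<k. deriv_coef r k i * deriv_coef 1 i l)"
    by (simp add: higher_pderiv_sum[where n = "Suc 0", simplified] pderiv_smult poly_ip_sum poly_ip_smult deriv_coef_def)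
  finally show ?thesis .
qed


text \<open>In the matrix product the index \<open>i\<close> contributes \<open>sqrt (i + 1)\<close>
  from each factor, hence \<open>i + 1 \<le> k\<close> in each of \<open>k\<close> terms: every
  further derivative costs \<open>k^2\<close>. The dependence on \<open>l\<close> comes from the
  last factor alone and stays \<open>sqrt (l + 1)\<close>, which remains positive at
  \<open>l = 0\<close>.\<close>

lemma deriv_coef_bound:
  assumes "1 \<le> r"
  shows "\<exists>C>0. \<forall>k l. 1 \<le> k \<longrightarrow> \<bar>deriv_coef r k l\<bar> \<le> C * real k powr (2 * real r - 3/2) * sqrt (real l + 1)"
  using assms
proof (induction r rule: nat_induct_at_least)
  case base
  show ?case
  proof (intro exI[of _ 4] conjI allI impI)
    fix k l :: nat assume k: "1 \<le> k"
    have "sqrt (real k + 1) \<le> sqrt (4 * real k)" using k by simp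
    also have "\<dots> = 2 * real k powr (1/2)" by (simp add: real_sqrt_mult powr_half_sqrt)
    finally have "2 * sqrt (real k + 1) * sqrt (real l + 1) \<le> 2 * (2 * real k powr (1/2)) * sqrt (real l + 1)"
      by (intro mult_right_mono mult_left_mono) auto
    also have "\<dots> = 4 * real k powr (2 * real 1 - 3/2) * sqrt (real l + 1)" by simp
    finally show "\<bar>deriv_coef 1 k l\<bar> \<le> 4 * real k powr (2 * real 1 - 3/2) * sqrt (real l + 1)"
      by (rule order.trans[OF deriv_coef_1_bound])
  qed simp
next
  case (Suc r)
  then obtain C where C: "C > 0"
    "\<And>k l. 1 \<le> k \<Longrightarrow> \<bar>deriv_coef r k l\<bar> \<le> C * real k powr (2 * real r - 3/2) * sqrt (real l + 1)"
    by blast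
  show ?case
  proof (intro exI[of _ "2 * C"] conjI allI impI)
    fix k l :: nat assume k: "1 \<le> k"
    have "\<bar>deriv_coef (Suc r) k l\<bar> \<le> (\<Sum>i<k. \<bar>deriv_coef r k i * deriv_coef 1 i l\<bar>)"
      unfolding deriv_coef_Suc[OF Suc.hyps] by (rule sum_abs)
    also have "\<dots> \<le> (\<Sum>i<k. 2 * C * real k powr (2 * real r - 3/2) * real k * sqrt (real l + 1))"
    proof (rule sum_mono)
      fix i assume i: "i \<in> {..<k}"
      have "\<bar>deriv_coef r k i * deriv_coef 1 i l\<bar>
          \<le> (C * real k powr (2 * real r - 3/2) * sqrt (real i + 1)) * (2 * sqrt (real i + 1) * sqrt (real l + 1))"
        unfolding abs_mult using C k deriv_coef_1_bound by (intro mult_mono) auto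
      also have "\<dots> = 2 * C * real k powr (2 * real r - 3/2) * (sqrt (real i + 1) * sqrt (real i + 1)) * sqrt (real l + 1)"
        by (simp only: ac_simps)
      also have "\<dots> = 2 * C * real k powr (2 * real r - 3/2) * (real i + 1) * sqrt (real l + 1)"
        by simp
      also have "\<dots> \<le> 2 * C * real k powr (2 * real r - 3/2) * real k * sqrt (real l + 1)"
        using C i by (intro mult_right_mono mult_left_mono) auto
      finally show "\<bar>deriv_coef r k i * deriv_coef 1 i l\<bar> \<le> 2 * C * real k powr (2 * real r - 3/2) * real k * sqrt (real l + 1)" .
    qed
    also have "\<dots> = 2 * C * (real k powr (2 * real r - 3/2) * real k powr 2) * sqrt (real l + 1)"
      using k by (simp add: power2_eq_square)
    also have "\<dots> = 2 * C * real k powr (2 * real (Suc r) - 3/2) * sqrt (real l + 1)"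
      unfolding powr_add[symmetric] by (simp add: algebra_simps)
    finally show "\<bar>deriv_coef (Suc r) k l\<bar> \<le> 2 * C * real k powr (2 * real (Suc r) - 3/2) * sqrt (real l + 1)" .
  qed (use C in simp)
qed

section \<open>Square-integrable functions\<close>

definition sq_integrable :: "'a measure \<Rightarrow> ('a \<Rightarrow> real) \<Rightarrow> bool" where
  "sq_integrable M f \<longleftrightarrow> f \<in> borel_measurable M \<and> integrable M (\<lambda>x. (f x)\<^sup>2)"

definition l2norm :: "'a measure \<Rightarrow> ('a \<Rightarrow> real) \<Rightarrow> real" where
  "l2norm M f = sqrt (LINT x|M. (f x)\<^sup>2)"

lemma l2norm_nonneg: "0 \<le> l2norm M f"
  unfolding l2norm_def by (simp add: integral_nonneg_AE)

lemma l2norm_power2: "(l2norm M f)\<^sup>2 = (LINT x|M. (f x)\<^sup>2)"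
  unfolding l2norm_def by (simp add: integral_nonneg_AE)

lemma l2norm_cong_AE:
  assumes "sq_integrable M f" "sq_integrable M g" "AE x in M. f x = g x"
  shows "l2norm M f = l2norm M g"
proof -
  have [measurable]: "f \<in> borel_measurable M" "g \<in> borel_measurable M"
    using assms by (auto simp: sq_integrable_def)
  have "(LINT x|M. (f x)\<^sup>2) = (LINT x|M. (g x)\<^sup>2)"
    by (rule integral_cong_AE) (use assms(3) in auto)
  then show ?thesis by (simp add: l2norm_def)
qed

lemma sq_integrable_0: "sq_integrable M (\<lambda>x. 0)"
  by (simp add: sq_integrable_def)

lemma sq_integrable_cmult: "sq_integrable M f \<Longrightarrow> sq_integrable M (\<lambda>x. c * f x)"
  by (auto simp: sq_integrable_def power_mult_distrib)

lemma l2norm_cmult: "l2norm M (\<lambda>x. c * f x) = \<bar>c\<bar> * l2norm M f"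
  by (simp add: l2norm_def power_mult_distrib real_sqrt_mult)

lemma sq_integrable_add:
  assumes "sq_integrable M f" "sq_integrable M g"
  shows "sq_integrable M (\<lambda>x. f x + g x)"
proof -
  have m[measurable]: "f \<in> borel_measurable M" "g \<in> borel_measurable M"
    using assms by (auto simp: sq_integrable_def)
  have "integrable M (\<lambda>x. (f x + g x)\<^sup>2)"
  proof (rule Bochner_Integration.integrable_bound)
    show "integrable M (\<lambda>x. 2 * (f x)\<^sup>2 + 2 * (g x)\<^sup>2)"
      using assms by (auto simp: sq_integrable_def)
    show "AE x in M. norm ((f x + g x)\<^sup>2) \<le> norm (2 * (f x)\<^sup>2 + 2 * (g x)\<^sup>2)"
    proof (rule AE_I2)
      fix x
      have "(f x + g x)\<^sup>2 \<le> 2 * (f x)\<^sup>2 + 2 * (g x)\<^sup>2"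
        using zero_le_power2[of "f x - g x"] by (simp add: power2_eq_square algebra_simps)
      then show "norm ((f x + g x)\<^sup>2) \<le> norm (2 * (f x)\<^sup>2 + 2 * (g x)\<^sup>2)" by simp
    qed
  qed simp
  then show ?thesis by (simp add: sq_integrable_def)
qed

lemma sq_integrable_diff:
  assumes "sq_integrable M f" "sq_integrable M g"
  shows "sq_integrable M (\<lambda>x. f x - g x)"
  using sq_integrable_add[OF assms(1) sq_integrable_cmult[OF assms(2), of "-1"]] by simp

lemma sq_integrable_sum:
  "(\<And>i. i \<in> I \<Longrightarrow> sq_integrable M (f i)) \<Longrightarrow> sq_integrable M (\<lambda>x. \<Sum>i\<in>I. f i x)"
  by (induction I rule: infinite_finite_induct) (auto simp: sq_integrable_0 intro: sq_integrable_add)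

text \<open>Pointwise weighted Young inequality \<open>2 f g \<le> (b/a) f^2 + (a/b) g^2\<close>,
  integrated. If \<open>a\<close> and \<open>b\<close> are the norms, the right-hand side integrates
  to \<open>(a + b)^2\<close>.\<close>

lemma l2norm_triangle:
  assumes f: "sq_integrable M f" and g: "sq_integrable M g"
  shows "l2norm M (\<lambda>x. f x + g x) \<le> l2norm M f + l2norm M g"
proof (rule field_le_epsilon)
  fix e :: real assume e: "0 < e"
  \<comment> \<open>The slack \<open>e/2\<close> keeps both weights positive even if a norm is zero,
    so that the quotients make sense.\<close>
  define a where "a = l2norm M f + e/2"
  define b where "b = l2norm M g + e/2"
  have a: "0 < a" "l2norm M f \<le> a" and b: "0 < b" "l2norm M g \<le> b"
    using e l2norm_nonneg[of M f] l2norm_nonneg[of M g] by (auto simp: a_def b_def)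
  have int: "integrable M (\<lambda>x. (f x)\<^sup>2)" "integrable M (\<lambda>x. (g x)\<^sup>2)"
    using f g by (auto simp: sq_integrable_def)
  have pt: "(f x + g x)\<^sup>2 \<le> (1 + b / a) * (f x)\<^sup>2 + (1 + a / b) * (g x)\<^sup>2" for x
  proof -
    have "0 \<le> (b * f x - a * g x)\<^sup>2 / (a * b)" using a b by simp
    also have "\<dots> = b / a * (f x)\<^sup>2 + a / b * (g x)\<^sup>2 - 2 * f x * g x"
      using a b by (simp add: field_simps power2_eq_square)
    finally show ?thesis by (simp add: power2_eq_square algebra_simps)
  qed
  have "(l2norm M (\<lambda>x. f x + g x))\<^sup>2 \<le> (LINT x|M. (1 + b / a) * (f x)\<^sup>2 + (1 + a / b) * (g x)\<^sup>2)"
    unfolding l2norm_power2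
    by (rule integral_mono) (use sq_integrable_add[OF f g] int pt in \<open>auto simp: sq_integrable_def\<close>)
  also have "\<dots> = (1 + b / a) * (l2norm M f)\<^sup>2 + (1 + a / b) * (l2norm M g)\<^sup>2"
    using int by (simp add: l2norm_power2)
  also have "\<dots> \<le> (1 + b / a) * a\<^sup>2 + (1 + a / b) * b\<^sup>2"
    using a b l2norm_nonneg[of M f] l2norm_nonneg[of M g]
    by (intro add_mono mult_left_mono power_mono) auto
  also have "\<dots> = (a + b)\<^sup>2" using a b by (simp add: field_simps power2_eq_square)
  finally have "l2norm M (\<lambda>x. f x + g x) \<le> a + b"
    by (rule power2_le_imp_le) (use a(1) b(1) in simp)
  then show "l2norm M (\<lambda>x. f x + g x) \<le> l2norm M f + l2norm M g + e" by (simp add: a_def b_def)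
qed

lemma l2norm_sum_le:
  "(\<And>i. i \<in> I \<Longrightarrow> sq_integrable M (f i)) \<Longrightarrow> l2norm M (\<lambda>x. \<Sum>i\<in>I. f i x) \<le> (\<Sum>i\<in>I. l2norm M (f i))"
proof (induction I rule: infinite_finite_induct)
  case (insert i I)
  then have "l2norm M (\<lambda>x. f i x + (\<Sum>i\<in>I. f i x)) \<le> l2norm M (f i) + l2norm M (\<lambda>x. \<Sum>i\<in>I. f i x)"
    by (intro l2norm_triangle sq_integrable_sum) auto
  then show ?case using insert by simp
qed (auto simp: l2norm_def)

section \<open>Absolutely convergent series in L2\<close>

lemma nn_integral_abs_power2:
  assumes "sq_integrable M f"
  shows "(\<integral>\<^sup>+x. ennreal ((f x)\<^sup>2) \<partial>M) = ennreal ((l2norm M f)\<^sup>2)"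
  unfolding l2norm_power2 using assms by (intro nn_integral_eq_integral) (auto simp: sq_integrable_def)

text \<open>Minkowski's inequality for series. Monotone convergence for the squared partial sums of
  the absolute values bounds the integral of their supremum by the square of the sum of the norms;
  this supremum is finite almost everywhere and dominates the square of the sum.\<close>

lemma l2norm_suminf_le:
  fixes v :: "nat \<Rightarrow> 'a \<Rightarrow> real"
  assumes v: "\<And>i. sq_integrable M (v i)" and sm: "summable (\<lambda>i. l2norm M (v i))"
  shows "AE x in M. summable (\<lambda>i. \<bar>v i x\<bar>)"
    and "sq_integrable M (\<lambda>x. \<Sum>i. v i x)"
    and "l2norm M (\<lambda>x. \<Sum>i. v i x) \<le> (\<Sum>i. l2norm M (v i))"
proof -
  let ?S = "\<Sum>i. l2norm M (v i)"
  define H where "H N x = (\<Sum>i<N. \<bar>v i x\<bar>)\<^sup>2" for N x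
  have [measurable]: "v i \<in> borel_measurable M" for i using v by (simp add: sq_integrable_def)
  have [measurable]: "H N \<in> borel_measurable M" for N unfolding H_def by measurable
  have abs: "sq_integrable M (\<lambda>x. \<bar>v i x\<bar>)" "l2norm M (\<lambda>x. \<bar>v i x\<bar>) = l2norm M (v i)" for i
    using v[of i] by (auto simp: sq_integrable_def l2norm_def)
  have S0: "0 \<le> ?S" by (intro suminf_nonneg sm l2norm_nonneg)
  have HN: "(\<integral>\<^sup>+x. ennreal (H N x) \<partial>M) \<le> ennreal (?S\<^sup>2)" for N
  proof -
    have "l2norm M (\<lambda>x. \<Sum>i<N. \<bar>v i x\<bar>) \<le> (\<Sum>i<N. l2norm M (\<lambda>x. \<bar>v i x\<bar>))"
      by (rule l2norm_sum_le) (rule abs)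
    also have "\<dots> \<le> ?S" unfolding abs by (rule sum_le_suminf[OF sm]) (auto intro: l2norm_nonneg)
    finally have "(l2norm M (\<lambda>x. \<Sum>i<N. \<bar>v i x\<bar>))\<^sup>2 \<le> ?S\<^sup>2"
      by (intro power_mono) (auto intro: l2norm_nonneg)
    then show ?thesis
      unfolding H_def by (subst nn_integral_abs_power2) (auto intro!: ennreal_leI sq_integrable_sum abs)
  qed
  have inc: "incseq (\<lambda>N x. ennreal (H N x))"
    unfolding H_def incseq_def le_fun_def
    by (auto intro!: ennreal_leI power_mono sum_mono2 sum_nonneg)
  have SUP: "(\<integral>\<^sup>+x. (SUP N. ennreal (H N x)) \<partial>M) \<le> ennreal (?S\<^sup>2)"
    by (subst nn_integral_monotone_convergence_SUP[OF inc]) (auto intro!: SUP_least HN)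
  have "AE x in M. (SUP N. ennreal (H N x)) \<noteq> \<infinity>"
    using SUP by (intro nn_integral_PInf_AE) (auto simp: top_unique)
  then show AE: "AE x in M. summable (\<lambda>i. \<bar>v i x\<bar>)"
  proof eventually_elim
    case (elim x)
    define B where "B = enn2real (SUP N. ennreal (H N x))"
    have "H N x \<le> B" for N
    proof -
      have "ennreal (H N x) \<le> (SUP N. ennreal (H N x))" by (rule SUP_upper) simp
      also have "\<dots> = ennreal B" using elim by (auto simp: B_def ennreal_enn2real_if)
      finally show ?thesis by (simp add: B_def)
    qed
    then have "(\<Sum>i<N. norm (\<bar>v i x\<bar>)) \<le> sqrt B" for N
      using real_le_rsqrt[of "\<Sum>i<N. \<bar>v i x\<bar>" B] by (simp add: H_def)
    then show ?case by (intro summableI_nonneg_bounded) auto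
  qed
  have [measurable]: "(\<lambda>x. \<Sum>i. v i x) \<in> borel_measurable M" by measurable
  have le: "AE x in M. ennreal ((\<Sum>i. v i x)\<^sup>2) \<le> (SUP N. ennreal (H N x))"
    using AE
  proof eventually_elim
    case (elim x)
    have "(\<lambda>N. \<Sum>i<N. v i x) \<longlonglongrightarrow> (\<Sum>i. v i x)"
      using summable_rabs_cancel[OF elim] by (rule summable_LIMSEQ)
    then have "(\<lambda>N. ennreal ((\<Sum>i<N. v i x)\<^sup>2)) \<longlonglongrightarrow> ennreal ((\<Sum>i. v i x)\<^sup>2)"
      by (intro tendsto_ennrealI tendsto_power)
    then show ?case
    proof (rule LIMSEQ_le_const2)
      have "ennreal ((\<Sum>i<N. v i x)\<^sup>2) \<le> (SUP N. ennreal (H N x))" for N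
      proof -
        have "(\<Sum>i<N. v i x)\<^sup>2 \<le> H N x"
          unfolding H_def by (rule power2_le_iff_abs_le[THEN iffD2]) (auto intro: sum_nonneg sum_abs)
        then have "ennreal ((\<Sum>i<N. v i x)\<^sup>2) \<le> ennreal (H N x)" by (rule ennreal_leI)
        also have "\<dots> \<le> (SUP N. ennreal (H N x))" by (rule SUP_upper) simp
        finally show ?thesis .
      qed
      then show "\<exists>N. \<forall>n\<ge>N. ennreal ((\<Sum>i<n. v i x)\<^sup>2) \<le> (SUP N. ennreal (H N x))" by blast
    qed
  qed
  have nn: "(\<integral>\<^sup>+x. ennreal ((\<Sum>i. v i x)\<^sup>2) \<partial>M) \<le> ennreal (?S\<^sup>2)"
    using nn_integral_mono_AE[OF le] SUP by (rule order.trans)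
  show sq: "sq_integrable M (\<lambda>x. \<Sum>i. v i x)"
    unfolding sq_integrable_def
    using nn by (auto intro!: integrableI_bounded simp: top_unique order.strict_trans1[OF _ ennreal_less_top])
  show "l2norm M (\<lambda>x. \<Sum>i. v i x) \<le> ?S"
  proof (rule power2_le_imp_le[OF _ S0])
    show "(l2norm M (\<lambda>x. \<Sum>i. v i x))\<^sup>2 \<le> ?S\<^sup>2"
      using nn unfolding nn_integral_abs_power2[OF sq] by (subst (asm) ennreal_le_iff) simp_all
  qed
qed

text \<open>Completeness in the form that \<open>has_mixed_deriv\<close> needs: convergence along
  the net of finite subsets. Enumerating the countable index set reduces it to an ordinary series,
  and absolute convergence controls the remainder of every sufficiently large finite set.\<close>

lemma l2_abs_convergent_series:
  fixes u :: "'i :: countable \<Rightarrow> 'a \<Rightarrow> real"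
  assumes u: "\<And>i. i \<in> I \<Longrightarrow> sq_integrable M (u i)"
    and sm: "(\<lambda>i. l2norm M (u i)) summable_on I"
  shows "\<exists>g. sq_integrable M g \<and>
    ((\<lambda>F. l2norm M (\<lambda>x. g x - (\<Sum>i\<in>F. u i x))) \<longlongrightarrow> 0) (finite_subsets_at_top I)"
proof -
  \<comment> \<open>Codes outside \<open>J\<close> carry the zero function, so the series may run
    over all natural numbers.\<close>
  define J where "J = to_nat ` I"
  define v where "v n = (if n \<in> J then u (from_nat n) else (\<lambda>x. 0))" for n
  have v: "sq_integrable M (v n)" for n
    using u by (auto simp: v_def J_def sq_integrable_0)
  have zero: "l2norm M (\<lambda>x. 0) = 0" by (simp add: l2norm_def)
  have "(\<lambda>n. l2norm M (v n)) summable_on J"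
    unfolding J_def by (subst summable_on_reindex) (use sm in \<open>auto simp: o_def v_def J_def cong: summable_on_cong\<close>)
  then have "(\<lambda>n. l2norm M (v n)) summable_on UNIV"
    using summable_on_cong_neutral[of UNIV J "\<lambda>n. l2norm M (v n)" "\<lambda>n. l2norm M (v n)"]
    by (auto simp: v_def zero)
  then have sv: "summable (\<lambda>n. l2norm M (v n))"
    by (rule summable_on_imp_summable)
  define g where "g x = (\<Sum>n. v n x)" for x
  have g: "sq_integrable M g" unfolding g_def by (rule l2norm_suminf_le[OF v sv])
  have "((\<lambda>F. l2norm M (\<lambda>x. g x - (\<Sum>i\<in>F. u i x))) \<longlongrightarrow> 0) (finite_subsets_at_top I)"
  proof (rule tendstoI)
    fix e :: real assume e: "0 < e"
    have "(\<lambda>N. \<Sum>n. l2norm M (v (n + N))) \<longlonglongrightarrow> 0"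
      using suminf_exist_split2[OF sv] .
    then obtain N where N: "(\<Sum>n. l2norm M (v (n + N))) < e"
      using e l2norm_nonneg
      by (metis (no_types, lifting) order_tendstoD(2) eventually_sequentially order_refl)
    \<comment> \<open>A finite set containing \<open>F0\<close> exhausts all codes below
      \<open>N\<close>; what it leaves out is part of the tail from \<open>N\<close> on.\<close>
    define F0 where "F0 = {i\<in>I. to_nat i < N}"
    have F0: "finite F0"
      by (rule finite_imageD[of to_nat]) (auto simp: F0_def intro: finite_subset[of _ "{..<N}"])
    have "dist (l2norm M (\<lambda>x. g x - (\<Sum>i\<in>F. u i x))) 0 < e" if F: "finite F" "F0 \<subseteq> F" "F \<subseteq> I" for F
    proof -
      define G where "G = to_nat ` F"
      define w where "w n = (if n \<in> G then (\<lambda>x. 0) else v n)" for n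
      have w: "sq_integrable M (w n)" for n using v by (auto simp: w_def sq_integrable_0)
      have wv: "l2norm M (w n) \<le> l2norm M (v n)" for n by (auto simp: w_def zero l2norm_nonneg)
      have sw: "summable (\<lambda>n. l2norm M (w n))"
        by (rule summable_comparison_test'[OF sv, of 0]) (simp add: wv l2norm_nonneg)
      have wN: "w n = (\<lambda>x. 0)" if "n < N" for n
        using that F by (force simp: w_def v_def G_def J_def F0_def)
      have AE: "AE x in M. g x - (\<Sum>i\<in>F. u i x) = (\<Sum>n. w n x)"
        using l2norm_suminf_le(1)[OF v sv]
      proof eventually_elim
        case (elim x)
        have "(\<Sum>i\<in>F. u i x) = (\<Sum>n\<in>G. v n x)"
          unfolding G_def using F by (subst sum.reindex) (auto simp: v_def J_def intro!: sum.cong)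
        moreover have "(\<lambda>n. if n \<in> G then v n x else 0) sums (\<Sum>n\<in>G. v n x)"
          using F by (intro sums_If_finite_set) (simp add: G_def)
        moreover have "(\<lambda>n. v n x) sums g x"
          unfolding g_def using summable_rabs_cancel[OF elim] by (rule summable_sums)
        ultimately have "(\<lambda>n. v n x - (if n \<in> G then v n x else 0)) sums (g x - (\<Sum>i\<in>F. u i x))"
          by (simp add: sums_diff)
        moreover have "(\<lambda>n. v n x - (if n \<in> G then v n x else 0)) = (\<lambda>n. w n x)"
          by (auto simp: w_def)
        ultimately show ?case by (simp add: sums_iff)
      qed
      have "l2norm M (\<lambda>x. g x - (\<Sum>i\<in>F. u i x)) = l2norm M (\<lambda>x. \<Sum>n. w n x)"
        using AE F u
        by (intro l2norm_cong_AE sq_integrable_diff g sq_integrable_sum l2norm_suminf_le(2)[OF w sw]) auto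
      also have "\<dots> \<le> (\<Sum>n. l2norm M (w n))" by (rule l2norm_suminf_le(3)[OF w sw])
      also have "\<dots> = (\<Sum>n. l2norm M (w (n + N)))"
        using suminf_split_initial_segment[OF sw, of N] by (simp add: wN zero)
      also have "\<dots> \<le> (\<Sum>n. l2norm M (v (n + N)))"
        by (intro suminf_le summable_ignore_initial_segment sw sv wv)
      finally show ?thesis using N by (simp add: l2norm_nonneg)
    qed
    then show "\<forall>\<^sub>F F in finite_subsets_at_top I. dist (l2norm M (\<lambda>x. g x - (\<Sum>i\<in>F. u i x))) 0 < e"
      unfolding eventually_finite_subsets_at_top
      by (intro exI[of _ F0]) (use F0 in \<open>auto simp: F0_def\<close>)
  qed
  then show ?thesis using g by blast
qed

section \<open>Power sums over hyperbolic crosses\<close>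

text \<open>Mean value theorem for \<open>x powr (1 - \<alpha>)\<close>: the integral comparison in
  telescoping form.\<close>

lemma powr_neg_le_telescope:
  fixes \<alpha> x :: real
  assumes "1 < \<alpha>" "0 < x"
  shows "(\<alpha> - 1) * (x + 1) powr (-\<alpha>) \<le> x powr (1 - \<alpha>) - (x + 1) powr (1 - \<alpha>)"
proof -
  have "\<exists>z>x. z < x + 1 \<and> (x + 1) powr (1 - \<alpha>) - x powr (1 - \<alpha>)
      = (x + 1 - x) * ((1 - \<alpha>) * z powr (1 - \<alpha> - 1))"
    by (rule MVT2) (use assms in \<open>auto intro!: derivative_eq_intros\<close>)
  then obtain z where z: "x < z" "z < x + 1"
    "x powr (1 - \<alpha>) - (x + 1) powr (1 - \<alpha>) = (\<alpha> - 1) * z powr (-\<alpha>)"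
    by (auto simp: algebra_simps)
  have "(x + 1) powr (-\<alpha>) \<le> z powr (-\<alpha>)"
    using assms z by (intro powr_mono2') auto
  then show ?thesis unfolding z(3) using assms by (intro mult_left_mono) auto
qed

text \<open>The subtracted term at the upper end lets the telescoping induction close. The constant
  \<open>\<alpha> / (\<alpha> - 1)\<close> is \<open>1 + 1 / (\<alpha> - 1)\<close>: the first term
  of the sum plus the integral.\<close>

lemma sum_powr_neg_interval_le:
  assumes "1 < \<alpha>" "1 \<le> m"
  shows "(\<Sum>k\<in>{m..m + d}. real k powr (-\<alpha>))
    \<le> \<alpha> / (\<alpha> - 1) * real m powr (1 - \<alpha>) - 1 / (\<alpha> - 1) * real (m + d) powr (1 - \<alpha>)"
proof (induction d)
  case 0
  have "real m powr (-\<alpha>) \<le> real m powr (1 - \<alpha>)" using assms by (intro powr_mono) auto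
  also have "\<dots> = (\<alpha> / (\<alpha> - 1) - 1 / (\<alpha> - 1)) * real m powr (1 - \<alpha>)"
    using assms by (simp flip: diff_divide_distrib)
  also have "\<dots> = \<alpha> / (\<alpha> - 1) * real m powr (1 - \<alpha>) - 1 / (\<alpha> - 1) * real m powr (1 - \<alpha>)"
    by (rule left_diff_distrib)
  finally show ?case by simp
next
  case (Suc d)
  have "real (m + Suc d) powr (-\<alpha>)
      \<le> 1 / (\<alpha> - 1) * (real (m + d) powr (1 - \<alpha>) - real (m + Suc d) powr (1 - \<alpha>))"
    using powr_neg_le_telescope[of \<alpha> "real (m + d)"] assms by (simp add: field_simps)
  then show ?case using Suc by (simp add: algebra_simps)
qed

text \<open>The threshold \<open>x\<close> is any positive real, so that it can be a quotient such
  as \<open>n / j powr \<gamma>\<close>; with \<open>x = 1\<close> the lemma bounds the full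
  sum.\<close>

lemma sum_powr_neg_tail_le:
  assumes "1 < \<alpha>" "0 < x" "finite F" "\<And>k. k \<in> F \<Longrightarrow> 1 \<le> k \<and> x \<le> real k"
  shows "(\<Sum>k\<in>F. real k powr (-\<alpha>)) \<le> \<alpha> / (\<alpha> - 1) * x powr (1 - \<alpha>)"
proof -
  define m where "m = max 1 (nat \<lceil>x\<rceil>)"
  have m: "1 \<le> m" "x \<le> real m" by (auto simp: m_def) linarith
  have "F \<subseteq> {m..m + Max (insert 0 F)}"
  proof
    fix k assume "k \<in> F"
    moreover have "m \<le> k" using assms(4)[OF \<open>k \<in> F\<close>] by (auto simp: m_def ceiling_le_iff nat_le_iff)
    ultimately show "k \<in> {m..m + Max (insert 0 F)}" using assms(3) by (auto intro: trans_le_add2)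
  qed
  then have "(\<Sum>k\<in>F. real k powr (-\<alpha>)) \<le> (\<Sum>k\<in>{m..m + Max (insert 0 F)}. real k powr (-\<alpha>))"
    by (intro sum_mono2) auto
  also have "\<dots> \<le> \<alpha> / (\<alpha> - 1) * real m powr (1 - \<alpha>)"
    using sum_powr_neg_interval_le[OF assms(1) m(1), of "Max (insert 0 F)"] assms(1)
    by (smt (verit) divide_nonneg_nonneg mult_nonneg_nonneg powr_ge_zero)
  also have "\<dots> \<le> \<alpha> / (\<alpha> - 1) * x powr (1 - \<alpha>)"
    using assms m by (intro mult_left_mono powr_mono2') auto
  finally show ?thesis .
qed

lemma sum_inverse_le_ln:
  assumes "1 \<le> y" "finite F" "\<And>j. j \<in> F \<Longrightarrow> 1 \<le> j \<and> real j \<le> y"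
  shows "(\<Sum>j\<in>F. real j powr (-1)) \<le> 1 + ln y"
proof -
  have harm: "(\<Sum>j\<in>{1..Suc N}. real j powr (-1)) \<le> 1 + ln (real (Suc N))" for N
  proof (induction N)
    case (Suc N)
    \<comment> \<open>The inequality \<open>ln u \<le> u - 1\<close> at
      \<open>u = (N + 1) / (N + 2)\<close> bounds the new harmonic term by the increment of the
      logarithm.\<close>
    have "ln (real (Suc N) / real (Suc (Suc N))) \<le> real (Suc N) / real (Suc (Suc N)) - 1"
      by (intro ln_le_minus_one) auto
    also have "\<dots> = - (real (Suc (Suc N)) powr (-1))" by (simp add: powr_minus field_simps)
    finally have "real (Suc (Suc N)) powr (-1) \<le> ln (real (Suc (Suc N))) - ln (real (Suc N))"
      by (simp add: ln_div)
    then show ?case using Suc by simp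
  qed simp
  obtain N where N: "nat \<lfloor>y\<rfloor> = Suc N" using assms(1) by (cases "nat \<lfloor>y\<rfloor>") auto
  have "F \<subseteq> {1..Suc N}"
  proof
    fix j assume "j \<in> F"
    from assms(3)[OF this] have "1 \<le> j" "real j \<le> y" by auto
    then show "j \<in> {1..Suc N}" unfolding N[symmetric] by (auto simp: le_nat_floor)
  qed
  then have "(\<Sum>j\<in>F. real j powr (-1)) \<le> (\<Sum>j\<in>{1..Suc N}. real j powr (-1))"
    by (intro sum_mono2) auto
  also have "\<dots> \<le> 1 + ln (real (Suc N))" by (rule harm)
  also have "\<dots> \<le> 1 + ln y" using assms(1) N[symmetric] by simp
  finally show ?thesis .
qed

lemma sum_powr_le:
  assumes "0 \<le> a" "0 < x" "finite F" "\<And>k. k \<in> F \<Longrightarrow> 1 \<le> k \<and> real k \<le> x"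
  shows "(\<Sum>k\<in>F. real k powr a) \<le> x powr (a + 1)"
proof -
  have "F \<subseteq> {1..nat \<lfloor>x\<rfloor>}"
  proof
    fix j assume "j \<in> F"
    from assms(4)[OF this] have "1 \<le> j" "real j \<le> x" by auto
    then show "j \<in> {1..nat \<lfloor>x\<rfloor>}" by (auto simp: le_nat_floor)
  qed
  then have "card F \<le> card {1..nat \<lfloor>x\<rfloor>}" by (intro card_mono) auto
  then have card: "real (card F) \<le> x" using assms(2) by simp linarith
  have "(\<Sum>k\<in>F. real k powr a) \<le> (\<Sum>k\<in>F. x powr a)"
    using assms by (intro sum_mono powr_mono2) auto
  also have "\<dots> = real (card F) * x powr a" by simp
  also have "\<dots> \<le> x * x powr a" using card by (intro mult_right_mono) auto
  also have "\<dots> = x powr (a + 1)" using assms(2) by (simp add: powr_add)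
  finally show ?thesis .
qed

section \<open>Double sums outside and inside a hyperbolic cross\<close>

lemma sum_fibers_le:
  fixes f :: "nat \<Rightarrow> real" and g h :: "nat \<Rightarrow> real"
  assumes "finite F" "\<And>j. j \<in> snd ` F \<Longrightarrow> (\<Sum>k\<in>{k. (k, j) \<in> F}. f k) \<le> h j" "\<And>j. 0 \<le> g j"
  shows "(\<Sum>(k, j)\<in>F. f k * g j) \<le> (\<Sum>j\<in>snd ` F. h j * g j)"
proof -
  have "(\<Sum>(k, j)\<in>F. f k * g j) = (\<Sum>j\<in>snd ` F. \<Sum>(k, j)\<in>{x\<in>F. snd x = j}. f k * g j)"
    using assms(1) by (rule sum.image_gen)
  also have "\<dots> = (\<Sum>j\<in>snd ` F. (\<Sum>k\<in>{k. (k, j) \<in> F}. f k) * g j)"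
  proof (rule sum.cong[OF refl])
    fix j
    have "{x\<in>F. snd x = j} = (\<lambda>k. (k, j)) ` {k. (k, j) \<in> F}" by force
    then show "(\<Sum>(k, j)\<in>{x\<in>F. snd x = j}. f k * g j) = (\<Sum>k\<in>{k. (k, j) \<in> F}. f k) * g j"
      by (simp add: sum.reindex inj_on_def sum_distrib_right)
  qed
  also have "\<dots> \<le> (\<Sum>j\<in>snd ` F. h j * g j)"
    using assms by (intro sum_mono mult_right_mono) auto
  finally show ?thesis .
qed

lemma finite_fiber: "finite F \<Longrightarrow> finite {k. (k, j) \<in> F}"
  by (rule finite_subset[of _ "fst ` F"]) force+

lemma quotient_powr:
  "0 < n \<Longrightarrow> (n / x powr \<gamma>) powr (1 - \<alpha>) = n powr (1 - \<alpha>) * x powr (\<gamma> * (\<alpha> - 1))" for n :: real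
  by (subst powr_divide) (auto simp: powr_powr divide_powr_uminus right_diff_distrib)

text \<open>For fixed \<open>j\<close> the sum over \<open>k \<ge> n / j powr \<gamma>\<close> is of
  order \<open>n powr (1 - \<alpha>) * j powr (\<gamma> * (\<alpha> - 1))\<close>. The remaining
  exponent of \<open>j\<close> is \<open>-\<sigma>\<close>, and the strict hypothesis says that
  \<open>\<sigma> > 1\<close>.\<close>

lemma sum_outside_hyp_cross_le:
  assumes "1 < \<alpha>" "\<gamma> * (\<alpha> - 1) + 1 < \<beta>"
  shows "\<exists>C>0. \<forall>n>0. \<forall>F. finite F \<longrightarrow> (\<forall>(k, j)\<in>F. 1 \<le> k \<and> 1 \<le> j \<and> n \<le> real k * real j powr \<gamma>) \<longrightarrow>
    (\<Sum>(k, j)\<in>F. real k powr (-\<alpha>) * real j powr (-\<beta>)) \<le> C * n powr (1 - \<alpha>)"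
proof -
  define \<sigma> where "\<sigma> = \<beta> - \<gamma> * (\<alpha> - 1)"
  have \<sigma>: "1 < \<sigma>" using assms by (simp add: \<sigma>_def)
  define c where "c = \<alpha> / (\<alpha> - 1)"
  have c: "0 < c" using assms by (simp add: c_def)
  show ?thesis
  proof (intro exI[of _ "c * (\<sigma> / (\<sigma> - 1))"] conjI allI impI)
    show "0 < c * (\<sigma> / (\<sigma> - 1))" using c \<sigma> by simp
    fix n :: real and F :: "(nat \<times> nat) set"
    assume n: "0 < n" and F: "finite F" "\<forall>(k, j)\<in>F. 1 \<le> k \<and> 1 \<le> j \<and> n \<le> real k * real j powr \<gamma>"
    have "(\<Sum>(k, j)\<in>F. real k powr (-\<alpha>) * real j powr (-\<beta>))
        \<le> (\<Sum>j\<in>snd ` F. c * (n / real j powr \<gamma>) powr (1 - \<alpha>) * real j powr (-\<beta>))"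
    proof (rule sum_fibers_le[OF F(1)])
      fix j assume "j \<in> snd ` F"
      then have j: "1 \<le> j" using F by auto
      show "(\<Sum>k\<in>{k. (k, j) \<in> F}. real k powr (-\<alpha>)) \<le> c * (n / real j powr \<gamma>) powr (1 - \<alpha>)"
        unfolding c_def using j n F assms
        by (intro sum_powr_neg_tail_le finite_fiber) (auto simp: field_simps)
    qed auto
    also have "\<dots> = (\<Sum>j\<in>snd ` F. c * n powr (1 - \<alpha>) * real j powr (-\<sigma>))"
    proof (rule sum.cong[OF refl])
      fix j assume "j \<in> snd ` F"
      then have j: "1 \<le> j" using F by auto
      have "(n / real j powr \<gamma>) powr (1 - \<alpha>) = n powr (1 - \<alpha>) * real j powr (\<gamma> * (\<alpha> - 1))"
        by (rule quotient_powr[OF n])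
      then show "c * (n / real j powr \<gamma>) powr (1 - \<alpha>) * real j powr (-\<beta>) = c * n powr (1 - \<alpha>) * real j powr (-\<sigma>)"
        by (simp add: \<sigma>_def mult.assoc flip: powr_add)
    qed
    also have "\<dots> = c * n powr (1 - \<alpha>) * (\<Sum>j\<in>snd ` F. real j powr (-\<sigma>))"
      by (simp add: sum_distrib_left)
    also have "\<dots> \<le> c * n powr (1 - \<alpha>) * (\<sigma> / (\<sigma> - 1) * 1 powr (1 - \<sigma>))"
      using F c by (intro mult_left_mono sum_powr_neg_tail_le \<sigma>) auto
    finally show "(\<Sum>(k, j)\<in>F. real k powr (-\<alpha>) * real j powr (-\<beta>)) \<le> c * (\<sigma> / (\<sigma> - 1)) * n powr (1 - \<alpha>)"
      by (simp add: mult_ac)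
  qed
qed

text \<open>The borderline case in which the sum over \<open>j\<close> is harmonic. It would diverge
  if continued indefinitely, so the fibre estimate is changed where it becomes wasteful.\<close>

lemma sum_outside_hyp_cross_critical_le:
  assumes "1 < \<alpha>" "0 < \<gamma>" "\<gamma> * (\<alpha> - 1) + 1 = \<beta>"
  shows "\<exists>C>0. \<forall>n\<ge>exp 1. \<forall>F. finite F \<longrightarrow> (\<forall>(k, j)\<in>F. 1 \<le> k \<and> 1 \<le> j \<and> n \<le> real k * real j powr \<gamma>) \<longrightarrow>
    (\<Sum>(k, j)\<in>F. real k powr (-\<alpha>) * real j powr (-\<beta>)) \<le> C * n powr (1 - \<alpha>) * ln n"
proof -
  define c where "c = \<alpha> / (\<alpha> - 1)"
  have c: "0 < c" using assms by (simp add: c_def)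
  have \<beta>: "1 < \<beta>" using assms by (simp flip: assms(3))
  define d where "d = c * (1 + 1 / \<gamma>) + c * (\<beta> / (\<beta> - 1))"
  show ?thesis
  proof (intro exI[of _ d] conjI allI impI)
    show "0 < d" using c \<beta> assms by (simp add: d_def add_pos_pos)
    fix n :: real and F :: "(nat \<times> nat) set"
    assume n: "exp 1 \<le> n" and F: "finite F" "\<forall>(k, j)\<in>F. 1 \<le> k \<and> 1 \<le> j \<and> n \<le> real k * real j powr \<gamma>"
    have n1: "1 < n" "0 < n" using n by (smt (verit) exp_gt_one exp_gt_zero)+
    have ln: "1 \<le> ln n" using n n1 by (simp add: ln_ge_iff)
    \<comment> \<open>Beyond \<open>y\<close> the threshold \<open>n / j powr \<gamma>\<close> is
      below 1, and only \<open>k \<ge> 1\<close> is used. The tail of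
      \<open>j powr (-\<beta>)\<close> from \<open>y\<close> on gives
      \<open>y powr (1 - \<beta>) = n powr (1 - \<alpha>)\<close>, without a logarithm.\<close>
    define y where "y = n powr (1 / \<gamma>)"
    have y: "1 \<le> y" "0 < y" using n1 assms by (auto simp: y_def ge_one_powr_ge_zero)
    define h where "h j = (if real j \<le> y then c * n powr (1 - \<alpha>) * real j powr (-1) else c * real j powr (-\<beta>))" for j
    have "(\<Sum>(k, j)\<in>F. real k powr (-\<alpha>) * real j powr (-\<beta>))
        \<le> (\<Sum>j\<in>snd ` F. (if real j \<le> y then c * (n / real j powr \<gamma>) powr (1 - \<alpha>) else c * 1 powr (1 - \<alpha>)) * real j powr (-\<beta>))"
    proof (rule sum_fibers_le[OF F(1)])
      fix j assume "j \<in> snd ` F"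
      then have j: "1 \<le> j" using F by auto
      have 1: "(\<Sum>k\<in>{k. (k, j) \<in> F}. real k powr (-\<alpha>)) \<le> c * (n / real j powr \<gamma>) powr (1 - \<alpha>)"
        unfolding c_def using j n1 F assms
        by (intro sum_powr_neg_tail_le finite_fiber) (auto simp: field_simps)
      have 2: "(\<Sum>k\<in>{k. (k, j) \<in> F}. real k powr (-\<alpha>)) \<le> c * 1 powr (1 - \<alpha>)"
        unfolding c_def using F assms
        by (intro sum_powr_neg_tail_le finite_fiber) auto
      show "(\<Sum>k\<in>{k. (k, j) \<in> F}. real k powr (-\<alpha>))
          \<le> (if real j \<le> y then c * (n / real j powr \<gamma>) powr (1 - \<alpha>) else c * 1 powr (1 - \<alpha>))"
        using 1 2 by auto
    qed auto
    also have "\<dots> = (\<Sum>j\<in>snd ` F. h j)"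
    proof (rule sum.cong[OF refl])
      fix j assume "j \<in> snd ` F"
      then have j: "1 \<le> j" using F by auto
      have "(n / real j powr \<gamma>) powr (1 - \<alpha>) = n powr (1 - \<alpha>) * real j powr (\<gamma> * (\<alpha> - 1))"
        by (rule quotient_powr[OF n1(2)])
      moreover have "\<gamma> * (\<alpha> - 1) + - \<beta> = -1" using assms by simp
      ultimately show "(if real j \<le> y then c * (n / real j powr \<gamma>) powr (1 - \<alpha>) else c * 1 powr (1 - \<alpha>)) * real j powr (-\<beta>) = h j"
        by (simp add: h_def mult.assoc flip: powr_add)
    qed
    also have "\<dots> = (\<Sum>j\<in>{j\<in>snd ` F. real j \<le> y}. c * n powr (1 - \<alpha>) * real j powr (-1))
        + (\<Sum>j\<in>{j\<in>snd ` F. \<not> real j \<le> y}. c * real j powr (-\<beta>))"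
      unfolding h_def using F(1) by (simp add: sum.If_cases Int_def conj_commute)
    also have "\<dots> = c * n powr (1 - \<alpha>) * (\<Sum>j\<in>{j\<in>snd ` F. real j \<le> y}. real j powr (-1))
        + c * (\<Sum>j\<in>{j\<in>snd ` F. \<not> real j \<le> y}. real j powr (-\<beta>))"
      by (simp add: sum_distrib_left)
    also have "\<dots> \<le> c * n powr (1 - \<alpha>) * (1 + ln y) + c * (\<beta> / (\<beta> - 1) * y powr (1 - \<beta>))"
      using F c y \<beta>
      by (intro add_mono mult_left_mono sum_inverse_le_ln sum_powr_neg_tail_le) auto
    also have "y powr (1 - \<beta>) = n powr (1 - \<alpha>)"
      using assms by (simp add: y_def powr_powr flip: assms(3))
    also have "ln y = 1 / \<gamma> * ln n" using n1 by (simp add: y_def ln_powr)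
    \<comment> \<open>From \<open>n \<ge> exp 1\<close> follows \<open>ln n \<ge> 1\<close>, so the
      terms without a logarithm are absorbed.\<close>
    also have "c * n powr (1 - \<alpha>) * (1 + 1 / \<gamma> * ln n) + c * (\<beta> / (\<beta> - 1) * n powr (1 - \<alpha>))
        \<le> c * n powr (1 - \<alpha>) * (1 * ln n + 1 / \<gamma> * ln n) + c * (\<beta> / (\<beta> - 1) * n powr (1 - \<alpha>)) * ln n"
    proof (intro add_mono mult_left_mono)
      have "0 \<le> c * (\<beta> / (\<beta> - 1) * n powr (1 - \<alpha>))" using c \<beta> by simp
      from mult_left_mono[OF ln this]
      show "c * (\<beta> / (\<beta> - 1) * n powr (1 - \<alpha>)) \<le> c * (\<beta> / (\<beta> - 1) * n powr (1 - \<alpha>)) * ln n" by simp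
    qed (use c ln assms(2) in auto)
    also have "\<dots> = d * n powr (1 - \<alpha>) * ln n" by (simp add: d_def algebra_simps)
    finally show "(\<Sum>(k, j)\<in>F. real k powr (-\<alpha>) * real j powr (-\<beta>)) \<le> d * n powr (1 - \<alpha>) * ln n" .
  qed
qed

text \<open>For fixed \<open>j\<close> there are at most \<open>n / j powr \<gamma>\<close> values
  of \<open>k\<close>, and each summand is at most the \<open>a\<close>-th power of that
  number.\<close>

lemma sum_inside_hyp_cross_le_aux:
  assumes "0 \<le> a" "0 < n" "finite F" "\<forall>(k, j)\<in>F. 1 \<le> k \<and> 1 \<le> j \<and> real k * real j powr \<gamma> \<le> n"
  shows "(\<Sum>(k, j)\<in>F. real k powr a * real j powr b)
    \<le> n powr (a + 1) * (\<Sum>j\<in>snd ` F. real j powr (- (\<gamma> * (a + 1) - b)))"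
proof -
  have "(\<Sum>(k, j)\<in>F. real k powr a * real j powr b)
      \<le> (\<Sum>j\<in>snd ` F. (n / real j powr \<gamma>) powr (a + 1) * real j powr b)"
  proof (rule sum_fibers_le[OF assms(3)])
    fix j assume "j \<in> snd ` F"
    then have j: "1 \<le> j" using assms by auto
    show "(\<Sum>k\<in>{k. (k, j) \<in> F}. real k powr a) \<le> (n / real j powr \<gamma>) powr (a + 1)"
      using j assms by (intro sum_powr_le finite_fiber) (auto simp: field_simps)
  qed auto
  also have "\<dots> = (\<Sum>j\<in>snd ` F. n powr (a + 1) * real j powr (- (\<gamma> * (a + 1) - b)))"
  proof (rule sum.cong[OF refl])
    fix j assume "j \<in> snd ` F"
    have "(n / real j powr \<gamma>) powr (a + 1) = n powr (a + 1) * real j powr (- (\<gamma> * (a + 1)))"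
      using assms(2) by (simp add: powr_divide powr_powr powr_minus_divide)
    then show "(n / real j powr \<gamma>) powr (a + 1) * real j powr b = n powr (a + 1) * real j powr (- (\<gamma> * (a + 1) - b))"
      by (simp add: mult.assoc flip: powr_add)
  qed
  finally show ?thesis by (simp add: sum_distrib_left)
qed

lemma sum_inside_hyp_cross_le:
  assumes "0 \<le> a" "b + 1 < \<gamma> * (a + 1)"
  shows "\<exists>C>0. \<forall>n>0. \<forall>F. finite F \<longrightarrow> (\<forall>(k, j)\<in>F. 1 \<le> k \<and> 1 \<le> j \<and> real k * real j powr \<gamma> \<le> n) \<longrightarrow>
    (\<Sum>(k, j)\<in>F. real k powr a * real j powr b) \<le> C * n powr (a + 1)"
proof -
  define \<sigma> where "\<sigma> = \<gamma> * (a + 1) - b"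
  have \<sigma>: "1 < \<sigma>" using assms by (simp add: \<sigma>_def)
  show ?thesis
  proof (intro exI[of _ "\<sigma> / (\<sigma> - 1)"] conjI allI impI)
    show "0 < \<sigma> / (\<sigma> - 1)" using \<sigma> by simp
    fix n :: real and F :: "(nat \<times> nat) set"
    assume n: "0 < n" and F: "finite F" "\<forall>(k, j)\<in>F. 1 \<le> k \<and> 1 \<le> j \<and> real k * real j powr \<gamma> \<le> n"
    have "(\<Sum>(k, j)\<in>F. real k powr a * real j powr b) \<le> n powr (a + 1) * (\<Sum>j\<in>snd ` F. real j powr (-\<sigma>))"
      unfolding \<sigma>_def by (rule sum_inside_hyp_cross_le_aux) (use assms n F in auto)
    also have "\<dots> \<le> n powr (a + 1) * (\<sigma> / (\<sigma> - 1) * 1 powr (1 - \<sigma>))"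
      using F by (intro mult_left_mono sum_powr_neg_tail_le \<sigma>) auto
    finally show "(\<Sum>(k, j)\<in>F. real k powr a * real j powr b) \<le> \<sigma> / (\<sigma> - 1) * n powr (a + 1)"
      by (simp add: mult_ac)
  qed
qed

text \<open>With equal exponents and \<gamma> = 1 the sum over \<open>j\<close> is harmonic;
  \<open>k \<ge> 1\<close> restricts it to \<open>j \<le> n\<close>.\<close>

lemma sum_inside_hyp_cross_critical_le:
  assumes "0 \<le> a" "n \<ge> exp 1" "finite F" "\<forall>(k, j)\<in>F. 1 \<le> k \<and> 1 \<le> j \<and> real k * real j \<le> n"
  shows "(\<Sum>(k, j)\<in>F. real k powr a * real j powr a) \<le> 2 * n powr (a + 1) * ln n"
proof -
  have n1: "1 < n" "0 < n" using assms(2) by (smt (verit) exp_gt_one exp_gt_zero)+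
  have ln: "1 \<le> ln n" using assms(2) n1 by (simp add: ln_ge_iff)
  have "(\<Sum>(k, j)\<in>F. real k powr a * real j powr a)
      \<le> n powr (a + 1) * (\<Sum>j\<in>snd ` F. real j powr (- (1 * (a + 1) - a)))"
    by (rule sum_inside_hyp_cross_le_aux) (use assms n1 in auto)
  also have "\<dots> = n powr (a + 1) * (\<Sum>j\<in>snd ` F. real j powr (-1))" by simp
  also have "\<dots> \<le> n powr (a + 1) * (1 + ln n)"
  proof (intro mult_left_mono sum_inverse_le_ln)
    fix j assume "j \<in> snd ` F"
    then obtain k where "(k, j) \<in> F" by auto
    then have k: "1 \<le> k" "1 \<le> j" "real k * real j \<le> n" using assms(4) by auto
    then have "1 * real j \<le> real k * real j" by (intro mult_right_mono) auto
    then show "1 \<le> j \<and> real j \<le> n" using k by linarith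
  qed (use n1 assms in auto)
  also have "\<dots> \<le> n powr (a + 1) * (2 * ln n)" using ln by (intro mult_left_mono) auto
  finally show ?thesis by (simp add: mult_ac)
qed

section \<open>Finite l_p bounds on power weights and Hoelder's inequality\<close>

text \<open>The exponent is \<open>p = 1 / \<theta>\<close>, with \<open>p = \<infinity>\<close> encoded by \<open>\<theta> = 0\<close>; the family \<open>v\<close> is meant to be
  nonnegative.\<close>

definition lp_bounded :: "real \<Rightarrow> 'i set \<Rightarrow> ('i \<Rightarrow> real) \<Rightarrow> real \<Rightarrow> bool" where
  "lp_bounded \<theta> F v K \<longleftrightarrow>
     (if \<theta> = 0 then \<forall>i\<in>F. v i \<le> K else (\<Sum>i\<in>F. v i powr (1 / \<theta>)) \<le> K powr (1 / \<theta>))"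

lemma lp_boundedI:
  assumes "0 < \<theta>" "0 \<le> C" "0 \<le> X" "(\<Sum>i\<in>F. v i powr (1 / \<theta>)) \<le> C * X powr (1 / \<theta>)"
  shows "lp_bounded \<theta> F v (C powr \<theta> * X)"
  using assms by (simp add: lp_bounded_def powr_mult powr_powr)

text \<open>Squares of an l_p family form an l_(p/2) family, so the reciprocal exponent doubles.
  This serves the argument through orthogonality.\<close>

lemma lp_bounded_power2:
  assumes "lp_bounded \<theta> F v K" "0 \<le> K" "\<And>i. i \<in> F \<Longrightarrow> 0 \<le> v i"
  shows "lp_bounded (2 * \<theta>) F (\<lambda>i. (v i)\<^sup>2) (K\<^sup>2)"
proof -
  have sq: "(x\<^sup>2) powr (1 / (2 * \<theta>)) = x powr (1 / \<theta>)" if "0 \<le> x" for x :: real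
    using that by (cases "x = 0") (auto simp: powr_powr simp flip: powr_numeral)
  show ?thesis using assms by (auto simp: lp_bounded_def sq power_mono)
qed

text \<open>Young's inequality for the normalised families \<open>a / K\<close> and
  \<open>b / L\<close>, summed; it uses the bounds \<open>K\<close> and \<open>L\<close> directly in
  place of the exact norms.\<close>

lemma Hoelder_sum_aux:
  fixes a b :: "'i \<Rightarrow> real"
  assumes "0 < \<theta>" "0 < \<eta>" "\<theta> + \<eta> = 1" "lp_bounded \<theta> F a K" "lp_bounded \<eta> F b L" "0 < K" "0 < L"
    and nonneg: "\<And>i. i \<in> F \<Longrightarrow> 0 \<le> a i" "\<And>i. i \<in> F \<Longrightarrow> 0 \<le> b i"
  shows "(\<Sum>i\<in>F. a i * b i) \<le> K * L"
proof -
  have "(\<Sum>i\<in>F. (a i / K) * (b i / L))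
      \<le> (\<Sum>i\<in>F. (a i / K) powr (1 / \<theta>) / (1 / \<theta>) + (b i / L) powr (1 / \<eta>) / (1 / \<eta>))"
    using assms by (intro sum_mono Youngs_inequality) auto
  also have "\<dots> = \<theta> * ((\<Sum>i\<in>F. a i powr (1 / \<theta>)) / K powr (1 / \<theta>))
      + \<eta> * ((\<Sum>i\<in>F. b i powr (1 / \<eta>)) / L powr (1 / \<eta>))"
    using nonneg assms
    by (simp add: sum.distrib powr_divide sum_divide_distrib sum_distrib_left mult.commute)
  also have "\<dots> \<le> \<theta> * 1 + \<eta> * 1"
    using assms by (intro add_mono mult_left_mono) (auto simp: lp_bounded_def)
  finally have "(\<Sum>i\<in>F. a i * b i) / (K * L) \<le> 1"
    using assms(3) by (simp add: sum_divide_distrib)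
  then show ?thesis using assms by (simp add: field_simps)
qed

lemma Hoelder_sum:
  fixes a b :: "'i \<Rightarrow> real"
  assumes "0 \<le> \<theta>" "0 \<le> \<eta>" "\<theta> + \<eta> = 1" "lp_bounded \<theta> F a K" "lp_bounded \<eta> F b L" "0 < K" "0 < L"
    and nonneg: "\<And>i. i \<in> F \<Longrightarrow> 0 \<le> a i" "\<And>i. i \<in> F \<Longrightarrow> 0 \<le> b i"
  shows "(\<Sum>i\<in>F. a i * b i) \<le> K * L"
proof -
  have extreme: "(\<Sum>i\<in>F. a i * b i) \<le> K * L"
    if "\<forall>i\<in>F. a i \<le> K" "(\<Sum>i\<in>F. b i powr 1) \<le> L" "0 < K"
      "\<And>i. i \<in> F \<Longrightarrow> 0 \<le> a i" "\<And>i. i \<in> F \<Longrightarrow> 0 \<le> b i" for a b :: "'i \<Rightarrow> real" and K L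
  proof -
    have "(\<Sum>i\<in>F. a i * b i) \<le> (\<Sum>i\<in>F. K * b i powr 1)"
      using that by (intro sum_mono mult_mono) auto
    also have "\<dots> = K * (\<Sum>i\<in>F. b i powr 1)" by (simp add: sum_distrib_left)
    also have "\<dots> \<le> K * L" using that by (intro mult_left_mono) auto
    finally show ?thesis .
  qed
  consider "\<theta> = 0" "\<eta> = 1" | "\<theta> = 1" "\<eta> = 0" | "0 < \<theta>" "0 < \<eta>"
    using assms(1-3) by fastforce
  then show ?thesis
  proof cases
    case 1
    then show ?thesis using assms by (intro extreme) (auto simp: lp_bounded_def)
  next
    case 2
    then have "(\<Sum>i\<in>F. b i * a i) \<le> L * K" using assms by (intro extreme) (auto simp: lp_bounded_def)
    then show ?thesis by (simp add: mult.commute)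
  next
    case 3
    then show ?thesis using assms by (intro Hoelder_sum_aux[of \<theta> \<eta>]) auto
  qed
qed

text \<open>For \<theta> > 0 this is the sum estimate with exponents \<open>A / \<theta>\<close> and
  \<open>B / \<theta>\<close>. For \<theta> = 0 the hypothesis reads
  \<open>\<gamma> * A < B\<close>, and the weight is at most
  \<open>(k * j powr \<gamma>) powr (-A)\<close>.\<close>

lemma lp_bounded_outside_hyp_cross:
  assumes "0 \<le> \<theta>" "\<theta> < A" "\<gamma> * (A - \<theta>) < B - \<theta>"
  shows "\<exists>C>0. \<forall>n>0. \<forall>F. finite F \<longrightarrow> (\<forall>(k, j)\<in>F. 1 \<le> k \<and> 1 \<le> j \<and> n \<le> real k * real j powr \<gamma>) \<longrightarrow>
    lp_bounded \<theta> F (\<lambda>(k, j). real k powr (-A) * real j powr (-B)) (C * n powr (\<theta> - A))"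
proof (cases "\<theta> = 0")
  case True
  have "real k powr (-A) * real j powr (-B) \<le> n powr (-A)"
    if "0 < n" "1 \<le> k" "1 \<le> j" "n \<le> real k * real j powr \<gamma>" for n k j
  proof -
    have "real k powr (-A) * real j powr (-B) \<le> real k powr (-A) * real j powr (\<gamma> * (-A))"
      using that assms True by (intro mult_left_mono powr_mono) auto
    also have "\<dots> = (real k * real j powr \<gamma>) powr (-A)" by (simp add: powr_mult powr_powr)
    also have "\<dots> \<le> n powr (-A)" using that assms True by (intro powr_mono2') auto
    finally show ?thesis .
  qed
  then show ?thesis using True
    by (intro exI[of _ 1]) (auto simp: lp_bounded_def)
next
  case False
  with assms have \<theta>: "0 < \<theta>" by simp
  have "1 < A / \<theta>" "\<gamma> * (A / \<theta> - 1) + 1 < B / \<theta>"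
    using assms \<theta> divide_strict_right_mono[OF assms(3) \<theta>]
    by (simp_all add: diff_divide_distrib right_diff_distrib)
  from sum_outside_hyp_cross_le[OF this] obtain C where C: "0 < C"
    "\<forall>n>0. \<forall>F. finite F \<longrightarrow> (\<forall>(k, j)\<in>F. 1 \<le> k \<and> 1 \<le> j \<and> n \<le> real k * real j powr \<gamma>) \<longrightarrow>
      (\<Sum>(k, j)\<in>F. real k powr (-(A / \<theta>)) * real j powr (-(B / \<theta>))) \<le> C * n powr (1 - A / \<theta>)"
    by (elim exE conjE) (rule that)
  show ?thesis
  proof (intro exI[of _ "C powr \<theta>"] conjI allI impI lp_boundedI)
    fix n :: real and F :: "(nat \<times> nat) set"
    assume n: "0 < n" and F: "finite F" "\<forall>(k, j)\<in>F. 1 \<le> k \<and> 1 \<le> j \<and> n \<le> real k * real j powr \<gamma>"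
    have "(\<Sum>i\<in>F. (case i of (k, j) \<Rightarrow> real k powr (-A) * real j powr (-B)) powr (1 / \<theta>))
        = (\<Sum>(k, j)\<in>F. real k powr (-(A / \<theta>)) * real j powr (-(B / \<theta>)))"
      by (intro sum.cong) (auto simp: powr_mult powr_powr)
    also have "\<dots> \<le> C * n powr (1 - A / \<theta>)" by (rule C(2)[THEN spec, THEN mp, OF n, THEN spec, THEN mp, OF F(1), THEN mp, OF F(2)])
    also have "n powr (1 - A / \<theta>) = (n powr (\<theta> - A)) powr (1 / \<theta>)"
      using \<theta> by (simp add: powr_powr diff_divide_distrib)
    finally show "(\<Sum>i\<in>F. (case i of (k, j) \<Rightarrow> real k powr (-A) * real j powr (-B)) powr (1 / \<theta>))
        \<le> C * (n powr (\<theta> - A)) powr (1 / \<theta>)" .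
  qed (use C \<theta> in auto)
qed

text \<open>The sum of the \<open>1 / \<theta>\<close>-th powers carries one logarithm; undoing the
  power leaves \<open>ln n powr \<theta>\<close>, which disappears for the supremum.\<close>

lemma lp_bounded_outside_hyp_cross_critical:
  assumes "0 \<le> \<theta>" "\<theta> < A" "0 < \<gamma>" "\<gamma> * (A - \<theta>) = B - \<theta>"
  shows "\<exists>C>0. \<forall>n\<ge>exp 1. \<forall>F. finite F \<longrightarrow> (\<forall>(k, j)\<in>F. 1 \<le> k \<and> 1 \<le> j \<and> n \<le> real k * real j powr \<gamma>) \<longrightarrow>
    lp_bounded \<theta> F (\<lambda>(k, j). real k powr (-A) * real j powr (-B)) (C * (n powr (\<theta> - A) * ln n powr \<theta>))"
proof (cases "\<theta> = 0")
  case True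
  have "real k powr (-A) * real j powr (-B) \<le> n powr (-A)"
    if "exp 1 \<le> n" "1 \<le> k" "1 \<le> j" "n \<le> real k * real j powr \<gamma>" for n k j
  proof -
    have n1: "1 < n" "0 < n" using that(1) by (smt (verit) exp_gt_one exp_gt_zero)+
    have "real k powr (-A) * real j powr (-B) = real k powr (-A) * real j powr (\<gamma> * (-A))"
      using assms True by simp
    also have "\<dots> = (real k * real j powr \<gamma>) powr (-A)" by (simp add: powr_mult powr_powr)
    also have "\<dots> \<le> n powr (-A)" using that assms True n1 by (intro powr_mono2') auto
    finally show ?thesis .
  qed
  note key = this
  show ?thesis
  proof (intro exI[of _ 1] conjI allI impI)
    fix n :: real and F :: "(nat \<times> nat) set"
    assume n: "exp 1 \<le> n" and F: "\<forall>(k, j)\<in>F. 1 \<le> k \<and> 1 \<le> j \<and> n \<le> real k * real j powr \<gamma>"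
    have "0 < n" using n exp_gt_zero[of "1::real"] by linarith
    \<comment> \<open>Needed for \<open>ln n powr 0 = 1\<close>, since
      \<open>0 powr 0 = 0\<close>.\<close>
    then have "ln n \<noteq> 0" using n ln_ge_iff[of n 1] by auto
    moreover have "\<forall>i\<in>F. (case i of (k, j) \<Rightarrow> real k powr (-A) * real j powr (-B)) \<le> n powr (-A)"
      using F key[OF n] by auto
    ultimately show "lp_bounded \<theta> F (\<lambda>(k, j). real k powr (-A) * real j powr (-B))
        (1 * (n powr (\<theta> - A) * ln n powr \<theta>))"
      using True by (simp add: lp_bounded_def)
  qed simp
next
  case False
  with assms have \<theta>: "0 < \<theta>" by simp
  have "1 < A / \<theta>" "\<gamma> * (A / \<theta> - 1) + 1 = B / \<theta>"
    using assms \<theta> by (simp_all add: field_simps)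
  from sum_outside_hyp_cross_critical_le[OF this(1) assms(3) this(2)] obtain C where C: "0 < C"
    "\<forall>n\<ge>exp 1. \<forall>F. finite F \<longrightarrow> (\<forall>(k, j)\<in>F. 1 \<le> k \<and> 1 \<le> j \<and> n \<le> real k * real j powr \<gamma>) \<longrightarrow>
      (\<Sum>(k, j)\<in>F. real k powr (-(A / \<theta>)) * real j powr (-(B / \<theta>))) \<le> C * n powr (1 - A / \<theta>) * ln n"
    by (elim exE conjE) (rule that)
  show ?thesis
  proof (intro exI[of _ "C powr \<theta>"] conjI allI impI lp_boundedI)
    fix n :: real and F :: "(nat \<times> nat) set"
    assume n: "exp 1 \<le> n" and F: "finite F" "\<forall>(k, j)\<in>F. 1 \<le> k \<and> 1 \<le> j \<and> n \<le> real k * real j powr \<gamma>"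
    have n1: "1 < n" using n by (smt (verit) exp_gt_one)
    have "(\<Sum>i\<in>F. (case i of (k, j) \<Rightarrow> real k powr (-A) * real j powr (-B)) powr (1 / \<theta>))
        = (\<Sum>(k, j)\<in>F. real k powr (-(A / \<theta>)) * real j powr (-(B / \<theta>)))"
      by (intro sum.cong) (auto simp: powr_mult powr_powr)
    also have "\<dots> \<le> C * n powr (1 - A / \<theta>) * ln n" by (rule C(2)[THEN spec, THEN mp, OF n, THEN spec, THEN mp, OF F(1), THEN mp, OF F(2)])
    also have "\<dots> = C * (n powr (\<theta> - A) * ln n powr \<theta>) powr (1 / \<theta>)"
      using \<theta> n1 by (simp add: powr_powr powr_mult diff_divide_distrib)
    finally show "(\<Sum>i\<in>F. (case i of (k, j) \<Rightarrow> real k powr (-A) * real j powr (-B)) powr (1 / \<theta>))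
        \<le> C * (n powr (\<theta> - A) * ln n powr \<theta>) powr (1 / \<theta>)" .
    show "0 \<le> n powr (\<theta> - A) * ln n powr \<theta>" by simp
  qed (use C \<theta> in auto)
qed

lemma lp_bounded_inside_hyp_cross:
  assumes "0 \<le> \<theta>" "0 \<le> a" "b + \<theta> < \<gamma> * (a + \<theta>)"
  shows "\<exists>C>0. \<forall>n>0. \<forall>F. finite F \<longrightarrow> (\<forall>(k, j)\<in>F. 1 \<le> k \<and> 1 \<le> j \<and> real k * real j powr \<gamma> \<le> n) \<longrightarrow>
    lp_bounded \<theta> F (\<lambda>(k, j). real k powr a * real j powr b) (C * n powr (a + \<theta>))"
proof (cases "\<theta> = 0")
  case True
  have "real k powr a * real j powr b \<le> n powr a"
    if "0 < n" "1 \<le> k" "1 \<le> j" "real k * real j powr \<gamma> \<le> n" for n k j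
  proof -
    have "real k powr a * real j powr b \<le> real k powr a * real j powr (\<gamma> * a)"
      using that assms True by (intro mult_left_mono powr_mono) auto
    also have "\<dots> = (real k * real j powr \<gamma>) powr a" by (simp add: powr_mult powr_powr)
    also have "\<dots> \<le> n powr a" using that assms True by (intro powr_mono2) auto
    finally show ?thesis .
  qed
  then show ?thesis using True
    by (intro exI[of _ 1]) (auto simp: lp_bounded_def)
next
  case False
  with assms have \<theta>: "0 < \<theta>" by simp
  have "0 \<le> a / \<theta>" "b / \<theta> + 1 < \<gamma> * (a / \<theta> + 1)"
    using assms \<theta> divide_strict_right_mono[OF assms(3) \<theta>]
    by (simp_all add: add_divide_distrib distrib_left)
  from sum_inside_hyp_cross_le[OF this] obtain C where C: "0 < C"
    "\<forall>n>0. \<forall>F. finite F \<longrightarrow> (\<forall>(k, j)\<in>F. 1 \<le> k \<and> 1 \<le> j \<and> real k * real j powr \<gamma> \<le> n) \<longrightarrow>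
      (\<Sum>(k, j)\<in>F. real k powr (a / \<theta>) * real j powr (b / \<theta>)) \<le> C * n powr (a / \<theta> + 1)"
    by (elim exE conjE) (rule that)
  show ?thesis
  proof (intro exI[of _ "C powr \<theta>"] conjI allI impI lp_boundedI)
    fix n :: real and F :: "(nat \<times> nat) set"
    assume n: "0 < n" and F: "finite F" "\<forall>(k, j)\<in>F. 1 \<le> k \<and> 1 \<le> j \<and> real k * real j powr \<gamma> \<le> n"
    have "(\<Sum>i\<in>F. (case i of (k, j) \<Rightarrow> real k powr a * real j powr b) powr (1 / \<theta>))
        = (\<Sum>(k, j)\<in>F. real k powr (a / \<theta>) * real j powr (b / \<theta>))"
      by (intro sum.cong) (auto simp: powr_mult powr_powr)
    also have "\<dots> \<le> C * n powr (a / \<theta> + 1)" by (rule C(2)[THEN spec, THEN mp, OF n, THEN spec, THEN mp, OF F(1), THEN mp, OF F(2)])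
    also have "n powr (a / \<theta> + 1) = (n powr (a + \<theta>)) powr (1 / \<theta>)"
      using \<theta> by (simp add: powr_powr add_divide_distrib)
    finally show "(\<Sum>i\<in>F. (case i of (k, j) \<Rightarrow> real k powr a * real j powr b) powr (1 / \<theta>))
        \<le> C * (n powr (a + \<theta>)) powr (1 / \<theta>)" .
  qed (use C \<theta> in auto)
qed

lemma lp_bounded_inside_hyp_cross_critical:
  assumes "0 \<le> \<theta>" "0 \<le> a"
  shows "\<exists>C>0. \<forall>n\<ge>exp 1. \<forall>F. finite F \<longrightarrow> (\<forall>(k, j)\<in>F. 1 \<le> k \<and> 1 \<le> j \<and> real k * real j \<le> n) \<longrightarrow>
    lp_bounded \<theta> F (\<lambda>(k, j). real k powr a * real j powr a) (C * (n powr (a + \<theta>) * ln n powr \<theta>))"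
proof (cases "\<theta> = 0")
  case True
  have "real k powr a * real j powr a \<le> n powr a"
    if "exp 1 \<le> n" "1 \<le> k" "1 \<le> j" "real k * real j \<le> n" for n k j
  proof -
    have n1: "1 < n" "0 < n" using that(1) by (smt (verit) exp_gt_one exp_gt_zero)+
    have "real k powr a * real j powr a = (real k * real j) powr a" by (simp add: powr_mult)
    also have "\<dots> \<le> n powr a" using that assms True by (intro powr_mono2) auto
    finally show ?thesis .
  qed
  note key = this
  show ?thesis
  proof (intro exI[of _ 1] conjI allI impI)
    fix n :: real and F :: "(nat \<times> nat) set"
    assume n: "exp 1 \<le> n" and F: "\<forall>(k, j)\<in>F. 1 \<le> k \<and> 1 \<le> j \<and> real k * real j \<le> n"
    have "0 < n" using n exp_gt_zero[of "1::real"] by linarith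
    then have "ln n \<noteq> 0" using n ln_ge_iff[of n 1] by auto
    moreover have "\<forall>i\<in>F. (case i of (k, j) \<Rightarrow> real k powr a * real j powr a) \<le> n powr a"
      using F key[OF n] by auto
    ultimately show "lp_bounded \<theta> F (\<lambda>(k, j). real k powr a * real j powr a)
        (1 * (n powr (a + \<theta>) * ln n powr \<theta>))"
      using True by (simp add: lp_bounded_def)
  qed simp
next
  case False
  with assms have \<theta>: "0 < \<theta>" by simp
  show ?thesis
  proof (intro exI[of _ "2 powr \<theta>"] conjI allI impI lp_boundedI)
    fix n :: real and F :: "(nat \<times> nat) set"
    assume n: "exp 1 \<le> n" and F: "finite F" "\<forall>(k, j)\<in>F. 1 \<le> k \<and> 1 \<le> j \<and> real k * real j \<le> n"
    have n1: "1 < n" using n by (smt (verit) exp_gt_one)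
    have "(\<Sum>i\<in>F. (case i of (k, j) \<Rightarrow> real k powr a * real j powr a) powr (1 / \<theta>))
        = (\<Sum>(k, j)\<in>F. real k powr (a / \<theta>) * real j powr (a / \<theta>))"
      by (intro sum.cong) (auto simp: powr_mult powr_powr)
    also have "\<dots> \<le> 2 * n powr (a / \<theta> + 1) * ln n"
      using assms n F by (intro sum_inside_hyp_cross_critical_le) auto
    also have "\<dots> = 2 * (n powr (a + \<theta>) * ln n powr \<theta>) powr (1 / \<theta>)"
      using \<theta> n1 by (simp add: powr_powr powr_mult add_divide_distrib)
    finally show "(\<Sum>i\<in>F. (case i of (k, j) \<Rightarrow> real k powr a * real j powr a) powr (1 / \<theta>))
        \<le> 2 * (n powr (a + \<theta>) * ln n powr \<theta>) powr (1 / \<theta>)" .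
    show "0 \<le> n powr (a + \<theta>) * ln n powr \<theta>" by simp
  qed (use \<theta> in auto)
qed

section \<open>Tensor products of differentiated Legendre polynomials\<close>

lemma in_L2_iff: "in_L2 f \<longleftrightarrow> sq_integrable (lebesgue_on Qsq) f"
  by (simp add: in_L2_def sq_integrable_def)

lemma L2_norm_eq: "L2_norm f = l2norm (lebesgue_on Qsq) f"
  by (simp add: L2_norm_def l2norm_def)

lemma Qsq_cbox: "Qsq = cbox (-1, -1) (1, 1)"
  by (simp add: Qsq_def cbox_Pair_eq)

lemma continuous_imp_integrable_Qsq:
  "continuous_on UNIV f \<Longrightarrow> integrable (lebesgue_on Qsq) (f :: real \<times> real \<Rightarrow> real)"
  unfolding Qsq_cbox by (rule continuous_imp_integrable) (auto intro: continuous_on_subset)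

lemma continuous_imp_sq_integrable_Qsq:
  assumes "continuous_on UNIV f"
  shows "sq_integrable (lebesgue_on Qsq) f"
  unfolding sq_integrable_def
  using assms by (auto intro!: continuous_imp_integrable_Qsq continuous_intros borel_measurable_integrable)

text \<open>Fubini for continuous integrands. Here the Lebesgue integrals of the L2 norms meet the
  gauge integral in \<open>poly_ip\<close>.\<close>

lemma integral_Qsq_tensor:
  fixes f g :: "real \<Rightarrow> real"
  assumes "continuous_on UNIV f" "continuous_on UNIV g"
  shows "(LINT x|lebesgue_on Qsq. f (fst x) * g (snd x)) = integral {-1..1} f * integral {-1..1} g"
proof -
  have cont: "continuous_on UNIV (\<lambda>x :: real \<times> real. f (fst x) * g (snd x))"
    by (intro continuous_intros continuous_on_compose2[OF assms(1)] continuous_on_compose2[OF assms(2)]) auto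
  have "(LINT x|lebesgue_on Qsq. f (fst x) * g (snd x)) = integral Qsq (\<lambda>x. f (fst x) * g (snd x))"
    by (rule lebesgue_integral_eq_integral[OF continuous_imp_integrable_Qsq[OF cont]]) (simp add: Qsq_cbox)
  also have "\<dots> = integral (cbox (-1) 1) (\<lambda>t. integral (cbox (-1) 1) (\<lambda>\<tau>. f t * g \<tau>))"
    unfolding Qsq_cbox
    using integral_prod_continuous[of "-1" "-1" 1 1 "\<lambda>x. f (fst x) * g (snd x)"] cont
    by (auto intro: continuous_on_subset)
  also have "\<dots> = integral {-1..1} f * integral {-1..1} g" by simp
  finally show ?thesis .
qed

lemma parseval:
  assumes "finite P"
  shows "(l2norm (lebesgue_on Qsq) (\<lambda>x. \<Sum>i\<in>P. d i * (poly (legendre (fst i)) (fst x) * poly (legendre (snd i)) (snd x))))\<^sup>2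
    = (\<Sum>i\<in>P. (d i)\<^sup>2)"
proof -
  let ?M = "lebesgue_on Qsq"
  let ?\<phi> = "\<lambda>i x. poly (legendre (fst i)) (fst x) * poly (legendre (snd i)) (snd x)"
  have int: "integrable ?M (\<lambda>x. d i * d i' * (?\<phi> i x * ?\<phi> i' x))" for i i'
    by (intro continuous_imp_integrable_Qsq continuous_intros)
  have ortho: "(LINT x|?M. ?\<phi> i x * ?\<phi> i' x) = (if i = i' then 1 else 0)" for i i'
  proof -
    have "(LINT x|?M. ?\<phi> i x * ?\<phi> i' x)
        = (LINT x|?M. (poly (legendre (fst i)) (fst x) * poly (legendre (fst i')) (fst x))
            * (poly (legendre (snd i)) (snd x) * poly (legendre (snd i')) (snd x)))"
      by (simp only: ac_simps)
    also have "\<dots> = poly_ip (legendre (fst i)) (legendre (fst i')) * poly_ip (legendre (snd i)) (legendre (snd i'))"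
      unfolding poly_ip_def
      by (rule integral_Qsq_tensor[where f = "\<lambda>t. poly (legendre (fst i)) t * poly (legendre (fst i')) t"
            and g = "\<lambda>t. poly (legendre (snd i)) t * poly (legendre (snd i')) t"]) (intro continuous_intros)+
    finally show ?thesis by (auto simp: poly_ip_legendre prod_eq_iff)
  qed
  have "(\<Sum>i\<in>P. d i * ?\<phi> i x)\<^sup>2 = (\<Sum>i\<in>P. \<Sum>i'\<in>P. d i * d i' * (?\<phi> i x * ?\<phi> i' x))" for x
    unfolding power2_eq_square sum_product by (simp only: ac_simps)
  then have "(l2norm ?M (\<lambda>x. \<Sum>i\<in>P. d i * ?\<phi> i x))\<^sup>2
      = (LINT x|?M. (\<Sum>i\<in>P. \<Sum>i'\<in>P. d i * d i' * (?\<phi> i x * ?\<phi> i' x)))"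
    unfolding l2norm_power2 by simp
  also have "\<dots> = (\<Sum>i\<in>P. \<Sum>i'\<in>P. (LINT x|?M. d i * d i' * (?\<phi> i x * ?\<phi> i' x)))"
    using int by (subst Bochner_Integration.integral_sum; (intro Bochner_Integration.integrable_sum)?)
      (auto intro!: sum.cong Bochner_Integration.integral_sum)
  also have "\<dots> = (\<Sum>i\<in>P. \<Sum>i'\<in>P. d i * d i' * (if i = i' then 1 else 0))"
    unfolding integral_mult_right_zero ortho ..
  also have "\<dots> = (\<Sum>i\<in>P. (d i)\<^sup>2)"
    using assms by (simp add: if_distrib power2_eq_square cong: if_cong)
  finally show ?thesis .
qed

definition deriv_tensor :: "nat \<Rightarrow> nat \<Rightarrow> nat \<times> nat \<Rightarrow> real \<times> real \<Rightarrow> real" where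
  "deriv_tensor r1 r2 i x = legendre_deriv r1 (fst i) (fst x) * legendre_deriv r2 (snd i) (snd x)"

lemma sq_integrable_deriv_tensor: "sq_integrable (lebesgue_on Qsq) (deriv_tensor r1 r2 i)"
  unfolding deriv_tensor_def legendre_deriv_def
  by (intro continuous_imp_sq_integrable_Qsq continuous_intros)

lemma sq_integrable_deriv_tensor_sum:
  "sq_integrable (lebesgue_on Qsq) (\<lambda>x. \<Sum>i\<in>F. u i * deriv_tensor r1 r2 i x)"
  by (intro sq_integrable_sum sq_integrable_cmult sq_integrable_deriv_tensor)

text \<open>By orthonormality the squared norm is a sum of \<open>k\<close> squared coefficients,
  each of order \<open>k powr (4 r - 3) * k\<close>; together this is
  \<open>k powr (4 r - 1)\<close>.\<close>

lemma poly_ip_legendre_deriv_le: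
  assumes "1 \<le> r"
  shows "\<exists>C>0. \<forall>k\<ge>1. poly_ip ((pderiv ^^ r) (legendre k)) ((pderiv ^^ r) (legendre k))
    \<le> (C * real k powr (2 * real r - 1/2))\<^sup>2"
proof -
  obtain C where C: "C > 0"
    "\<And>k l. 1 \<le> k \<Longrightarrow> \<bar>deriv_coef r k l\<bar> \<le> C * real k powr (2 * real r - 3/2) * sqrt (real l + 1)"
    using deriv_coef_bound[OF assms] by blast
  show ?thesis
  proof (intro exI[of _ C] conjI allI impI)
    fix k :: nat assume k: "1 \<le> k"
    let ?p = "(pderiv ^^ r) (legendre k)"
    have "poly_ip ?p ?p = poly_ip (\<Sum>l<k. smult (deriv_coef r k l) (legendre l)) ?p"
      using legendre_deriv_expansion[OF assms order_refl, of k] by simp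
    also have "\<dots> = (\<Sum>l<k. (deriv_coef r k l)\<^sup>2)"
      by (simp add: poly_ip_sum poly_ip_smult poly_ip_commute[of "legendre _"] deriv_coef_def power2_eq_square)
    also have "\<dots> \<le> (\<Sum>l<k. (C * real k powr (2 * real r - 3/2))\<^sup>2 * real k)"
    proof (rule sum_mono)
      fix l assume l: "l \<in> {..<k}"
      have "(deriv_coef r k l)\<^sup>2 \<le> (C * real k powr (2 * real r - 3/2) * sqrt (real l + 1))\<^sup>2"
        using C(2)[OF k, of l] by (metis abs_ge_zero power2_abs power_mono)
      also have "\<dots> = (C * real k powr (2 * real r - 3/2))\<^sup>2 * (real l + 1)"
        by (simp add: power_mult_distrib)
      also have "\<dots> \<le> (C * real k powr (2 * real r - 3/2))\<^sup>2 * real k"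
        using l by (intro mult_left_mono) auto
      finally show "(deriv_coef r k l)\<^sup>2 \<le> (C * real k powr (2 * real r - 3/2))\<^sup>2 * real k" .
    qed
    also have "\<dots> = (C * (real k powr (2 * real r - 3/2) * real k powr 1))\<^sup>2"
      by (simp add: power2_eq_square)
    also have "\<dots> = (C * real k powr (2 * real r - 1/2))\<^sup>2"
      unfolding powr_add[symmetric] by simp
    finally show "poly_ip ?p ?p \<le> (C * real k powr (2 * real r - 1/2))\<^sup>2" .
  qed (use C in simp)
qed

lemma l2norm_deriv_tensor_le:
  assumes "1 \<le> r1" "1 \<le> r2"
  shows "\<exists>C>0. \<forall>k\<ge>1. \<forall>j\<ge>1. l2norm (lebesgue_on Qsq) (deriv_tensor r1 r2 (k, j))
    \<le> C * (real k powr (2 * real r1 - 1/2) * real j powr (2 * real r2 - 1/2))"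
proof -
  obtain C where C: "C > 0" "\<forall>k\<ge>1. poly_ip ((pderiv ^^ r1) (legendre k)) ((pderiv ^^ r1) (legendre k))
    \<le> (C * real k powr (2 * real r1 - 1/2))\<^sup>2"
    using poly_ip_legendre_deriv_le[OF assms(1)] by blast
  obtain D where D: "D > 0" "\<forall>k\<ge>1. poly_ip ((pderiv ^^ r2) (legendre k)) ((pderiv ^^ r2) (legendre k))
    \<le> (D * real k powr (2 * real r2 - 1/2))\<^sup>2"
    using poly_ip_legendre_deriv_le[OF assms(2)] by blast
  show ?thesis
  proof (intro exI[of _ "C * D"] conjI allI impI)
    fix k j :: nat assume k: "1 \<le> k" and j: "1 \<le> j"
    let ?p = "(pderiv ^^ r1) (legendre k)" and ?q = "(pderiv ^^ r2) (legendre j)"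
    have "(l2norm (lebesgue_on Qsq) (deriv_tensor r1 r2 (k, j)))\<^sup>2
        = (LINT x|lebesgue_on Qsq. (poly ?p (fst x) * poly ?p (fst x)) * (poly ?q (snd x) * poly ?q (snd x)))"
      unfolding l2norm_power2 by (simp only: deriv_tensor_def legendre_deriv_def power2_eq_square fst_conv snd_conv ac_simps)
    also have "\<dots> = poly_ip ?p ?p * poly_ip ?q ?q"
      unfolding poly_ip_def
      by (rule integral_Qsq_tensor[where f = "\<lambda>t. poly ?p t * poly ?p t" and g = "\<lambda>t. poly ?q t * poly ?q t"])
        (intro continuous_intros)+
    also have "\<dots> \<le> (C * real k powr (2 * real r1 - 1/2))\<^sup>2 * (D * real j powr (2 * real r2 - 1/2))\<^sup>2"
      using C D k j by (intro mult_mono) (auto simp: poly_ip_def intro!: integral_nonneg poly_mult_integrable)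
    also have "\<dots> = (C * D * (real k powr (2 * real r1 - 1/2) * real j powr (2 * real r2 - 1/2)))\<^sup>2"
      by (simp add: power_mult_distrib)
    finally show "l2norm (lebesgue_on Qsq) (deriv_tensor r1 r2 (k, j))
        \<le> C * D * (real k powr (2 * real r1 - 1/2) * real j powr (2 * real r2 - 1/2))"
      by (rule power2_le_imp_le) (use C(1) D(1) in simp)
  qed (use C D in simp)
qed

section \<open>Weighted l_2 and l_1 bounds for sums of tensor products\<close>

lemma l2norm_deriv_tensor_sum_power2:
  assumes "1 \<le> r1" "1 \<le> r2" "F \<subseteq> {..K} \<times> {..K}"
  shows "(l2norm (lebesgue_on Qsq) (\<lambda>x. \<Sum>i\<in>F. u i * deriv_tensor r1 r2 i x))\<^sup>2
    = (\<Sum>(l, m)\<in>{..<K} \<times> {..<K}. (\<Sum>(k, j)\<in>F. u (k, j) * deriv_coef r1 k l * deriv_coef r2 j m)\<^sup>2)"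
proof -
  let ?P = "{..<K} \<times> {..<K}"
  have exp: "legendre_deriv r k t = (\<Sum>l<K. deriv_coef r k l * poly (legendre l) t)" if "1 \<le> r" "k \<le> K" for r k t
    unfolding legendre_deriv_def legendre_deriv_expansion[OF that] by (simp add: poly_sum)
  have dt: "deriv_tensor r1 r2 i x = (\<Sum>p\<in>?P. (deriv_coef r1 (fst i) (fst p) * deriv_coef r2 (snd i) (snd p))
      * (poly (legendre (fst p)) (fst x) * poly (legendre (snd p)) (snd x)))" if "i \<in> F" for i x
  proof -
    have "fst i \<le> K" "snd i \<le> K" using that assms(3) by auto
    note e = exp[OF assms(1) this(1)] exp[OF assms(2) this(2)]
    show ?thesis
      unfolding deriv_tensor_def e sum_product sum.cartesian_product case_prod_beta
      by (simp only: ac_simps)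
  qed
  have "(\<Sum>i\<in>F. u i * deriv_tensor r1 r2 i x)
      = (\<Sum>p\<in>?P. (\<Sum>i\<in>F. u i * deriv_coef r1 (fst i) (fst p) * deriv_coef r2 (snd i) (snd p))
          * (poly (legendre (fst p)) (fst x) * poly (legendre (snd p)) (snd x)))" for x
  proof -
    have "(\<Sum>i\<in>F. u i * deriv_tensor r1 r2 i x)
        = (\<Sum>i\<in>F. \<Sum>p\<in>?P. (u i * deriv_coef r1 (fst i) (fst p) * deriv_coef r2 (snd i) (snd p))
          * (poly (legendre (fst p)) (fst x) * poly (legendre (snd p)) (snd x)))"
      by (rule sum.cong[OF refl]) (simp add: dt sum_distrib_left mult.assoc)
    also have "\<dots> = (\<Sum>p\<in>?P. \<Sum>i\<in>F. (u i * deriv_coef r1 (fst i) (fst p) * deriv_coef r2 (snd i) (snd p))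
          * (poly (legendre (fst p)) (fst x) * poly (legendre (snd p)) (snd x)))"
      by (rule sum.swap)
    finally show ?thesis by (simp add: sum_distrib_right)
  qed
  then show ?thesis by (simp add: parseval case_prod_beta)
qed

text \<open>A discrete Hardy inequality: Cauchy--Schwarz with the weight \<open>1 / (k j)\<close> on the sum over
  \<open>k > l\<close>, \<open>j > m\<close>.\<close>

lemma l2norm_deriv_tensor_sum_le_weighted_l2:
  assumes "1 \<le> r1" "1 \<le> r2"
  shows "\<exists>C>0. \<forall>F u. finite F \<longrightarrow> F \<subseteq> {1..} \<times> {1..} \<longrightarrow>
    (l2norm (lebesgue_on Qsq) (\<lambda>x. \<Sum>i\<in>F. u i * deriv_tensor r1 r2 i x))\<^sup>2
      \<le> C * (\<Sum>(k, j)\<in>F. (u (k, j))\<^sup>2 * (real k powr (4 * real r1) * real j powr (4 * real r2)))"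
proof -
  obtain C1 where C1: "C1 > 0"
    "\<And>k l. 1 \<le> k \<Longrightarrow> \<bar>deriv_coef r1 k l\<bar> \<le> C1 * real k powr (2 * real r1 - 3/2) * sqrt (real l + 1)"
    using deriv_coef_bound[OF assms(1)] by blast
  obtain C2 where C2: "C2 > 0"
    "\<And>k l. 1 \<le> k \<Longrightarrow> \<bar>deriv_coef r2 k l\<bar> \<le> C2 * real k powr (2 * real r2 - 3/2) * sqrt (real l + 1)"
    using deriv_coef_bound[OF assms(2)] by blast
  \<comment> \<open>Each of the two one-dimensional tails of \<open>1 / k^2\<close> contributes a
    factor 2, and the coefficient bounds enter squared.\<close>
  define C where "C = 4 * (C1 * C2)\<^sup>2"
  show ?thesis
  proof (intro exI[of _ C] conjI allI impI)
    show "0 < C" using C1 C2 by (simp add: C_def)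
    fix F :: "(nat \<times> nat) set" and u :: "nat \<times> nat \<Rightarrow> real"
    assume F: "finite F" "F \<subseteq> {1..} \<times> {1..}"
    define K where "K = Max (fst ` F \<union> snd ` F \<union> {0})"
    have K: "F \<subseteq> {..K} \<times> {..K}"
      using F(1) by (auto simp: K_def intro!: Max_ge) force+
    define w where "w = (\<lambda>(k, j). (u (k, j))\<^sup>2 * (real k powr (4 * real r1 - 1) * real j powr (4 * real r2 - 1)))"
    have w: "0 \<le> w i" for i by (auto simp: w_def split: prod.split)
    have entry: "(\<Sum>(k, j)\<in>F. u (k, j) * deriv_coef r1 k l * deriv_coef r2 j m)\<^sup>2
        \<le> C * (\<Sum>i\<in>F. if l < fst i \<and> m < snd i then w i else 0)" for l m
    proof -
      \<comment> \<open>Strict triangularity: the pair \<open>(l, m)\<close> receives contributions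
        only from \<open>k > l\<close> and \<open>j > m\<close>.\<close>
      define G where "G = {i\<in>F. l < fst i \<and> m < snd i}"
      have G: "finite G" "G \<subseteq> F" using F by (auto simp: G_def)
      define s where "s = sqrt (real l + 1) * sqrt (real m + 1)"
      define a where "a = (\<lambda>(k, j). \<bar>u (k, j)\<bar> * (real k powr (2 * real r1 - 1/2) * real j powr (2 * real r2 - 1/2)))"
      \<comment> \<open>Splitting \<open>1 / (k j)\<close> off the coefficient bounds leaves the
        weight \<open>a\<close>. The squares of \<open>b\<close> over \<open>k > l\<close>,
        \<open>j > m\<close> sum to at most \<open>4 / s^2\<close>, which cancels the factor
        \<open>s^2 = (l + 1) (m + 1)\<close> of the coefficient bounds.\<close>
      define b where "b = (\<lambda>(k, j). real k powr (-1) * real j powr (-1))"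
      have "\<bar>\<Sum>(k, j)\<in>F. u (k, j) * deriv_coef r1 k l * deriv_coef r2 j m\<bar>
          = \<bar>\<Sum>(k, j)\<in>G. u (k, j) * deriv_coef r1 k l * deriv_coef r2 j m\<bar>"
        using F deriv_coef_eq_0[OF assms(1)] deriv_coef_eq_0[OF assms(2)]
        by (intro arg_cong[of _ _ abs] sum.mono_neutral_right) (auto simp: G_def, (meson not_less)+)
      also have "\<dots> \<le> (\<Sum>i\<in>G. C1 * C2 * s * (a i * b i))"
      proof (rule order.trans[OF sum_abs sum_mono])
        fix i assume "i \<in> G"
        then obtain k j where i: "i = (k, j)" "1 \<le> k" "1 \<le> j" using F G by (cases i) auto
        have "\<bar>u (k, j)\<bar> * \<bar>deriv_coef r1 k l\<bar> * \<bar>deriv_coef r2 j m\<bar>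
            \<le> \<bar>u (k, j)\<bar> * (C1 * real k powr (2 * real r1 - 3/2) * sqrt (real l + 1))
              * (C2 * real j powr (2 * real r2 - 3/2) * sqrt (real m + 1))"
          using C1 C2 i by (intro mult_mono) auto
        also have "real k powr (2 * real r1 - 3/2) = real k powr (2 * real r1 - 1/2) * real k powr (-1)"
          unfolding powr_add[symmetric] by simp
        also have "real j powr (2 * real r2 - 3/2) = real j powr (2 * real r2 - 1/2) * real j powr (-1)"
          unfolding powr_add[symmetric] by simp
        finally show "\<bar>case i of (k, j) \<Rightarrow> u (k, j) * deriv_coef r1 k l * deriv_coef r2 j m\<bar> \<le> C1 * C2 * s * (a i * b i)"
          by (simp only: i prod.case a_def b_def s_def abs_mult mult_ac)
      qed
      also have "\<dots> = C1 * C2 * s * (\<Sum>i\<in>G. a i * b i)" by (simp add: sum_distrib_left)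
      finally have "\<bar>\<Sum>(k, j)\<in>F. u (k, j) * deriv_coef r1 k l * deriv_coef r2 j m\<bar>\<^sup>2
          \<le> (C1 * C2 * s * (\<Sum>i\<in>G. a i * b i))\<^sup>2"
        by (rule power_mono) simp
      then have "(\<Sum>(k, j)\<in>F. u (k, j) * deriv_coef r1 k l * deriv_coef r2 j m)\<^sup>2
          \<le> (C1 * C2 * s * (\<Sum>i\<in>G. a i * b i))\<^sup>2"
        by (simp only: power2_abs)
      also have "\<dots> = (C1 * C2)\<^sup>2 * s\<^sup>2 * (\<Sum>i\<in>G. a i * b i)\<^sup>2" by (simp add: power_mult_distrib)
      also have "\<dots> \<le> (C1 * C2)\<^sup>2 * s\<^sup>2 * ((\<Sum>i\<in>G. (a i)\<^sup>2) * (4 / s\<^sup>2))"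
      proof (intro mult_left_mono order.trans[OF Cauchy_Schwarz_ineq_sum])
        have sq: "(x powr (-1))\<^sup>2 = x powr (-2)" for x :: real
          unfolding power2_eq_square powr_add[symmetric] by simp
        have tail: "(\<Sum>k\<in>A. real k powr (-2)) \<le> 2 / (real l + 1)" if "finite A" "\<And>k. k \<in> A \<Longrightarrow> l < k" for A l
          using sum_powr_neg_tail_le[of 2 "real l + 1" A] that by (force simp: powr_minus_divide Suc_le_eq)
        \<comment> \<open>Enlarging \<open>G\<close> to the product of its projections keeps
          \<open>k > l\<close> and \<open>j > m\<close>, and the sum factorises.\<close>
        have "(\<Sum>i\<in>G. (b i)\<^sup>2) \<le> (\<Sum>i\<in>fst ` G \<times> snd ` G. (b i)\<^sup>2)"
          using G by (intro sum_mono2) force+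
        also have "\<dots> = (\<Sum>k\<in>fst ` G. real k powr (-2)) * (\<Sum>j\<in>snd ` G. real j powr (-2))"
          by (simp only: b_def sum_product sum.cartesian_product power_mult_distrib sq case_prod_beta')
        also have "\<dots> \<le> (2 / (real l + 1)) * (2 / (real m + 1))"
          using G(1) by (intro mult_mono tail sum_nonneg) (auto simp: G_def)
        also have "\<dots> = 4 / s\<^sup>2" by (simp add: s_def power_mult_distrib)
        finally show "(\<Sum>i\<in>G. (b i)\<^sup>2) \<le> 4 / s\<^sup>2" .
      qed (auto intro: sum_nonneg)
      also have "\<dots> = C * (\<Sum>i\<in>G. (a i)\<^sup>2)" by (simp add: C_def s_def power_mult_distrib)
      also have "(\<Sum>i\<in>G. (a i)\<^sup>2) = (\<Sum>i\<in>G. w i)"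
      proof (rule sum.cong[OF refl])
        fix i assume "i \<in> G"
        have sq: "(x powr c)\<^sup>2 = x powr (2 * c)" for x c :: real
          unfolding power2_eq_square powr_add[symmetric] by simp
        show "(a i)\<^sup>2 = w i"
          by (cases i) (simp add: a_def w_def power_mult_distrib sq)
      qed
      also have "\<dots> = (\<Sum>i\<in>F. if l < fst i \<and> m < snd i then w i else 0)"
        unfolding G_def by (rule sum.inter_filter[OF F(1)])
      finally show ?thesis .
    qed
    have "(l2norm (lebesgue_on Qsq) (\<lambda>x. \<Sum>i\<in>F. u i * deriv_tensor r1 r2 i x))\<^sup>2
        \<le> (\<Sum>(l, m)\<in>{..<K} \<times> {..<K}. C * (\<Sum>i\<in>F. if l < fst i \<and> m < snd i then w i else 0))"
      unfolding l2norm_deriv_tensor_sum_power2[OF assms K] by (intro sum_mono) (auto intro!: entry)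
    also have "\<dots> = C * (\<Sum>i\<in>F. \<Sum>(l, m)\<in>{..<K} \<times> {..<K}. if l < fst i \<and> m < snd i then w i else 0)"
      by (subst sum.swap) (simp add: sum_distrib_left case_prod_beta)
    also have "\<dots> \<le> C * (\<Sum>(k, j)\<in>F. (u (k, j))\<^sup>2 * (real k powr (4 * real r1) * real j powr (4 * real r2)))"
    proof (intro mult_left_mono sum_mono)
      fix i assume i: "i \<in> F"
      obtain k j where kj: "i = (k, j)" by (cases i)
      with i F have k: "1 \<le> k" "1 \<le> j" by auto
      \<comment> \<open>At most \<open>k * j\<close> pairs \<open>(l, m)\<close> see the weight of
        \<open>(k, j)\<close>; this raises its exponents from \<open>4 r - 1\<close> to
        \<open>4 r\<close>.\<close>
      have "(\<Sum>(l, m)\<in>{..<K} \<times> {..<K}. if l < fst i \<and> m < snd i then w i else 0)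
          = (\<Sum>p\<in>{p\<in>{..<K} \<times> {..<K}. fst p < k \<and> snd p < j}. w i)"
        by (subst sum.inter_filter) (auto simp: kj case_prod_beta)
      also have "\<dots> \<le> (\<Sum>p\<in>{..<k} \<times> {..<j}. w i)"
        using w by (intro sum_mono2) auto
      also have "\<dots> = w i * (real k powr 1 * real j powr 1)" by simp
      also have "\<dots> = (u (k, j))\<^sup>2 * ((real k powr (4 * real r1 - 1) * real k powr 1) * (real j powr (4 * real r2 - 1) * real j powr 1))"
        unfolding w_def kj by (simp only: prod.case ac_simps)
      also have "\<dots> = (u (k, j))\<^sup>2 * (real k powr (4 * real r1) * real j powr (4 * real r2))"
        unfolding powr_add[symmetric] by simp
      finally show "(\<Sum>(l, m)\<in>{..<K} \<times> {..<K}. if l < fst i \<and> m < snd i then w i else 0)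
          \<le> (case i of (k, j) \<Rightarrow> (u (k, j))\<^sup>2 * (real k powr (4 * real r1) * real j powr (4 * real r2)))"
        by (simp add: kj)
    qed (use \<open>0 < C\<close> in simp)
    finally show "(l2norm (lebesgue_on Qsq) (\<lambda>x. \<Sum>i\<in>F. u i * deriv_tensor r1 r2 i x))\<^sup>2
        \<le> C * (\<Sum>(k, j)\<in>F. (u (k, j))\<^sup>2 * (real k powr (4 * real r1) * real j powr (4 * real r2)))" .
  qed
qed

text \<open>The left-hand side is the sum of the norms, not the norm of the sum: existence of the
  mixed derivative needs summability of the norms.\<close>

lemma l2norm_deriv_tensor_sum_le_weighted_l1:
  assumes "1 \<le> r1" "1 \<le> r2"
  shows "\<exists>C>0. \<forall>F u. F \<subseteq> {1..} \<times> {1..} \<longrightarrow>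
    (\<Sum>i\<in>F. l2norm (lebesgue_on Qsq) (\<lambda>x. u i * deriv_tensor r1 r2 i x))
      \<le> C * (\<Sum>(k, j)\<in>F. \<bar>u (k, j)\<bar> * (real k powr (2 * real r1 - 1/2) * real j powr (2 * real r2 - 1/2)))"
proof -
  obtain C where C: "C > 0" "\<forall>k\<ge>1. \<forall>j\<ge>1. l2norm (lebesgue_on Qsq) (deriv_tensor r1 r2 (k, j))
    \<le> C * (real k powr (2 * real r1 - 1/2) * real j powr (2 * real r2 - 1/2))"
    using l2norm_deriv_tensor_le[OF assms] by blast
  show ?thesis
  proof (intro exI[of _ C] conjI allI impI)
    fix F :: "(nat \<times> nat) set" and u :: "nat \<times> nat \<Rightarrow> real"
    assume F: "F \<subseteq> {1..} \<times> {1..}"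
    have "(\<Sum>i\<in>F. l2norm (lebesgue_on Qsq) (\<lambda>x. u i * deriv_tensor r1 r2 i x))
        \<le> (\<Sum>(k, j)\<in>F. C * (\<bar>u (k, j)\<bar> * (real k powr (2 * real r1 - 1/2) * real j powr (2 * real r2 - 1/2))))"
    proof (rule sum_mono)
      fix i assume "i \<in> F"
      then obtain k j where i: "i = (k, j)" "1 \<le> k" "1 \<le> j" using F by (cases i) auto
      have "\<bar>u i\<bar> * l2norm (lebesgue_on Qsq) (deriv_tensor r1 r2 i)
          \<le> \<bar>u i\<bar> * (C * (real k powr (2 * real r1 - 1/2) * real j powr (2 * real r2 - 1/2)))"
        using C i by (intro mult_left_mono) auto
      then show "l2norm (lebesgue_on Qsq) (\<lambda>x. u i * deriv_tensor r1 r2 i x)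
          \<le> (case i of (k, j) \<Rightarrow> C * (\<bar>u (k, j)\<bar> * (real k powr (2 * real r1 - 1/2) * real j powr (2 * real r2 - 1/2))))"
        by (simp add: l2norm_cmult i mult_ac)
    qed
    also have "\<dots> = C * (\<Sum>(k, j)\<in>F. \<bar>u (k, j)\<bar> * (real k powr (2 * real r1 - 1/2) * real j powr (2 * real r2 - 1/2)))"
      by (simp add: sum_distrib_left case_prod_beta)
    finally show "(\<Sum>i\<in>F. l2norm (lebesgue_on Qsq) (\<lambda>x. u i * deriv_tensor r1 r2 i x))
      \<le> C * (\<Sum>(k, j)\<in>F. \<bar>u (k, j)\<bar> * (real k powr (2 * real r1 - 1/2) * real j powr (2 * real r2 - 1/2)))" .
  qed (use C in simp)
qed

lemma l2norm_deriv_tensor_sum_le: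
  "l2norm (lebesgue_on Qsq) (\<lambda>x. \<Sum>i\<in>F. u i * deriv_tensor r1 r2 i x)
    \<le> (\<Sum>i\<in>F. l2norm (lebesgue_on Qsq) (\<lambda>x. u i * deriv_tensor r1 r2 i x))"
  by (intro l2norm_sum_le sq_integrable_cmult sq_integrable_deriv_tensor)

section \<open>The hypotheses on \<open>f\<close> and on the data as finite l_p bounds\<close>

lemma lp_bounded_smooth_class:
  assumes "f \<in> smooth_class s \<mu>" "smooth_norm s \<mu> f \<le> 1" "1 \<le> s" "finite F"
  shows "lp_bounded (1 / s) F (\<lambda>(k, j). (real (max 1 k) * real (max 1 j)) powr \<mu> * \<bar>coef f k j\<bar>) 1"
proof -
  let ?S = "\<Sum>\<^sub>\<infinity>i\<in>UNIV. smooth_term s \<mu> f i"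
  have nonneg: "0 \<le> smooth_term s \<mu> f i" for i by (auto simp: smooth_term_def split: prod.split)
  have "?S \<le> 1"
  proof (rule ccontr)
    assume "\<not> ?S \<le> 1"
    then have "1 < ?S powr (1 / s)" using assms(3) by (intro gr_one_powr) auto
    then show False using assms(2) by (simp add: smooth_norm_def)
  qed
  moreover have "(\<Sum>i\<in>F. smooth_term s \<mu> f i) \<le> ?S"
    using assms(1) by (intro finite_sum_le_infsum assms(4)) (auto simp: smooth_class_def nonneg)
  moreover have "(\<Sum>i\<in>F. (case i of (k, j) \<Rightarrow> (real (max 1 k) * real (max 1 j)) powr \<mu> * \<bar>coef f k j\<bar>) powr s)
      = (\<Sum>i\<in>F. smooth_term s \<mu> f i)"
    by (intro sum.cong) (auto simp: smooth_term_def powr_mult powr_powr mult.commute)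
  ultimately show ?thesis using assms(3) by (simp add: lp_bounded_def)
qed

lemma lp_bounded_of_lp_norm:
  assumes "in_lp p \<xi>" "lp_norm p \<xi> \<le> \<delta>" "1 \<le> p" "finite F" "0 < \<delta>"
  shows "lp_bounded (real_of_ereal (1 / p)) F (\<lambda>i. \<bar>\<xi> i\<bar>) \<delta>"
proof (cases "p = \<infinity>")
  case True
  then have "bounded (range \<xi>)" using assms(1) by (simp add: in_lp_def)
  \<comment> \<open>The real supremum in \<open>lp_norm\<close> bounds its members only for a
    bounded family, which \<open>in_lp\<close> provides.\<close>
  then have "bdd_above (range (\<lambda>i. \<bar>\<xi> i\<bar>))" by (auto simp: bounded_iff bdd_above_def)
  then have "\<bar>\<xi> i\<bar> \<le> \<delta>" for i
    using assms(2) True cSUP_upper[of i UNIV "\<lambda>i. \<bar>\<xi> i\<bar>"] by (simp add: lp_norm_def)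
  then show ?thesis using True by (simp add: lp_bounded_def)
next
  case False
  then obtain p' where p: "p = ereal p'" "1 \<le> p'"
    using assms(3) by (cases p) (auto simp: one_ereal_def)
  let ?S = "\<Sum>\<^sub>\<infinity>i\<in>UNIV. \<bar>\<xi> i\<bar> powr p'"
  have "?S = (?S powr (1 / p')) powr p'"
    using p by (simp add: powr_powr infsum_nonneg)
  also have "\<dots> \<le> \<delta> powr p'"
    using assms(2) p by (intro powr_mono2) (auto simp: lp_norm_def)
  finally have "?S \<le> \<delta> powr p'" .
  moreover have "(\<Sum>i\<in>F. \<bar>\<xi> i\<bar> powr p') \<le> ?S"
    using assms(1) p by (intro finite_sum_le_infsum assms(4)) (auto simp: in_lp_def)
  ultimately show ?thesis using p by (simp add: lp_bounded_def one_ereal_def)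
qed

section \<open>Error bounds and rates\<close>

text \<open>With \<open>L = ln (1/\<delta>)\<close> and \<open>E = L + e * ln L\<close> one has
  \<open>\<delta> / L powr e = exp (-E)\<close>, so \<open>n\<close> is comparable to
  \<open>exp (E / M)\<close>. Then \<open>n powr (-\<alpha>)\<close> is of order
  \<open>exp (-\<alpha> E / M)\<close>, and so is \<open>\<delta> * n powr \<beta>\<close> up to
  \<open>L powr e\<close>, because \<open>M = \<alpha> + \<beta>\<close>. What remains is
  bookkeeping of powers of \<open>L\<close>: \<open>y\<close> and \<open>e + z\<close> must not
  exceed \<open>x\<close>.\<close>

lemma rate_asymptotics:
  fixes \<alpha> \<beta> e x y z c1 c2 C1 C2 M :: real
  assumes pos: "0 < \<alpha>" "0 < \<beta>" "0 < c1" "0 < c2" "0 < C1" "0 < C2"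
    and exps: "0 \<le> y" "y \<le> x" "0 \<le> z" "e + z \<le> x" and M: "M = \<alpha> + \<beta>"
  shows "\<exists>c>0. \<exists>\<delta>0\<in>{0<..<1}. \<forall>\<delta>\<in>{0<..<\<delta>0}. \<forall>n.
    c1 * (\<delta> / ln (1/\<delta>) powr e) powr (-(1/M)) \<le> n \<and> n \<le> c2 * (\<delta> / ln (1/\<delta>) powr e) powr (-(1/M)) \<longrightarrow>
    exp 1 \<le> n \<and> C1 * (n powr (-\<alpha>) * ln n powr y) + C2 * \<delta> * (n powr \<beta> * ln n powr z)
      \<le> c * ((\<delta> / ln (1/\<delta>) powr e) powr (\<alpha> / M) * ln (1/\<delta>) powr x)"
proof -
  have M0: "0 < M" using pos M by simp
  \<comment> \<open>From \<open>ln n \<le> ln c2 + E / M\<close> with \<open>ln c2 \<le> L\<close>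
    and \<open>E \<le> (1 + \<bar>e\<bar>) * L\<close>.\<close>
  define \<kappa> where "\<kappa> = 1 + (1 + \<bar>e\<bar>) / M"
  have \<kappa>: "0 < \<kappa>" using M0 by (simp add: \<kappa>_def add_pos_nonneg)
  define c where "c = C1 * (c1 powr (-\<alpha>) * \<kappa> powr y) + C2 * (c2 powr \<beta> * \<kappa> powr z)"
  have c: "0 < c" using pos \<kappa> by (simp add: c_def add_pos_pos)
  have lim: "filterlim (\<lambda>\<delta>::real. ln (1 / \<delta>)) at_top (at_right 0)" by real_asymp
  have "filterlim (\<lambda>L::real. L + e * ln L) at_top at_top" by real_asymp
  then have "filterlim (\<lambda>\<delta>. ln (1 / \<delta>) + e * ln (ln (1 / \<delta>))) at_top (at_right 0)"
    by (rule filterlim_compose) (rule lim)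
  \<comment> \<open>The first condition forces \<open>n \<ge> exp 1\<close>; the second gives
    \<open>L \<ge> 1\<close> and lets \<open>L\<close> absorb \<open>ln c2\<close>.\<close>
  then have "eventually (\<lambda>\<delta>. M * (1 - ln c1) \<le> ln (1 / \<delta>) + e * ln (ln (1 / \<delta>))
      \<and> max 1 (ln c2) \<le> ln (1 / \<delta>)) (at_right 0)"
    using lim unfolding filterlim_at_top by (intro eventually_conj) blast+
  then obtain b where b: "0 < b" "\<And>\<delta>. 0 < \<delta> \<Longrightarrow> \<delta> < b \<Longrightarrow>
      M * (1 - ln c1) \<le> ln (1 / \<delta>) + e * ln (ln (1 / \<delta>)) \<and> max 1 (ln c2) \<le> ln (1 / \<delta>)"
    unfolding eventually_at_right_field by auto
  show ?thesis
  proof (intro exI[of _ c] conjI bexI[of _ "min b (1/2)"] ballI allI impI c)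
    fix \<delta> n
    assume "\<delta> \<in> {0<..<min b (1/2)}"
    then have \<delta>: "0 < \<delta>" "\<delta> < b" by auto
    define L where "L = ln (1 / \<delta>)"
    define E where "E = L + e * ln L"
    have L: "1 \<le> L" "ln c2 \<le> L" and E: "M * (1 - ln c1) \<le> E"
      using b(2)[OF \<delta>] by (auto simp: L_def E_def)
    have exL: "\<delta> = exp (-L)" using \<delta> by (simp add: L_def ln_div)
    have "exp (-E) = exp (-L) / exp (e * ln L)"
      unfolding exp_diff[symmetric] by (simp add: E_def)
    then have D: "\<delta> / L powr e = exp (-E)"
      using L by (simp add: exL powr_def)
    have Dp: "(\<delta> / L powr e) powr a = exp (- (a * E))" for a unfolding D by (simp add: powr_def)
    assume "c1 * (\<delta> / ln (1/\<delta>) powr e) powr (-(1/M)) \<le> n \<and> n \<le> c2 * (\<delta> / ln (1/\<delta>) powr e) powr (-(1/M))"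
    then have n: "c1 * exp (E / M) \<le> n" "n \<le> c2 * exp (E / M)"
      unfolding L_def[symmetric] Dp by simp_all
    have "1 - ln c1 \<le> E / M" using E M0 by (simp add: field_simps)
    then have "exp 1 \<le> exp (ln c1 + E / M)" by simp
    also have "\<dots> = c1 * exp (E / M)" using pos by (simp add: exp_add)
    finally show n1: "exp 1 \<le> n" using n by linarith
    have n0: "0 < n" using n1 exp_gt_zero[of "1::real"] by linarith
    have ln1: "1 \<le> ln n" using n1 n0 by (simp add: ln_ge_iff)
    have lnL: "0 \<le> ln L" "ln L \<le> L" using L ln_le_minus_one[of L] by auto
    have "ln n \<le> ln (c2 * exp (E / M))" using n n0 by (intro ln_mono) auto
    also have "\<dots> = ln c2 + E / M" using pos by (simp add: ln_mult)
    also have "\<dots> \<le> L + (L + \<bar>e\<bar> * L) / M"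
    proof (intro add_mono divide_right_mono L)
      have "e * ln L \<le> \<bar>e\<bar> * ln L" using lnL by (intro mult_right_mono) auto
      also have "\<dots> \<le> \<bar>e\<bar> * L" using lnL by (intro mult_left_mono) auto
      finally show "E \<le> L + \<bar>e\<bar> * L" by (simp add: E_def)
    qed (use M0 in simp)
    also have "\<dots> = \<kappa> * L" using M0 by (simp add: \<kappa>_def field_simps)
    finally have lnn: "ln n \<le> \<kappa> * L" .
    have lnp: "ln n powr a \<le> \<kappa> powr a * L powr a" if "0 \<le> a" for a
    proof -
      have "ln n powr a \<le> (\<kappa> * L) powr a" using that ln1 lnn by (intro powr_mono2) auto
      then show ?thesis by (simp add: powr_mult)
    qed
    have 1: "n powr (-\<alpha>) * ln n powr y \<le> (c1 powr (-\<alpha>) * exp (- (\<alpha> / M * E))) * (\<kappa> powr y * L powr x)"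
    proof (rule mult_mono)
      have "n powr (-\<alpha>) \<le> (c1 * exp (E / M)) powr (-\<alpha>)"
        using n pos by (intro powr_mono2') auto
      also have "\<dots> = c1 powr (-\<alpha>) * exp (- (\<alpha> / M * E))" by (simp add: powr_mult powr_def[of "exp _"])
      finally show "n powr (-\<alpha>) \<le> c1 powr (-\<alpha>) * exp (- (\<alpha> / M * E))" .
      have "\<kappa> powr y * L powr y \<le> \<kappa> powr y * L powr x"
        using exps L by (intro mult_left_mono powr_mono) auto
      then show "ln n powr y \<le> \<kappa> powr y * L powr x" using lnp[OF exps(1)] by linarith
    qed auto
    have \<delta>D: "\<delta> = exp (-E) * L powr e" using D L by (simp add: field_simps)
    have "\<delta> * (n powr \<beta> * ln n powr z) \<le> \<delta> * ((c2 powr \<beta> * exp (\<beta> * E / M)) * (\<kappa> powr z * L powr z))"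
    proof (intro mult_left_mono mult_mono)
      have "n powr \<beta> \<le> (c2 * exp (E / M)) powr \<beta>"
        using n n0 pos by (intro powr_mono2) auto
      also have "\<dots> = c2 powr \<beta> * exp (\<beta> * E / M)" by (simp add: powr_mult powr_def[of "exp _"])
      finally show "n powr \<beta> \<le> c2 powr \<beta> * exp (\<beta> * E / M)" .
    qed (use \<delta> lnp[OF exps(3)] in auto)
    also have "\<dots> = c2 powr \<beta> * \<kappa> powr z * (exp (-E) * exp (\<beta> * E / M)) * (L powr e * L powr z)"
      by (subst \<delta>D) (simp only: ac_simps)
    also have "exp (-E) * exp (\<beta> * E / M) = exp (- (\<alpha> / M * E))"
      unfolding exp_add[symmetric] using M0 M by (simp add: field_simps)
    also have "L powr e * L powr z = L powr (e + z)" by (simp add: powr_add)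
    also have "c2 powr \<beta> * \<kappa> powr z * exp (- (\<alpha> / M * E)) * L powr (e + z)
        \<le> c2 powr \<beta> * \<kappa> powr z * exp (- (\<alpha> / M * E)) * L powr x"
      using exps L by (intro mult_left_mono powr_mono) auto
    finally have 2: "\<delta> * (n powr \<beta> * ln n powr z) \<le> c2 powr \<beta> * \<kappa> powr z * exp (- (\<alpha> / M * E)) * L powr x" .
    have "C1 * (n powr (-\<alpha>) * ln n powr y) + C2 * (\<delta> * (n powr \<beta> * ln n powr z))
        \<le> C1 * ((c1 powr (-\<alpha>) * exp (- (\<alpha> / M * E))) * (\<kappa> powr y * L powr x))
          + C2 * (c2 powr \<beta> * \<kappa> powr z * exp (- (\<alpha> / M * E)) * L powr x)"
      using 1 2 pos by (intro add_mono mult_left_mono) auto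
    also have "\<dots> = c * (exp (- (\<alpha> / M * E)) * L powr x)" by (simp add: c_def algebra_simps)
    finally show "C1 * (n powr (-\<alpha>) * ln n powr y) + C2 * \<delta> * (n powr \<beta> * ln n powr z)
      \<le> c * ((\<delta> / ln (1/\<delta>) powr e) powr (\<alpha> / M) * ln (1/\<delta>) powr x)"
      unfolding L_def[symmetric] Dp by (simp only: mult.assoc)
  qed (use b in auto)
qed

text \<open>Hoelder with exponents \<open>s\<close> and its conjugate: the factor
  \<open>(k j) powr \<mu>\<close> is given to the coefficients, where the class bounds it, and taken
  out of the derivative weights.\<close>

lemma coef_weighted_l1_le:
  assumes f: "f \<in> smooth_class s \<mu>" "smooth_norm s \<mu> f \<le> 1" and s: "1 \<le> s"
    and F: "finite F" "F \<subseteq> {1..} \<times> {1..}" and K: "0 < K"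
    and bd: "lp_bounded (1 - 1/s) F
      (\<lambda>(k, j). real k powr (-(\<mu> - 2 * real r1 + 1/2)) * real j powr (-(\<mu> - 2 * real r2 + 1/2))) K"
  shows "(\<Sum>(k, j)\<in>F. \<bar>coef f k j\<bar> * (real k powr (2 * real r1 - 1/2) * real j powr (2 * real r2 - 1/2))) \<le> K"
proof -
  let ?a = "\<lambda>(k, j). (real (max 1 k) * real (max 1 j)) powr \<mu> * \<bar>coef f k j\<bar>"
  let ?b = "\<lambda>(k, j). real k powr (-(\<mu> - 2 * real r1 + 1/2)) * real j powr (-(\<mu> - 2 * real r2 + 1/2))"
  have "(\<Sum>(k, j)\<in>F. \<bar>coef f k j\<bar> * (real k powr (2 * real r1 - 1/2) * real j powr (2 * real r2 - 1/2)))
      = (\<Sum>i\<in>F. ?a i * ?b i)"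
  proof (rule sum.cong[OF refl])
    fix i assume "i \<in> F"
    then obtain k j where i: "i = (k, j)" "1 \<le> k" "1 \<le> j" using F by (cases i) auto
    have "?a i * ?b i = \<bar>coef f k j\<bar> * ((real k powr \<mu> * real k powr (-(\<mu> - 2 * real r1 + 1/2)))
        * (real j powr \<mu> * real j powr (-(\<mu> - 2 * real r2 + 1/2))))"
      using i by (simp only: prod.case max_absorb2 powr_mult ac_simps)
    also have "\<dots> = \<bar>coef f k j\<bar> * (real k powr (2 * real r1 - 1/2) * real j powr (2 * real r2 - 1/2))"
      unfolding powr_add[symmetric] by simp
    finally show "(case i of (k, j) \<Rightarrow> \<bar>coef f k j\<bar> * (real k powr (2 * real r1 - 1/2) * real j powr (2 * real r2 - 1/2))) = ?a i * ?b i"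
      by (simp only: i prod.case)
  qed
  also have "\<dots> \<le> 1 * K"
    by (rule Hoelder_sum[OF _ _ _ lp_bounded_smooth_class[OF f s F(1)] bd]) (use s K in \<open>auto split: prod.split\<close>)
  finally show ?thesis by simp
qed

text \<open>The same splitting for squares: the squared coefficients are bounded in l_(s/2), whose
  conjugate reciprocal exponent \<open>1 - 2/s\<close> is nonnegative exactly for
  \<open>s \<ge> 2\<close>.\<close>

lemma coef_weighted_l2_le:
  assumes f: "f \<in> smooth_class s \<mu>" "smooth_norm s \<mu> f \<le> 1" and s: "2 \<le> s"
    and F: "finite F" "F \<subseteq> {1..} \<times> {1..}" and K: "0 < K"
    and bd: "lp_bounded (1 - 2/s) F
      (\<lambda>(k, j). real k powr (-(2 * \<mu> - 4 * real r1)) * real j powr (-(2 * \<mu> - 4 * real r2))) K"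
  shows "(\<Sum>(k, j)\<in>F. (coef f k j)\<^sup>2 * (real k powr (4 * real r1) * real j powr (4 * real r2))) \<le> K"
proof -
  let ?a = "\<lambda>(k, j). (real (max 1 k) * real (max 1 j)) powr \<mu> * \<bar>coef f k j\<bar>"
  let ?b = "\<lambda>(k, j). real k powr (-(2 * \<mu> - 4 * real r1)) * real j powr (-(2 * \<mu> - 4 * real r2))"
  have sq: "(x powr c)\<^sup>2 = x powr (2 * c)" for x c :: real
    unfolding power2_eq_square powr_add[symmetric] by simp
  have "(\<Sum>(k, j)\<in>F. (coef f k j)\<^sup>2 * (real k powr (4 * real r1) * real j powr (4 * real r2)))
      = (\<Sum>i\<in>F. (?a i)\<^sup>2 * ?b i)"
  proof (rule sum.cong[OF refl])
    fix i assume "i \<in> F"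
    then obtain k j where i: "i = (k, j)" "1 \<le> k" "1 \<le> j" using F by (cases i) auto
    have "(?a i)\<^sup>2 * ?b i = (coef f k j)\<^sup>2 * ((real k powr (2 * \<mu>) * real k powr (-(2 * \<mu> - 4 * real r1)))
        * (real j powr (2 * \<mu>) * real j powr (-(2 * \<mu> - 4 * real r2))))"
      using i by (simp only: prod.case max_absorb2 powr_mult power_mult_distrib sq power2_abs ac_simps)
    also have "\<dots> = (coef f k j)\<^sup>2 * (real k powr (4 * real r1) * real j powr (4 * real r2))"
      unfolding powr_add[symmetric] by simp
    finally show "(case i of (k, j) \<Rightarrow> (coef f k j)\<^sup>2 * (real k powr (4 * real r1) * real j powr (4 * real r2))) = (?a i)\<^sup>2 * ?b i"
      by (simp only: i prod.case)
  qed
  also have "\<dots> \<le> 1\<^sup>2 * K"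
  proof (rule Hoelder_sum[OF _ _ _ _ bd])
    have "lp_bounded (1 / s) F ?a 1" using s by (intro lp_bounded_smooth_class f F) auto
    then show "lp_bounded (2 * (1 / s)) F (\<lambda>i. (?a i)\<^sup>2) (1\<^sup>2)"
      by (rule lp_bounded_power2) (auto split: prod.split)
  qed (use s K in \<open>auto split: prod.split\<close>)
  finally show ?thesis by simp
qed

lemma ex_mixed_deriv:
  assumes f: "f \<in> smooth_class s \<mu>" "smooth_norm s \<mu> f \<le> 1"
    and s: "1 \<le> s" and r: "1 \<le> r2" "r2 \<le> r1" and \<mu>: "\<mu> > 2 * real r1 + 1/2 - 1/s"
  shows "\<exists>g. has_mixed_deriv r1 r2 f g"
proof -
  define u where "u = (\<lambda>(k, j). coef f k j)"
  let ?I = "{r1..} \<times> {r2..}"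
  have r1: "1 \<le> r1" using r by simp
  have 1: "0 \<le> 1 - 1/s" "1 - 1/s < \<mu> - 2 * real r1 + 1/2" using s \<mu> by auto
  \<comment> \<open>The estimate outside a cross is used with \<gamma> = 1/2 because it is then
    strictly subcritical also for r1 = r2, where \<gamma> = 1 would be critical.\<close>
  have 2: "1/2 * ((\<mu> - 2 * real r1 + 1/2) - (1 - 1/s)) < (\<mu> - 2 * real r2 + 1/2) - (1 - 1/s)"
    using r \<mu> by (simp add: field_simps)
  obtain C where C: "0 < C" "\<forall>n>0. \<forall>F. finite F \<longrightarrow> (\<forall>(k, j)\<in>F. 1 \<le> k \<and> 1 \<le> j \<and> n \<le> real k * real j powr (1/2)) \<longrightarrow>
    lp_bounded (1 - 1/s) F (\<lambda>(k, j). real k powr (-(\<mu> - 2 * real r1 + 1/2)) * real j powr (-(\<mu> - 2 * real r2 + 1/2)))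
      (C * n powr ((1 - 1/s) - (\<mu> - 2 * real r1 + 1/2)))"
    using lp_bounded_outside_hyp_cross[OF 1 2] by (elim exE conjE) (rule that)
  obtain D where D: "D > 0" "\<forall>F u. F \<subseteq> {1..} \<times> {1..} \<longrightarrow>
    (\<Sum>i\<in>F. l2norm (lebesgue_on Qsq) (\<lambda>x. u i * deriv_tensor r1 r2 i x))
      \<le> D * (\<Sum>(k, j)\<in>F. \<bar>u (k, j)\<bar> * (real k powr (2 * real r1 - 1/2) * real j powr (2 * real r2 - 1/2)))"
    using l2norm_deriv_tensor_sum_le_weighted_l1[OF r1 r(1)] by (elim exE conjE) (rule that)
  have "(\<lambda>i. l2norm (lebesgue_on Qsq) (\<lambda>x. u i * deriv_tensor r1 r2 i x)) summable_on ?I"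
  proof (rule nonneg_bdd_above_summable_on)
    show "bdd_above (sum (\<lambda>i. l2norm (lebesgue_on Qsq) (\<lambda>x. u i * deriv_tensor r1 r2 i x)) ` {F. F \<subseteq> ?I \<and> finite F})"
    proof (rule bdd_aboveI2)
      fix F assume "F \<in> {F. F \<subseteq> ?I \<and> finite F}"
      then have F: "finite F" "F \<subseteq> {1..} \<times> {1..}" using r by force+
      \<comment> \<open>With \<open>n = 1/2\<close> every index pair lies outside the cross, so the
        outside estimate bounds all finite partial sums uniformly.\<close>
      have "1/2 \<le> real k * real j powr (1/2)" if "(k, j) \<in> F" for k j
      proof -
        have "1 \<le> k" "1 \<le> j" using that F by auto
        then have "1 * 1 \<le> real k * real j powr (1/2)" by (intro mult_mono ge_one_powr_ge_zero) auto
        then show ?thesis by simp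
      qed
      then have out: "\<forall>(k, j)\<in>F. 1 \<le> k \<and> 1 \<le> j \<and> 1/2 \<le> real k * real j powr (1/2)" using F(2) by auto
      have half: "0 < (1/2 :: real)" by simp
      have "(\<Sum>(k, j)\<in>F. \<bar>coef f k j\<bar> * (real k powr (2 * real r1 - 1/2) * real j powr (2 * real r2 - 1/2)))
          \<le> C * (1/2) powr ((1 - 1/s) - (\<mu> - 2 * real r1 + 1/2))"
        by (rule coef_weighted_l1_le[OF f s F _
              C(2)[THEN spec, THEN mp, OF half, THEN spec, THEN mp, OF F(1), THEN mp, OF out]])
          (use C(1) in simp)
      then have "D * (\<Sum>(k, j)\<in>F. \<bar>u (k, j)\<bar> * (real k powr (2 * real r1 - 1/2) * real j powr (2 * real r2 - 1/2)))
          \<le> D * (C * (1/2) powr ((1 - 1/s) - (\<mu> - 2 * real r1 + 1/2)))"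
        unfolding u_def prod.case using D(1) by (intro mult_left_mono) simp_all
      with D(2)[THEN spec, THEN spec, THEN mp, OF F(2), of u]
      show "(\<Sum>i\<in>F. l2norm (lebesgue_on Qsq) (\<lambda>x. u i * deriv_tensor r1 r2 i x))
          \<le> D * (C * (1/2) powr ((1 - 1/s) - (\<mu> - 2 * real r1 + 1/2)))"
        by (rule order.trans)
    qed
  qed (rule l2norm_nonneg)
  from l2_abs_convergent_series[OF sq_integrable_cmult[OF sq_integrable_deriv_tensor] this]
  obtain g where g: "sq_integrable (lebesgue_on Qsq) g"
    "((\<lambda>F. l2norm (lebesgue_on Qsq) (\<lambda>x. g x - (\<Sum>i\<in>F. u i * deriv_tensor r1 r2 i x))) \<longlongrightarrow> 0) (finite_subsets_at_top ?I)"
    by (elim exE conjE) (rule that)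
  have "(\<lambda>x. g x - (\<Sum>i\<in>F. u i * deriv_tensor r1 r2 i x))
      = (\<lambda>(t, \<tau>). g (t, \<tau>) - (\<Sum>(k, j)\<in>F. coef f k j * legendre_deriv r1 k t * legendre_deriv r2 j \<tau>))" for F
    by (auto simp: fun_eq_iff u_def deriv_tensor_def case_prod_beta mult.assoc)
  then show ?thesis using g unfolding has_mixed_deriv_def in_L2_iff L2_norm_eq by auto
qed

section \<open>Truncation error and propagated data error\<close>

lemma finite_hyp_cross:
  assumes "1 \<le> \<gamma>" "1 \<le> r1" "1 \<le> r2"
  shows "finite (hyp_cross r1 r2 n \<gamma>)"
proof (rule finite_subset)
  show "hyp_cross r1 r2 n \<gamma> \<subseteq> {..nat \<lfloor>n\<rfloor>} \<times> {..nat \<lfloor>n\<rfloor>}"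
  proof
    fix i assume "i \<in> hyp_cross r1 r2 n \<gamma>"
    then obtain k j where i: "i = (k, j)" "1 \<le> k" "1 \<le> j" "real k * real j powr \<gamma> \<le> n"
      using assms by (auto simp: hyp_cross_def)
    have j: "real j powr 1 \<le> real j powr \<gamma>" using i assms by (intro powr_mono) auto
    then have j': "real j \<le> real j powr \<gamma>" "1 \<le> real j powr \<gamma>" using i by auto
    have "real k * 1 \<le> real k * real j powr \<gamma>" using j' by (intro mult_left_mono) auto
    moreover have "1 * real j powr \<gamma> \<le> real k * real j powr \<gamma>" using i by (intro mult_right_mono) auto
    ultimately have "real k \<le> n" "real j \<le> n" using i j' by linarith+
    then show "i \<in> {..nat \<lfloor>n\<rfloor>} \<times> {..nat \<lfloor>n\<rfloor>}" by (auto simp: i le_nat_floor)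
  qed
qed simp

lemma ln_ge_1: "exp 1 \<le> n \<Longrightarrow> 0 < n \<and> 1 \<le> ln n" for n :: real
  using exp_gt_zero[of "1::real"] ln_ge_iff[of n 1] by linarith

lemma rate_pos: "exp 1 \<le> n \<Longrightarrow> 0 < n powr a * ln n powr b" for n a b :: real
  using ln_ge_1[of n] by (intro mult_pos_pos) auto

text \<open>Finite \<open>F\<close> stands for the infinite remainder; the passage to the limit is
  made once, in \<open>mixed_deriv_remainder_le\<close>. The power of \<open>n\<close> is fixed and
  only the logarithm exponent \<open>y\<close> depends on the case.\<close>

definition truncation_bound :: "real \<Rightarrow> real \<Rightarrow> nat \<Rightarrow> nat \<Rightarrow> real \<Rightarrow> real \<Rightarrow> bool" where
  "truncation_bound s \<mu> r1 r2 \<gamma> y \<longleftrightarrow> (\<exists>C>0. \<forall>n\<ge>exp 1. \<forall>f F.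
     f \<in> smooth_class s \<mu> \<longrightarrow> smooth_norm s \<mu> f \<le> 1 \<longrightarrow>
     finite F \<longrightarrow> F \<subseteq> {r1..} \<times> {r2..} - hyp_cross r1 r2 n \<gamma> \<longrightarrow>
     l2norm (lebesgue_on Qsq) (\<lambda>x. \<Sum>i\<in>F. (case i of (k, j) \<Rightarrow> coef f k j) * deriv_tensor r1 r2 i x)
       \<le> C * (n powr (-(\<mu> - 2 * real r1 + 1/s - 1/2)) * ln n powr y))"

text \<open>Here \<open>q = 1/p\<close>, and again only the exponent \<open>z\<close> of the
  logarithm varies.\<close>

definition propagation_bound :: "real \<Rightarrow> nat \<Rightarrow> nat \<Rightarrow> real \<Rightarrow> real \<Rightarrow> bool" where
  "propagation_bound q r1 r2 \<gamma> z \<longleftrightarrow> (\<exists>C>0. \<forall>n\<ge>exp 1. \<forall>\<delta>>0. \<forall>\<xi>.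
     lp_bounded q (hyp_cross r1 r2 n \<gamma>) (\<lambda>i. \<bar>\<xi> i\<bar>) \<delta> \<longrightarrow>
     l2norm (lebesgue_on Qsq) (\<lambda>x. \<Sum>i\<in>hyp_cross r1 r2 n \<gamma>. \<xi> i * deriv_tensor r1 r2 i x)
       \<le> C * \<delta> * (n powr (2 * real r1 + 1/2 - q) * ln n powr z))"

lemma outside_hyp_crossD:
  assumes "F \<subseteq> {r1..} \<times> {r2..} - hyp_cross r1 r2 n \<gamma>" "1 \<le> r1" "1 \<le> r2"
  shows "\<forall>(k, j)\<in>F. 1 \<le> k \<and> 1 \<le> j \<and> n \<le> real k * real j powr \<gamma>" "F \<subseteq> {1..} \<times> {1..}"
  using assms by (force simp: hyp_cross_def)+

lemma truncation_bound_of_lp_bounded: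
  assumes s: "1 \<le> s" and r: "1 \<le> r2" "r2 \<le> r1"
    and bd: "\<exists>C>0. \<forall>n\<ge>exp 1. \<forall>F. finite F \<longrightarrow> (\<forall>(k, j)\<in>F. 1 \<le> k \<and> 1 \<le> j \<and> n \<le> real k * real j powr \<gamma>) \<longrightarrow>
      lp_bounded (1 - 1/s) F (\<lambda>(k, j). real k powr (-(\<mu> - 2 * real r1 + 1/2)) * real j powr (-(\<mu> - 2 * real r2 + 1/2)))
        (C * (n powr ((1 - 1/s) - (\<mu> - 2 * real r1 + 1/2)) * ln n powr y))"
  shows "truncation_bound s \<mu> r1 r2 \<gamma> y"
proof -
  have r1: "1 \<le> r1" using r by simp
  obtain C where C: "0 < C" "\<forall>n\<ge>exp 1. \<forall>F. finite F \<longrightarrow> (\<forall>(k, j)\<in>F. 1 \<le> k \<and> 1 \<le> j \<and> n \<le> real k * real j powr \<gamma>) \<longrightarrow>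
      lp_bounded (1 - 1/s) F (\<lambda>(k, j). real k powr (-(\<mu> - 2 * real r1 + 1/2)) * real j powr (-(\<mu> - 2 * real r2 + 1/2)))
        (C * (n powr ((1 - 1/s) - (\<mu> - 2 * real r1 + 1/2)) * ln n powr y))"
    using bd by (elim exE conjE) (rule that)
  obtain D where D: "D > 0" "\<forall>F u. F \<subseteq> {1..} \<times> {1..} \<longrightarrow>
    (\<Sum>i\<in>F. l2norm (lebesgue_on Qsq) (\<lambda>x. u i * deriv_tensor r1 r2 i x))
      \<le> D * (\<Sum>(k, j)\<in>F. \<bar>u (k, j)\<bar> * (real k powr (2 * real r1 - 1/2) * real j powr (2 * real r2 - 1/2)))"
    using l2norm_deriv_tensor_sum_le_weighted_l1[OF r1 r(1)] by (elim exE conjE) (rule that)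
  show ?thesis
    unfolding truncation_bound_def
  proof (intro exI[of _ "D * C"] conjI allI impI)
    fix n f F
    assume n: "exp 1 \<le> (n::real)" and f: "f \<in> smooth_class s \<mu>" "smooth_norm s \<mu> f \<le> 1"
      and F: "finite F" "F \<subseteq> {r1..} \<times> {r2..} - hyp_cross r1 r2 n \<gamma>"
    note F' = outside_hyp_crossD[OF F(2) r1 r(1)]
    have "(\<Sum>(k, j)\<in>F. \<bar>coef f k j\<bar> * (real k powr (2 * real r1 - 1/2) * real j powr (2 * real r2 - 1/2)))
        \<le> C * (n powr ((1 - 1/s) - (\<mu> - 2 * real r1 + 1/2)) * ln n powr y)"
      by (rule coef_weighted_l1_le[OF f s F(1) F'(2) _
          C(2)[THEN spec, THEN mp, OF n, THEN spec, THEN mp, OF F(1), THEN mp, OF F'(1)]])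
        (intro mult_pos_pos C(1) rate_pos n)
    also have "(1 - 1/s) - (\<mu> - 2 * real r1 + 1/2) = -(\<mu> - 2 * real r1 + 1/s - 1/2)" by simp
    finally have "D * (\<Sum>(k, j)\<in>F. \<bar>coef f k j\<bar> * (real k powr (2 * real r1 - 1/2) * real j powr (2 * real r2 - 1/2)))
        \<le> D * (C * (n powr (-(\<mu> - 2 * real r1 + 1/s - 1/2)) * ln n powr y))"
      using D(1) by (rule mult_left_mono[OF _ less_imp_le])
    with D(2)[THEN spec, THEN spec, THEN mp, OF F'(2), of "\<lambda>(k, j). coef f k j"]
    have "(\<Sum>i\<in>F. l2norm (lebesgue_on Qsq) (\<lambda>x. (case i of (k, j) \<Rightarrow> coef f k j) * deriv_tensor r1 r2 i x))
        \<le> D * C * (n powr (-(\<mu> - 2 * real r1 + 1/s - 1/2)) * ln n powr y)"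
      unfolding prod.case mult.assoc by (rule order.trans)
    then show "l2norm (lebesgue_on Qsq) (\<lambda>x. \<Sum>i\<in>F. (case i of (k, j) \<Rightarrow> coef f k j) * deriv_tensor r1 r2 i x)
       \<le> D * C * (n powr (-(\<mu> - 2 * real r1 + 1/s - 1/2)) * ln n powr y)"
      by (rule order.trans[OF l2norm_deriv_tensor_sum_le])
  qed (use C(1) D(1) in simp)
qed

text \<open>The hypothesis on \<gamma> says \<gamma> < b/a, the convergence condition of the sum
  outside the cross at the conjugate exponent of \<open>s\<close>.\<close>

lemma truncation_bound_subcritical:
  assumes s: "1 \<le> s" and r: "1 \<le> r2" "r2 \<le> r1" and \<mu>: "\<mu> > 2 * real r1 + 1/2 - 1/s"
    and \<gamma>: "\<gamma> * (\<mu> - 2 * real r1 + 1/s - 1/2) < \<mu> - 2 * real r2 + 1/s - 1/2"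
  shows "truncation_bound s \<mu> r1 r2 \<gamma> 0"
proof (rule truncation_bound_of_lp_bounded[OF s r])
  have 1: "0 \<le> 1 - 1/s" "1 - 1/s < \<mu> - 2 * real r1 + 1/2" using s \<mu> by auto
  have 2: "\<gamma> * ((\<mu> - 2 * real r1 + 1/2) - (1 - 1/s)) < (\<mu> - 2 * real r2 + 1/2) - (1 - 1/s)"
    using \<gamma> by (simp add: algebra_simps)
  obtain C where C: "0 < C" "\<forall>n>0. \<forall>F. finite F \<longrightarrow> (\<forall>(k, j)\<in>F. 1 \<le> k \<and> 1 \<le> j \<and> n \<le> real k * real j powr \<gamma>) \<longrightarrow>
      lp_bounded (1 - 1/s) F (\<lambda>(k, j). real k powr (-(\<mu> - 2 * real r1 + 1/2)) * real j powr (-(\<mu> - 2 * real r2 + 1/2)))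
        (C * n powr ((1 - 1/s) - (\<mu> - 2 * real r1 + 1/2)))"
    using lp_bounded_outside_hyp_cross[OF 1 2] by (elim exE conjE) (rule that)
  show "\<exists>C>0. \<forall>n\<ge>exp 1. \<forall>F. finite F \<longrightarrow> (\<forall>(k, j)\<in>F. 1 \<le> k \<and> 1 \<le> j \<and> n \<le> real k * real j powr \<gamma>) \<longrightarrow>
      lp_bounded (1 - 1/s) F (\<lambda>(k, j). real k powr (-(\<mu> - 2 * real r1 + 1/2)) * real j powr (-(\<mu> - 2 * real r2 + 1/2)))
        (C * (n powr ((1 - 1/s) - (\<mu> - 2 * real r1 + 1/2)) * ln n powr 0))"
  proof (intro exI[of _ C] conjI allI impI)
    fix n F assume n: "exp 1 \<le> (n::real)" and F: "finite F" "\<forall>(k, j)\<in>F. 1 \<le> k \<and> 1 \<le> j \<and> n \<le> real k * real j powr \<gamma>"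
    have n0: "0 < n" and "ln n powr 0 = 1" using ln_ge_1[OF n] by auto
    then show "lp_bounded (1 - 1/s) F (\<lambda>(k, j). real k powr (-(\<mu> - 2 * real r1 + 1/2)) * real j powr (-(\<mu> - 2 * real r2 + 1/2)))
        (C * (n powr ((1 - 1/s) - (\<mu> - 2 * real r1 + 1/2)) * ln n powr 0))"
      using C(2)[THEN spec, THEN mp, OF n0, THEN spec, THEN mp, OF F(1), THEN mp, OF F(2)] by (simp only: mult_1_right)
  qed (rule C)
qed

text \<open>This covers \<gamma> = b/a, hence also \<gamma> = 1 for r1 = r2. The exponent
  \<open>1 - 1/s\<close> is the conjugate reciprocal exponent in Hoelder's inequality.\<close>

lemma truncation_bound_critical:
  assumes s: "1 \<le> s" and r: "1 \<le> r2" "r2 \<le> r1" and \<mu>: "\<mu> > 2 * real r1 + 1/2 - 1/s"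
    and \<gamma>: "0 < \<gamma>" "\<gamma> * (\<mu> - 2 * real r1 + 1/s - 1/2) = \<mu> - 2 * real r2 + 1/s - 1/2"
  shows "truncation_bound s \<mu> r1 r2 \<gamma> (1 - 1/s)"
proof (rule truncation_bound_of_lp_bounded[OF s r])
  have 1: "0 \<le> 1 - 1/s" "1 - 1/s < \<mu> - 2 * real r1 + 1/2" using s \<mu> by auto
  have e: "\<gamma> * ((\<mu> - 2 * real r1 + 1/2) - (1 - 1/s)) = (\<mu> - 2 * real r2 + 1/2) - (1 - 1/s)"
    using \<gamma>(2) by (simp add: algebra_simps)
  show "\<exists>C>0. \<forall>n\<ge>exp 1. \<forall>F. finite F \<longrightarrow> (\<forall>(k, j)\<in>F. 1 \<le> k \<and> 1 \<le> j \<and> n \<le> real k * real j powr \<gamma>) \<longrightarrow>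
      lp_bounded (1 - 1/s) F (\<lambda>(k, j). real k powr (-(\<mu> - 2 * real r1 + 1/2)) * real j powr (-(\<mu> - 2 * real r2 + 1/2)))
        (C * (n powr ((1 - 1/s) - (\<mu> - 2 * real r1 + 1/2)) * ln n powr (1 - 1/s)))"
    by (rule lp_bounded_outside_hyp_cross_critical[OF 1 \<gamma>(1) e])
qed

text \<open>For \<open>s > 2\<close> the triangle inequality loses a power of the logarithm at the critical \<open>\<gamma>\<close>; the
  weighted \<open>\<ell>\<^sub>2\<close> bound does not.\<close>

lemma truncation_bound_critical_l2:
  assumes s: "2 \<le> s" and r: "1 \<le> r2" "r2 \<le> r1" and \<mu>: "\<mu> > 2 * real r1 + 1/2 - 1/s"
    and \<gamma>: "0 < \<gamma>" "\<gamma> * (\<mu> - 2 * real r1 + 1/s - 1/2) = \<mu> - 2 * real r2 + 1/s - 1/2"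
  shows "truncation_bound s \<mu> r1 r2 \<gamma> (1/2 - 1/s)"
proof -
  have r1: "1 \<le> r1" using r by simp
  \<comment> \<open>Squaring doubles both exponents, so the critical \<gamma> is the same. The
    squared error carries \<open>ln n powr (1 - 2/s)\<close>; the square root halves this to
    \<open>1/2 - 1/s\<close>.\<close>
  have two: "(2 * \<mu> - 4 * real r) - (1 - 2/s) = 2 * (\<mu> - 2 * real r + 1/s - 1/2)" for r
    by (simp add: field_simps)
  have 1: "0 \<le> 1 - 2/s" using s by auto
  have 2: "1 - 2/s < 2 * \<mu> - 4 * real r1" using two[of r1] \<mu> by linarith
  have e: "\<gamma> * ((2 * \<mu> - 4 * real r1) - (1 - 2/s)) = (2 * \<mu> - 4 * real r2) - (1 - 2/s)"
    by (simp only: two mult.left_commute[of \<gamma> 2] \<gamma>(2))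
  obtain C where C: "0 < C" "\<forall>n\<ge>exp 1. \<forall>F. finite F \<longrightarrow> (\<forall>(k, j)\<in>F. 1 \<le> k \<and> 1 \<le> j \<and> n \<le> real k * real j powr \<gamma>) \<longrightarrow>
      lp_bounded (1 - 2/s) F (\<lambda>(k, j). real k powr (-(2 * \<mu> - 4 * real r1)) * real j powr (-(2 * \<mu> - 4 * real r2)))
        (C * (n powr ((1 - 2/s) - (2 * \<mu> - 4 * real r1)) * ln n powr (1 - 2/s)))"
    using lp_bounded_outside_hyp_cross_critical[OF 1 2 \<gamma>(1) e] by (elim exE conjE) (rule that)
  obtain D where D: "D > 0" "\<forall>F u. finite F \<longrightarrow> F \<subseteq> {1..} \<times> {1..} \<longrightarrow>
    (l2norm (lebesgue_on Qsq) (\<lambda>x. \<Sum>i\<in>F. u i * deriv_tensor r1 r2 i x))\<^sup>2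
      \<le> D * (\<Sum>(k, j)\<in>F. (u (k, j))\<^sup>2 * (real k powr (4 * real r1) * real j powr (4 * real r2)))"
    using l2norm_deriv_tensor_sum_le_weighted_l2[OF r1 r(1)] by (elim exE conjE) (rule that)
  show ?thesis
    unfolding truncation_bound_def
  proof (intro exI[of _ "sqrt (D * C)"] conjI allI impI)
    fix n f F
    assume n: "exp 1 \<le> (n::real)" and f: "f \<in> smooth_class s \<mu>" "smooth_norm s \<mu> f \<le> 1"
      and F: "finite F" "F \<subseteq> {r1..} \<times> {r2..} - hyp_cross r1 r2 n \<gamma>"
    note F' = outside_hyp_crossD[OF F(2) r1 r(1)]
    have sq: "(x powr c)\<^sup>2 = x powr (2 * c)" for x c :: real
      unfolding power2_eq_square powr_add[symmetric] by simp
    have "(\<Sum>(k, j)\<in>F. (coef f k j)\<^sup>2 * (real k powr (4 * real r1) * real j powr (4 * real r2)))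
        \<le> C * (n powr ((1 - 2/s) - (2 * \<mu> - 4 * real r1)) * ln n powr (1 - 2/s))"
      by (rule coef_weighted_l2_le[OF f s F(1) F'(2) _
          C(2)[THEN spec, THEN mp, OF n, THEN spec, THEN mp, OF F(1), THEN mp, OF F'(1)]])
        (intro mult_pos_pos C(1) rate_pos n)
    also have "(1 - 2/s) - (2 * \<mu> - 4 * real r1) = 2 * (-(\<mu> - 2 * real r1 + 1/s - 1/2))"
      using two[of r1] by linarith
    also have "1 - 2/s = 2 * (1/2 - 1/s)" by simp
    finally have "D * (\<Sum>(k, j)\<in>F. (coef f k j)\<^sup>2 * (real k powr (4 * real r1) * real j powr (4 * real r2)))
        \<le> D * (C * (n powr (2 * (-(\<mu> - 2 * real r1 + 1/s - 1/2))) * ln n powr (2 * (1/2 - 1/s))))"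
      using D(1) by (rule mult_left_mono[OF _ less_imp_le])
    also have "\<dots> = (sqrt (D * C))\<^sup>2 * (n powr (2 * (-(\<mu> - 2 * real r1 + 1/s - 1/2))) * ln n powr (2 * (1/2 - 1/s)))"
      using C(1) D(1) by simp
    also have "\<dots> = (sqrt (D * C) * (n powr (-(\<mu> - 2 * real r1 + 1/s - 1/2)) * ln n powr (1/2 - 1/s)))\<^sup>2"
      by (simp only: power_mult_distrib sq)
    finally have "D * (\<Sum>(k, j)\<in>F. (case (k, j) of (k, j) \<Rightarrow> coef f k j)\<^sup>2 * (real k powr (4 * real r1) * real j powr (4 * real r2)))
        \<le> (sqrt (D * C) * (n powr (-(\<mu> - 2 * real r1 + 1/s - 1/2)) * ln n powr (1/2 - 1/s)))\<^sup>2"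
      unfolding prod.case .
    then have "(l2norm (lebesgue_on Qsq) (\<lambda>x. \<Sum>i\<in>F. (case i of (k, j) \<Rightarrow> coef f k j) * deriv_tensor r1 r2 i x))\<^sup>2
        \<le> (sqrt (D * C) * (n powr (-(\<mu> - 2 * real r1 + 1/s - 1/2)) * ln n powr (1/2 - 1/s)))\<^sup>2"
      by (rule order.trans[OF D(2)[THEN spec, THEN spec, THEN mp, OF F(1), THEN mp, OF F'(2)]])
    then show "l2norm (lebesgue_on Qsq) (\<lambda>x. \<Sum>i\<in>F. (case i of (k, j) \<Rightarrow> coef f k j) * deriv_tensor r1 r2 i x)
       \<le> sqrt (D * C) * (n powr (-(\<mu> - 2 * real r1 + 1/s - 1/2)) * ln n powr (1/2 - 1/s))"
      by (rule power2_le_imp_le) (use C(1) D(1) in simp)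
  qed (use C(1) D(1) in simp)
qed

lemma propagation_bound_of_lp_bounded:
  assumes q: "0 \<le> q" "q \<le> 1" and r: "1 \<le> r2" "r2 \<le> r1" and \<gamma>: "1 \<le> \<gamma>"
    and bd: "\<exists>C>0. \<forall>n\<ge>exp 1. \<forall>F. finite F \<longrightarrow> (\<forall>(k, j)\<in>F. 1 \<le> k \<and> 1 \<le> j \<and> real k * real j powr \<gamma> \<le> n) \<longrightarrow>
      lp_bounded (1 - q) F (\<lambda>(k, j). real k powr (2 * real r1 - 1/2) * real j powr (2 * real r2 - 1/2))
        (C * (n powr (2 * real r1 - 1/2 + (1 - q)) * ln n powr z))"
  shows "propagation_bound q r1 r2 \<gamma> z"
proof -
  have r1: "1 \<le> r1" using r by simp
  obtain C where C: "0 < C" "\<forall>n\<ge>exp 1. \<forall>F. finite F \<longrightarrow> (\<forall>(k, j)\<in>F. 1 \<le> k \<and> 1 \<le> j \<and> real k * real j powr \<gamma> \<le> n) \<longrightarrow>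
      lp_bounded (1 - q) F (\<lambda>(k, j). real k powr (2 * real r1 - 1/2) * real j powr (2 * real r2 - 1/2))
        (C * (n powr (2 * real r1 - 1/2 + (1 - q)) * ln n powr z))"
    using bd by (elim exE conjE) (rule that)
  obtain D where D: "D > 0" "\<forall>F u. F \<subseteq> {1..} \<times> {1..} \<longrightarrow>
    (\<Sum>i\<in>F. l2norm (lebesgue_on Qsq) (\<lambda>x. u i * deriv_tensor r1 r2 i x))
      \<le> D * (\<Sum>(k, j)\<in>F. \<bar>u (k, j)\<bar> * (real k powr (2 * real r1 - 1/2) * real j powr (2 * real r2 - 1/2)))"
    using l2norm_deriv_tensor_sum_le_weighted_l1[OF r1 r(1)] by (elim exE conjE) (rule that)
  show ?thesis
    unfolding propagation_bound_def
  proof (intro exI[of _ "D * C"] conjI allI impI)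
    fix n \<delta> :: real and \<xi> :: "nat \<times> nat \<Rightarrow> real"
    let ?F = "hyp_cross r1 r2 n \<gamma>"
    assume n: "exp 1 \<le> n" and \<delta>: "0 < \<delta>" and \<xi>: "lp_bounded q ?F (\<lambda>i. \<bar>\<xi> i\<bar>) \<delta>"
    have F: "finite ?F" using \<gamma> r1 r by (intro finite_hyp_cross) auto
    have F': "?F \<subseteq> {1..} \<times> {1..}" "\<forall>(k, j)\<in>?F. 1 \<le> k \<and> 1 \<le> j \<and> real k * real j powr \<gamma> \<le> n"
      using r by (auto simp: hyp_cross_def)
    have e: "2 * real r1 - 1/2 + (1 - q) = 2 * real r1 + 1/2 - q" by simp
    have "(\<Sum>i\<in>?F. \<bar>\<xi> i\<bar> * (case i of (k, j) \<Rightarrow> real k powr (2 * real r1 - 1/2) * real j powr (2 * real r2 - 1/2)))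
        \<le> \<delta> * (C * (n powr (2 * real r1 - 1/2 + (1 - q)) * ln n powr z))"
      by (rule Hoelder_sum[OF _ _ _ \<xi>
            C(2)[THEN spec, THEN mp, OF n, THEN spec, THEN mp, OF F, THEN mp, OF F'(2)]])
        (use q \<delta> in \<open>auto split: prod.split intro!: mult_pos_pos C(1) rate_pos n\<close>)
    then have "(\<Sum>(k, j)\<in>?F. \<bar>\<xi> (k, j)\<bar> * (real k powr (2 * real r1 - 1/2) * real j powr (2 * real r2 - 1/2)))
        \<le> \<delta> * (C * (n powr (2 * real r1 + 1/2 - q) * ln n powr z))"
      unfolding e by (simp add: case_prod_beta)
    then have "D * (\<Sum>(k, j)\<in>?F. \<bar>\<xi> (k, j)\<bar> * (real k powr (2 * real r1 - 1/2) * real j powr (2 * real r2 - 1/2)))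
        \<le> D * (\<delta> * (C * (n powr (2 * real r1 + 1/2 - q) * ln n powr z)))"
      using D(1) by (rule mult_left_mono[OF _ less_imp_le])
    then have "(\<Sum>i\<in>?F. l2norm (lebesgue_on Qsq) (\<lambda>x. \<xi> i * deriv_tensor r1 r2 i x))
        \<le> D * (\<delta> * (C * (n powr (2 * real r1 + 1/2 - q) * ln n powr z)))"
      by (rule order.trans[OF D(2)[THEN spec, THEN spec, THEN mp, OF F'(1), of \<xi>]])
    also have "\<dots> = D * C * \<delta> * (n powr (2 * real r1 + 1/2 - q) * ln n powr z)" by (simp only: ac_simps)
    finally show "l2norm (lebesgue_on Qsq) (\<lambda>x. \<Sum>i\<in>?F. \<xi> i * deriv_tensor r1 r2 i x)
       \<le> D * C * \<delta> * (n powr (2 * real r1 + 1/2 - q) * ln n powr z)"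
      by (rule order.trans[OF l2norm_deriv_tensor_sum_le])
  qed (use C(1) D(1) in simp)
qed

text \<open>Since r2 < r1, the weight grows strictly more slowly in \<open>j\<close> than in
  \<open>k\<close>; the sum over \<open>j\<close> converges already at \<gamma> = 1, and a larger
  \<gamma> only helps.\<close>

lemma propagation_bound_anisotropic:
  assumes q: "0 \<le> q" "q \<le> 1" and r: "1 \<le> r2" "r2 < r1" and \<gamma>: "1 \<le> \<gamma>"
  shows "propagation_bound q r1 r2 \<gamma> 0"
proof (rule propagation_bound_of_lp_bounded[OF q r(1) less_imp_le[OF r(2)] \<gamma>])
  have "(2 * real r2 - 1/2) + (1 - q) < 1 * ((2 * real r1 - 1/2) + (1 - q))" using r by simp
  also have "\<dots> \<le> \<gamma> * ((2 * real r1 - 1/2) + (1 - q))" using \<gamma> q r by (intro mult_right_mono) auto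
  finally have 1: "(2 * real r2 - 1/2) + (1 - q) < \<gamma> * ((2 * real r1 - 1/2) + (1 - q))" .
  have 2: "0 \<le> 1 - q" "0 \<le> 2 * real r1 - 1/2" using q r by auto
  obtain C where C: "0 < C" "\<forall>n>0. \<forall>F. finite F \<longrightarrow> (\<forall>(k, j)\<in>F. 1 \<le> k \<and> 1 \<le> j \<and> real k * real j powr \<gamma> \<le> n) \<longrightarrow>
      lp_bounded (1 - q) F (\<lambda>(k, j). real k powr (2 * real r1 - 1/2) * real j powr (2 * real r2 - 1/2))
        (C * n powr (2 * real r1 - 1/2 + (1 - q)))"
    using lp_bounded_inside_hyp_cross[OF 2 1] by (elim exE conjE) (rule that)
  show "\<exists>C>0. \<forall>n\<ge>exp 1. \<forall>F. finite F \<longrightarrow> (\<forall>(k, j)\<in>F. 1 \<le> k \<and> 1 \<le> j \<and> real k * real j powr \<gamma> \<le> n) \<longrightarrow>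
      lp_bounded (1 - q) F (\<lambda>(k, j). real k powr (2 * real r1 - 1/2) * real j powr (2 * real r2 - 1/2))
        (C * (n powr (2 * real r1 - 1/2 + (1 - q)) * ln n powr 0))"
  proof (intro exI[of _ C] conjI allI impI)
    fix n F assume n: "exp 1 \<le> (n::real)" and F: "finite F" "\<forall>(k, j)\<in>F. 1 \<le> k \<and> 1 \<le> j \<and> real k * real j powr \<gamma> \<le> n"
    have n0: "0 < n" and "ln n powr 0 = 1" using ln_ge_1[OF n] by auto
    then show "lp_bounded (1 - q) F (\<lambda>(k, j). real k powr (2 * real r1 - 1/2) * real j powr (2 * real r2 - 1/2))
        (C * (n powr (2 * real r1 - 1/2 + (1 - q)) * ln n powr 0))"
      using C(2)[THEN spec, THEN mp, OF n0, THEN spec, THEN mp, OF F(1), THEN mp, OF F(2)] by (simp only: mult_1_right)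
  qed (rule C)
qed

lemma propagation_bound_isotropic:
  assumes q: "0 \<le> q" "q \<le> 1" and r: "1 \<le> r"
  shows "propagation_bound q r r 1 (1 - q)"
proof (rule propagation_bound_of_lp_bounded[OF q r order_refl order_refl])
  have 2: "0 \<le> 1 - q" "0 \<le> 2 * real r - 1/2" using q r by auto
  show "\<exists>C>0. \<forall>n\<ge>exp 1. \<forall>F. finite F \<longrightarrow> (\<forall>(k, j)\<in>F. 1 \<le> k \<and> 1 \<le> j \<and> real k * real j powr 1 \<le> n) \<longrightarrow>
      lp_bounded (1 - q) F (\<lambda>(k, j). real k powr (2 * real r - 1/2) * real j powr (2 * real r - 1/2))
        (C * (n powr (2 * real r - 1/2 + (1 - q)) * ln n powr (1 - q)))"
    using lp_bounded_inside_hyp_cross_critical[OF 2] by simp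
qed

section \<open>Assembly of the error estimate\<close>

lemma mixed_deriv_remainder_le:
  assumes g: "has_mixed_deriv r1 r2 f g" and G: "finite G" "G \<subseteq> {r1..} \<times> {r2..}"
    and K: "\<And>F. finite F \<Longrightarrow> F \<subseteq> {r1..} \<times> {r2..} - G \<Longrightarrow>
      l2norm (lebesgue_on Qsq) (\<lambda>x. \<Sum>i\<in>F. (case i of (k, j) \<Rightarrow> coef f k j) * deriv_tensor r1 r2 i x) \<le> K"
  shows "sq_integrable (lebesgue_on Qsq) g"
    and "l2norm (lebesgue_on Qsq) (\<lambda>x. g x - (\<Sum>i\<in>G. (case i of (k, j) \<Rightarrow> coef f k j) * deriv_tensor r1 r2 i x)) \<le> K"
proof -
  let ?M = "lebesgue_on Qsq" and ?I = "{r1..} \<times> {r2..}"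
  let ?S = "\<lambda>F x. \<Sum>i\<in>F. (case i of (k, j) \<Rightarrow> coef f k j) * deriv_tensor r1 r2 i x"
  have eq: "(\<lambda>(t, \<tau>). g (t, \<tau>) - (\<Sum>(k, j)\<in>F. coef f k j * legendre_deriv r1 k t * legendre_deriv r2 j \<tau>))
      = (\<lambda>x. g x - ?S F x)" for F
    by (auto simp: fun_eq_iff deriv_tensor_def case_prod_beta mult.assoc)
  show sg: "sq_integrable ?M g"
    using g by (simp add: has_mixed_deriv_def in_L2_iff)
  have lim: "((\<lambda>F. l2norm ?M (\<lambda>x. g x - ?S F x)) \<longlongrightarrow> 0) (finite_subsets_at_top ?I)"
    using g unfolding has_mixed_deriv_def L2_norm_eq eq by simp
  \<comment> \<open>For \<open>F\<close> containing \<open>G\<close>, the difference of the two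
    partial sums runs over a finite set outside \<open>G\<close> and is bounded by \<open>K\<close>;
    the distance from \<open>g\<close> to the partial sum over \<open>F\<close> tends to 0.\<close>
  have "eventually (\<lambda>F. l2norm ?M (\<lambda>x. g x - ?S G x) - K \<le> l2norm ?M (\<lambda>x. g x - ?S F x)) (finite_subsets_at_top ?I)"
    unfolding eventually_finite_subsets_at_top
  proof (intro exI[of _ G] conjI G allI impI)
    fix F assume F: "finite F \<and> G \<subseteq> F \<and> F \<subseteq> ?I"
    have "?S F x = ?S G x + ?S (F - G) x" for x
      using F sum.subset_diff[of G F "\<lambda>i. (case i of (k, j) \<Rightarrow> coef f k j) * deriv_tensor r1 r2 i x"] by linarith
    then have "(\<lambda>x. g x - ?S G x) = (\<lambda>x. (g x - ?S F x) + ?S (F - G) x)" by auto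
    then have "l2norm ?M (\<lambda>x. g x - ?S G x) \<le> l2norm ?M (\<lambda>x. g x - ?S F x) + l2norm ?M (?S (F - G))"
      using l2norm_triangle[OF sq_integrable_diff[OF sg sq_integrable_deriv_tensor_sum] sq_integrable_deriv_tensor_sum]
      by simp
    also have "l2norm ?M (?S (F - G)) \<le> K" using F by (intro K) auto
    finally show "l2norm ?M (\<lambda>x. g x - ?S G x) - K \<le> l2norm ?M (\<lambda>x. g x - ?S F x)" by simp
  qed
  from tendsto_lowerbound[OF lim this] show "l2norm ?M (\<lambda>x. g x - ?S G x) \<le> K" by simp
qed

text \<open>The parameter \<open>e\<close> is the logarithmic correction in the choice of
  \<open>n\<close>, and \<open>x\<close> the logarithm exponent of the rate. \<open>N\<close> and
  \<open>B\<close> are prescribed only on the unit interval, where \<open>ln (1/\<delta>)\<close> is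
  positive, so that each rate can be supplied in the form in which it is stated.\<close>

lemma error_rate_of_bounds:
  fixes s \<mu> c1 c2 e x y z :: real and p :: ereal
  defines "q \<equiv> real_of_ereal (1 / p)"
  defines "M \<equiv> \<mu> - q + 1/s"
  assumes s: "1 \<le> s" and p: "1 \<le> p" "q \<le> 1" and r: "1 \<le> r2" "r2 \<le> r1"
    and \<mu>: "\<mu> > 2 * real r1 + 1/2 - 1/s" and c: "0 < c1" "0 < c2" and \<gamma>: "1 \<le> \<gamma>"
    and trunc: "truncation_bound s \<mu> r1 r2 \<gamma> y" and noise: "propagation_bound q r1 r2 \<gamma> z"
    and exps: "0 \<le> y" "y \<le> x" "0 \<le> z" "e + z \<le> x"
    and N: "\<And>\<delta>. 0 < \<delta> \<Longrightarrow> \<delta> < 1 \<Longrightarrow> N \<delta> = (\<delta> / ln (1/\<delta>) powr e) powr (-(1/M))"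
    and B: "\<And>\<delta>. 0 < \<delta> \<Longrightarrow> \<delta> < 1 \<Longrightarrow>
      B \<delta> = (\<delta> / ln (1/\<delta>) powr e) powr ((\<mu> - 2 * real r1 + 1/s - 1/2) / M) * ln (1/\<delta>) powr x"
  shows "error_rate s \<mu> p r1 r2 \<gamma> c1 c2 N B"
proof -
  define \<alpha> where "\<alpha> = \<mu> - 2 * real r1 + 1/s - 1/2"
  define \<beta> where "\<beta> = 2 * real r1 + 1/2 - q"
  have \<alpha>\<beta>: "0 < \<alpha>" "0 < \<beta>" "M = \<alpha> + \<beta>"
    using \<mu> p r by (auto simp: \<alpha>_def \<beta>_def M_def)
  let ?M = "lebesgue_on Qsq"
  obtain C1 where C1: "0 < C1" "\<forall>n\<ge>exp 1. \<forall>f F.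
     f \<in> smooth_class s \<mu> \<longrightarrow> smooth_norm s \<mu> f \<le> 1 \<longrightarrow>
     finite F \<longrightarrow> F \<subseteq> {r1..} \<times> {r2..} - hyp_cross r1 r2 n \<gamma> \<longrightarrow>
     l2norm ?M (\<lambda>x. \<Sum>i\<in>F. (case i of (k, j) \<Rightarrow> coef f k j) * deriv_tensor r1 r2 i x)
       \<le> C1 * (n powr (-\<alpha>) * ln n powr y)"
    using trunc[unfolded truncation_bound_def, folded \<alpha>_def] by (elim exE conjE) (rule that)
  obtain C2 where C2: "0 < C2" "\<forall>n\<ge>exp 1. \<forall>\<delta>>0. \<forall>\<xi>.
     lp_bounded q (hyp_cross r1 r2 n \<gamma>) (\<lambda>i. \<bar>\<xi> i\<bar>) \<delta> \<longrightarrow>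
     l2norm ?M (\<lambda>x. \<Sum>i\<in>hyp_cross r1 r2 n \<gamma>. \<xi> i * deriv_tensor r1 r2 i x)
       \<le> C2 * \<delta> * (n powr \<beta> * ln n powr z)"
    using noise[unfolded propagation_bound_def, folded \<beta>_def] by (elim exE conjE) (rule that)
  obtain c \<delta>0 where c0: "0 < c" "\<delta>0 \<in> {0<..<1}" and rate: "\<forall>\<delta>\<in>{0<..<\<delta>0}. \<forall>n.
    c1 * (\<delta> / ln (1/\<delta>) powr e) powr (-(1/M)) \<le> n \<and> n \<le> c2 * (\<delta> / ln (1/\<delta>) powr e) powr (-(1/M)) \<longrightarrow>
    exp 1 \<le> n \<and> C1 * (n powr (-\<alpha>) * ln n powr y) + C2 * \<delta> * (n powr \<beta> * ln n powr z)
      \<le> c * ((\<delta> / ln (1/\<delta>) powr e) powr (\<alpha> / M) * ln (1/\<delta>) powr x)"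
    using rate_asymptotics[OF \<alpha>\<beta>(1,2) c C1(1) C2(1) exps \<alpha>\<beta>(3)] by (elim exE conjE bexE) (rule that)
  show ?thesis
    unfolding error_rate_def
  proof (intro exI[of _ c] conjI bexI[of _ \<delta>0] ballI allI impI c0)
    fix \<delta> n f yy
    assume \<delta>: "\<delta> \<in> {0<..<\<delta>0}" and A: "c1 * N \<delta> \<le> n \<and> n \<le> c2 * N \<delta> \<and>
        f \<in> smooth_class s \<mu> \<and> smooth_norm s \<mu> f \<le> 1 \<and>
        in_lp p (\<lambda>(k, j). coef f k j - yy k j) \<and>
        lp_norm p (\<lambda>(k, j). coef f k j - yy k j) \<le> \<delta>"
    have \<delta>01: "0 < \<delta>" "\<delta> < 1" using \<delta> c0 by auto
    have f: "f \<in> smooth_class s \<mu>" "smooth_norm s \<mu> f \<le> 1" using A by auto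
    have "c1 * (\<delta> / ln (1/\<delta>) powr e) powr (-(1/M)) \<le> n \<and> n \<le> c2 * (\<delta> / ln (1/\<delta>) powr e) powr (-(1/M))"
      using A N[OF \<delta>01] by simp
    with rate[THEN bspec, OF \<delta>, THEN spec, of n]
    have n: "exp 1 \<le> n" and le: "C1 * (n powr (-\<alpha>) * ln n powr y) + C2 * \<delta> * (n powr \<beta> * ln n powr z) \<le> c * B \<delta>"
      unfolding B[OF \<delta>01] \<alpha>_def by blast+
    obtain g where g: "has_mixed_deriv r1 r2 f g"
      using ex_mixed_deriv[OF f s r \<mu>] by blast
    let ?G = "hyp_cross r1 r2 n \<gamma>"
    have G: "finite ?G" "?G \<subseteq> {r1..} \<times> {r2..}"
      using finite_hyp_cross[of \<gamma> r1 r2 n] \<gamma> r by (auto simp: hyp_cross_def)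
    let ?S = "\<lambda>x. \<Sum>i\<in>?G. (case i of (k, j) \<Rightarrow> coef f k j) * deriv_tensor r1 r2 i x"
    let ?\<xi> = "\<lambda>(k, j). coef f k j - yy k j"
    note rem = mixed_deriv_remainder_le[OF g G,
        OF C1(2)[THEN spec, THEN mp, OF n, THEN spec, THEN spec, THEN mp, OF f(1), THEN mp, OF f(2), THEN mp, THEN mp]]
    have "lp_bounded q ?G (\<lambda>i. \<bar>?\<xi> i\<bar>) \<delta>"
      unfolding q_def using A p G(1) \<delta>01 by (intro lp_bounded_of_lp_norm) auto
    then have noise_le: "l2norm ?M (\<lambda>x. \<Sum>i\<in>?G. ?\<xi> i * deriv_tensor r1 r2 i x) \<le> C2 * \<delta> * (n powr \<beta> * ln n powr z)"
      using C2(2)[THEN spec, THEN mp, OF n, THEN spec, THEN mp, OF \<delta>01(1)] by blast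
    \<comment> \<open>The data are the exact coefficients minus \<open>\<xi>\<close>, so the error
      is the series remainder plus the contribution of \<open>\<xi>\<close> on the cross.\<close>
    have "g x - trunc_deriv r1 r2 n \<gamma> yy x = (g x - ?S x) + (\<Sum>i\<in>?G. ?\<xi> i * deriv_tensor r1 r2 i x)" for x
      by (simp add: trunc_deriv_def deriv_tensor_def case_prod_beta left_diff_distrib sum_subtractf mult.assoc)
    then have "L2_norm (\<lambda>x. g x - trunc_deriv r1 r2 n \<gamma> yy x)
        = l2norm ?M (\<lambda>x. (g x - ?S x) + (\<Sum>i\<in>?G. ?\<xi> i * deriv_tensor r1 r2 i x))"
      by (simp only: L2_norm_eq)
    also have "\<dots> \<le> l2norm ?M (\<lambda>x. g x - ?S x) + l2norm ?M (\<lambda>x. \<Sum>i\<in>?G. ?\<xi> i * deriv_tensor r1 r2 i x)"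
      by (rule l2norm_triangle[OF sq_integrable_diff[OF rem(1) sq_integrable_deriv_tensor_sum] sq_integrable_deriv_tensor_sum])
    also have "\<dots> \<le> c * B \<delta>"
      using rem(2) noise_le le by linarith
    finally show "\<exists>g. has_mixed_deriv r1 r2 f g \<and> L2_norm (\<lambda>x. g x - trunc_deriv r1 r2 n \<gamma> yy x) \<le> c * B \<delta>"
      using g by blast
  qed
qed

lemma real_of_ereal_inverse_bounds:
  assumes "1 \<le> (p :: ereal)"
  shows "0 \<le> real_of_ereal (1 / p)" "real_of_ereal (1 / p) \<le> 1"
  using assms by (cases p; simp add: one_ereal_def divide_le_eq)+

theorem theorem0p2p3:
  fixes s \<mu> c1 c2 :: real and p :: ereal and r1 r2 :: nat
  assumes "1 \<le> s" and "1 \<le> p" and "1 \<le> r2" and "r2 \<le> r1"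
    and "\<mu> > 2 * real r1 + 1/2 - 1/s"
    and "0 < c1" and "0 < c2"
  shows "let q = real_of_ereal (1 / p); M = \<mu> - q + 1/s in
    (r1 = r2 \<longrightarrow>
      error_rate s \<mu> p r1 r1 1 c1 c2
        (\<lambda>\<delta>. (\<delta> / ln (1/\<delta>) powr (q - 1/s)) powr (- (1/M)))
        (\<lambda>\<delta>. (\<delta> * ln (1/\<delta>) powr (1/s - q)) powr ((\<mu> - 2 * real r1 + 1/s - 1/2) / M)
               * ln (1/\<delta>) powr (3/2 - 1/s))) \<and>
    (r2 < r1 \<longrightarrow>
      (\<forall>\<gamma> \<in> {1 ..< (\<mu> - 2 * real r2 + 1/s - 1/2) / (\<mu> - 2 * real r1 + 1/s + 1/2)}
            \<union> {(\<mu> - 2 * real r2 + 1/s - 1/2) / (\<mu> - 2 * real r1 + 1/s + 1/2)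
                 <..< (\<mu> - 2 * real r2 + 1/s + 1/2) / (\<mu> - 2 * real r1 + 1/s + 1/2)}
            \<union> {(\<mu> - 2 * real r2 + 1/s + 1/2) / (\<mu> - 2 * real r1 + 1/s + 1/2)
                 <..< (\<mu> - 2 * real r2 + 1/s - 1/2) / (\<mu> - 2 * real r1 + 1/s - 1/2)}.
        error_rate s \<mu> p r1 r2 \<gamma> c1 c2
          (\<lambda>\<delta>. \<delta> powr (- (1/M)))
          (\<lambda>\<delta>. \<delta> powr ((\<mu> - 2 * real r1 + 1/s - 1/2) / M))) \<and>
      (\<forall>\<gamma> \<in> {(\<mu> - 2 * real r2 + 1/s - 1/2) / (\<mu> - 2 * real r1 + 1/s + 1/2),
              (\<mu> - 2 * real r2 + 1/s - 1/2) / (\<mu> - 2 * real r1 + 1/s - 1/2)}.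
        error_rate s \<mu> p r1 r2 \<gamma> c1 c2
          (\<lambda>\<delta>. \<delta> powr (- (1/M)) * ln (1/\<delta>) powr (1 / (2 * M)))
          (\<lambda>\<delta>. (\<delta> / ln (1/\<delta>) powr (1/2)) powr ((\<mu> - 2 * real r1 + 1/s - 1/2) / M)
                 * ln (1/\<delta>) powr (1/2))) \<and>
      (\<forall>\<gamma> \<in> {(\<mu> - 2 * real r2 + 1/s + 1/2) / (\<mu> - 2 * real r1 + 1/s + 1/2)}.
        error_rate s \<mu> p r1 r2 \<gamma> c1 c2
          (\<lambda>\<delta>. (\<delta> / ln (1/\<delta>) powr (1 - 1/s)) powr (- (1/M)))
          (\<lambda>\<delta>. (\<delta> / ln (1/\<delta>) powr (1 - 1/s)) powr ((\<mu> - 2 * real r1 + 1/s - 1/2) / M)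
                 * ln (1/\<delta>) powr (1 - 1/s))))"
proof -
  define q where "q = real_of_ereal (1 / p)"
  define M where "M = \<mu> - q + 1/s"
  define a where "a = \<mu> - 2 * real r1 + 1/s - 1/2"
  define b where "b = \<mu> - 2 * real r2 + 1/s - 1/2"
  have a1: "\<mu> - 2 * real r1 + 1/s + 1/2 = a + 1" and b1: "\<mu> - 2 * real r2 + 1/s + 1/2 = b + 1"
    by (simp_all add: a_def b_def)
  have a0: "0 < a" using assms(5) by (simp add: a_def)
  have q: "0 \<le> q" "q \<le> 1" unfolding q_def using real_of_ereal_inverse_bounds[OF assms(2)] .
  have s: "0 \<le> 1/s" "1/s \<le> 1" using assms(1) by auto
  note rate = error_rate_of_bounds[where p = p and s = s and \<mu> = \<mu>, folded q_def, folded M_def,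
      OF assms(1,2) q(2) assms(3-7), folded a_def]
  have isotropic: "error_rate s \<mu> p r1 r1 1 c1 c2
        (\<lambda>\<delta>. (\<delta> / ln (1/\<delta>) powr (q - 1/s)) powr (- (1/M)))
        (\<lambda>\<delta>. (\<delta> * ln (1/\<delta>) powr (1/s - q)) powr (a / M) * ln (1/\<delta>) powr (3/2 - 1/s))"
    if "r1 = r2"
  proof -
    have div: "\<delta> * ln (1/\<delta>) powr (1/s - q) = \<delta> / ln (1/\<delta>) powr (q - 1/s)" for \<delta>
      using powr_minus_divide[of "ln (1/\<delta>)" "q - 1/s"] by simp
    have "truncation_bound s \<mu> r1 r2 1 (1 - 1/s)"
      by (rule truncation_bound_critical[OF assms(1) assms(3-5)]) (use that in auto)
    moreover have "propagation_bound q r1 r2 1 (1 - q)"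
      using propagation_bound_isotropic[OF q assms(3)] that by simp
    \<comment> \<open>Here \<open>y = 1 - 1/s\<close> and \<open>z = 1 - q\<close>; with
      \<open>e = q - 1/s\<close> also \<open>e + z = 1 - 1/s\<close>, and both lie below
      \<open>3/2 - 1/s\<close>.\<close>
    ultimately have "error_rate s \<mu> p r1 r2 1 c1 c2
        (\<lambda>\<delta>. (\<delta> / ln (1/\<delta>) powr (q - 1/s)) powr (- (1/M)))
        (\<lambda>\<delta>. (\<delta> * ln (1/\<delta>) powr (1/s - q)) powr (a / M) * ln (1/\<delta>) powr (3/2 - 1/s))"
      unfolding div by (rule rate[where e = "q - 1/s", OF order_refl]) (use q s in auto)
    then show ?thesis using that by simp
  qed
  \<comment> \<open>Neither error term has a logarithm (\<open>y = z = 0\<close>), so any correction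
    \<open>e \<le> x\<close> in the choice of \<open>n\<close> is admissible.\<close>
  have noncritical: "error_rate s \<mu> p r1 r2 \<gamma> c1 c2 N B"
    if r: "r2 < r1" and \<gamma>: "1 \<le> \<gamma>" "\<gamma> < b / a" and ex: "0 \<le> x" "e \<le> x"
      and N: "\<And>\<delta>. 0 < \<delta> \<Longrightarrow> \<delta> < 1 \<Longrightarrow> N \<delta> = (\<delta> / ln (1/\<delta>) powr e) powr (-(1/M))"
      and B: "\<And>\<delta>. 0 < \<delta> \<Longrightarrow> \<delta> < 1 \<Longrightarrow> B \<delta> = (\<delta> / ln (1/\<delta>) powr e) powr (a / M) * ln (1/\<delta>) powr x"
    for \<gamma> e x N B
  proof -
    have "truncation_bound s \<mu> r1 r2 \<gamma> 0"
      using truncation_bound_subcritical[OF assms(1) assms(3-5), of \<gamma>, folded a_def b_def] \<gamma> a0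
      by (simp add: field_simps)
    then show ?thesis
      by (rule rate[where e = e and x = x, OF \<gamma>(1) _ propagation_bound_anisotropic[OF q assms(3) r \<gamma>(1)]]) (use ex N B in auto)
  qed
  \<comment> \<open>The rate allows \<open>x = 1/2\<close>. The triangle inequality gives
    \<open>y = 1 - 1/s\<close>, which is at most 1/2 only for \<open>s \<le> 2\<close>; for larger
    \<open>s\<close> orthogonality gives \<open>y = 1/2 - 1/s\<close>.\<close>
  have critical: "error_rate s \<mu> p r1 r2 (b / a) c1 c2 N B"
    if r: "r2 < r1"
      and N: "\<And>\<delta>. 0 < \<delta> \<Longrightarrow> \<delta> < 1 \<Longrightarrow> N \<delta> = (\<delta> / ln (1/\<delta>) powr (1/2)) powr (-(1/M))"
      and B: "\<And>\<delta>. 0 < \<delta> \<Longrightarrow> \<delta> < 1 \<Longrightarrow> B \<delta> = (\<delta> / ln (1/\<delta>) powr (1/2)) powr (a / M) * ln (1/\<delta>) powr (1/2)"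
    for N B
  proof -
    have \<gamma>: "1 \<le> b / a" "0 < b / a" "b / a * a = b" using a0 r by (simp_all add: a_def b_def)
    note noise = propagation_bound_anisotropic[OF q assms(3) r \<gamma>(1)]
    show ?thesis
    proof (cases "s \<le> 2")
      case True
      have "truncation_bound s \<mu> r1 r2 (b / a) (1 - 1/s)"
        using truncation_bound_critical[OF assms(1) assms(3-5) \<gamma>(2), folded a_def b_def] \<gamma>(3) by simp
      moreover have "1 - 1/s \<le> 1/2" using True assms(1) by (simp add: field_simps)
      ultimately show ?thesis by (intro rate[where e = "1/2" and x = "1/2" and y = "1 - 1/s", OF \<gamma>(1) _ noise]) (use s N B in auto)
    next
      case False
      then have s2: "2 \<le> s" by simp
      have "truncation_bound s \<mu> r1 r2 (b / a) (1/2 - 1/s)"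
        using truncation_bound_critical_l2[OF s2 assms(3-5) \<gamma>(2), folded a_def b_def] \<gamma>(3) by simp
      moreover have "0 \<le> 1/2 - 1/s" using s2 by (simp add: field_simps)
      ultimately show ?thesis by (intro rate[where e = "1/2" and x = "1/2" and y = "1/2 - 1/s", OF \<gamma>(1) _ noise]) (use s N B in auto)
    qed
  qed
  \<comment> \<open>As r1 and r2 are integers, \<open>r2 < r1\<close> gives
    \<open>b \<ge> a + 2\<close>; this places all the breakpoints in increasing order above
    1.\<close>
  have order: "1 < b / (a + 1)" "b / (a + 1) < (b + 1) / (a + 1)" "(b + 1) / (a + 1) < b / a" if "r2 < r1"
  proof -
    have "real r2 + 1 \<le> real r1" using that by linarith
    then have "a + 2 \<le> b" by (simp add: a_def b_def)
    then show "1 < b / (a + 1)" "b / (a + 1) < (b + 1) / (a + 1)" "(b + 1) / (a + 1) < b / a"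
      using a0 by (simp_all add: field_simps)
  qed
  \<comment> \<open>The strict bound \<open>\<delta> < 1\<close> makes
    \<open>ln (1/\<delta>)\<close> nonzero, so its power with exponent 0 is 1.\<close>
  have one: "\<delta> / ln (1/\<delta>) powr 0 = \<delta>" "ln (1/\<delta>) powr 0 = 1" if "0 < \<delta>" "\<delta> < 1" for \<delta> :: real
    using that by (simp_all add: ln_div)
  have half: "\<delta> powr (- (1/M)) * ln (1/\<delta>) powr (1 / (2 * M)) = (\<delta> / ln (1/\<delta>) powr (1/2)) powr (- (1/M))"
    if "0 < \<delta>" "\<delta> < 1" for \<delta> :: real
    using that by (subst powr_divide) (auto simp: powr_powr divide_powr_uminus ln_div)
  show ?thesis
    unfolding Let_def q_def[symmetric] M_def[symmetric] a1 b1 a_def[symmetric] b_def[symmetric]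
  proof (intro conjI impI ballI isotropic)
    fix \<gamma> assume r: "r2 < r1"
      and "\<gamma> \<in> {1..<b / (a + 1)} \<union> {b / (a + 1)<..<(b + 1) / (a + 1)} \<union> {(b + 1) / (a + 1)<..<b / a}"
    then have "1 \<le> \<gamma>" "\<gamma> < b / a" using order[OF r] by auto
    then show "error_rate s \<mu> p r1 r2 \<gamma> c1 c2 (\<lambda>\<delta>. \<delta> powr (- (1/M))) (\<lambda>\<delta>. \<delta> powr (a / M))"
      by (rule noncritical[OF r, of _ 0 0]) (simp_all only: one order_refl mult_1_right div_by_1)
  next
    fix \<gamma> assume r: "r2 < r1" and \<gamma>: "\<gamma> \<in> {b / (a + 1), b / a}"
    show "error_rate s \<mu> p r1 r2 \<gamma> c1 c2 (\<lambda>\<delta>. \<delta> powr (- (1/M)) * ln (1/\<delta>) powr (1 / (2 * M)))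
        (\<lambda>\<delta>. (\<delta> / ln (1/\<delta>) powr (1/2)) powr (a / M) * ln (1/\<delta>) powr (1/2))"
    proof (cases "\<gamma> = b / a")
      case True
      show ?thesis unfolding True by (rule critical[OF r half refl])
    next
      case False
      then have "1 \<le> \<gamma>" "\<gamma> < b / a" using \<gamma> order[OF r] by auto
      then show ?thesis by (rule noncritical[OF r _ _ _ _ half refl]) simp_all
    qed
  next
    fix \<gamma> assume r: "r2 < r1" and "\<gamma> \<in> {(b + 1) / (a + 1)}"
    then have "1 \<le> \<gamma>" "\<gamma> < b / a" using order[OF r] by auto
    then show "error_rate s \<mu> p r1 r2 \<gamma> c1 c2 (\<lambda>\<delta>. (\<delta> / ln (1/\<delta>) powr (1 - 1/s)) powr (- (1/M)))
        (\<lambda>\<delta>. (\<delta> / ln (1/\<delta>) powr (1 - 1/s)) powr (a / M) * ln (1/\<delta>) powr (1 - 1/s))"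
      by (rule noncritical[OF r _ _ _ _ refl refl]) (use s in simp_all)
  qed
qed

end
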